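(* Let $p\in(0,1)$ be a constant and let $G(n,p)$ be the binomial random graph. Then $G(n,p)$ obeys the $\mathcal{E}_1^2$ zero-one law (i.e. for every sentence $\varphi\in\mathcal{E}_1^2$, $\lim_{n\to\infty}{\sf P}(G(n,p)\models\varphi)$ exists and belongs to $\{0,1\}$) if and only if $p\notin\{\frac{3-\sqrt{5}}{2},\frac{\sqrt{5}-1}{2}\}$. Moreover, if $p\in\{\frac{3-\sqrt{5}}{2},\frac{\sqrt{5}-1}{2}\}$, then $G(n,p)$ does not obey the $\mathcal{E}_1^2$ convergence law, i.e. there is a sentence $\varphi\in\mathcal{E}_1^2$ such that ${\sf P}(G(n,p)\models\varphi)$ does not converge as $n\to\infty$.
   Context: $G(n,p)$ is the random graph on vertex set $\{1,\ldots,n\}$ in which each pair of vertices is joined by an edge independently with probability $p$. Sentences are about undirected graphs, built from the relations $\sim$ (adjacency) and $=$. $\mathcal{E}_1^2$ is the class of existential monadic second order sentences of the form $\exists X\,\phi(X)$, where $X$ is a single monadic (set) variable ranging over subsets of the vertex set and $\phi(X)$ is a first order sentence in $\sim,=$ and the unary predicate $X$ of quantifier depth $2$ (the maximum number of nested first order quantifiers is 2). *)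

theory Defs
  imports Complex_Main
begin

datatype fo = Adj nat nat | Eq nat nat | InX nat | Neg fo | Conj fo fo | Ex nat fo

fun qdepth :: "fo \<Rightarrow> nat" where
  "qdepth (Adj x y) = 0"
| "qdepth (Eq x y) = 0"
| "qdepth (InX x) = 0"
| "qdepth (Neg f) = qdepth f"
| "qdepth (Conj f g) = max (qdepth f) (qdepth g)"
| "qdepth (Ex x f) = Suc (qdepth f)"

fun fv :: "fo \<Rightarrow> nat set" where
  "fv (Adj x y) = {x, y}"
| "fv (Eq x y) = {x, y}"
| "fv (InX x) = {x}"
| "fv (Neg f) = fv f"
| "fv (Conj f g) = fv f \<union> fv g"
| "fv (Ex x f) = fv f - {x}"

fun sat :: "nat set set \<Rightarrow> nat set \<Rightarrow> nat set \<Rightarrow> (nat \<Rightarrow> nat) \<Rightarrow> fo \<Rightarrow> bool" where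
  "sat E V S a (Adj x y) = ({a x, a y} \<in> E)"
| "sat E V S a (Eq x y) = (a x = a y)"
| "sat E V S a (InX x) = (a x \<in> S)"
| "sat E V S a (Neg f) = (\<not> sat E V S a f)"
| "sat E V S a (Conj f g) = (sat E V S a f \<and> sat E V S a g)"
| "sat E V S a (Ex x f) = (\<exists>v\<in>V. sat E V S (a(x := v)) f)"

text \<open>A sentence of E_1^2 is \<exists>X. \<phi>(X) with \<phi> a FO sentence of quantifier depth 2
  (at most 2 nested quantifiers); we represent it by the body \<phi>.\<close>
definition E12 :: "fo \<Rightarrow> bool" where
  "E12 \<phi> \<longleftrightarrow> fv \<phi> = {} \<and> qdepth \<phi> \<le> 2"

definition models_E12 :: "nat set set \<Rightarrow> nat set \<Rightarrow> fo \<Rightarrow> bool" where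
  "models_E12 E V \<phi> \<longleftrightarrow> (\<exists>S\<subseteq>V. sat E V S (\<lambda>_. 0) \<phi>)"

definition all_pairs :: "nat \<Rightarrow> nat set set" where
  "all_pairs n = {e. \<exists>i j. 1 \<le> i \<and> i < j \<and> j \<le> n \<and> e = {i, j}}"

definition prob_Gnp :: "nat \<Rightarrow> real \<Rightarrow> fo \<Rightarrow> real" where
  "prob_Gnp n p \<phi> = (\<Sum>E\<in>Pow (all_pairs n).
      if models_E12 E {1..n} \<phi>
      then p ^ card E * (1 - p) ^ (card (all_pairs n) - card E) else 0)"

definition zero_one_law_E12 :: "real \<Rightarrow> bool" where
  "zero_one_law_E12 p \<longleftrightarrow>
     (\<forall>\<phi>. E12 \<phi> \<longrightarrow> (\<exists>L\<in>{0, 1}. (\<lambda>n. prob_Gnp n p \<phi>) \<longlonglongrightarrow> L))"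

definition convergence_law_E12 :: "real \<Rightarrow> bool" where
  "convergence_law_E12 p \<longleftrightarrow>
     (\<forall>\<phi>. E12 \<phi> \<longrightarrow> convergent (\<lambda>n. prob_Gnp n p \<phi>))"

end

theory Submission
  imports Defs "HOL-Analysis.Convex"
begin

text \<open>Depth two confines the exceptions to homogeneous sets: a vertex only records which
  adjacency values it meets inside and outside \<open>S\<close>, and every type set left undecided
  by extension witnesses has all vertices of \<open>S\<close> (or of its complement) meeting one and
  the same value inside that set. The golden ratio enters because \<open>s = t\<close> and
  \<open>s = 1 - t ^ 2\<close> mean \<open>t ^ 2 + t = 1\<close>. At \<open>s = t\<close>
  non-maximality is essential. Asking for one more vertex joined to a homogeneous set of size
  \<open>k = m - 1\<close> multiplies the expected number by about \<open>n * t ^ (2 * k)\<close>.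
  When \<open>\<rho>\<close> is near 1 this is about \<open>m * t ^ k\<close>, so without that
  request the expected number would be exponentially large instead of balanced. The oscillation
  comes from a gap: the values of \<open>n\<close> with \<open>\<rho> = 1\<close> for consecutive
  \<open>m\<close> differ by a factor of about \<open>1 / s\<close>, which stays away from 1, so
  \<open>n\<close> can also be placed midway between two of them. For non-convergence a constant
  lower bound on the probability is enough, which a second moment of the order of the squared first
  moment provides.\<close>

text \<open>
  A depth-two sentence about a graph with a distinguished vertex set \<open>S\<close> only depends on the set of
  depth-one types that are realised. In a graph with the usual extension properties nearly all
  type sets are either realised by some \<open>S\<close> or by none; the exceptions concern cliques and independent
  sets \<open>S\<close> such that no outside vertex is adjacent (for independent \<open>S\<close>) or non-adjacent (for cliques) to
  all of \<open>S\<close>.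

  Let \<open>t\<^sup>2\<close> be the probability of the pairs inside \<open>S\<close> (\<open>1 - p\<close> or \<open>p\<close>) and \<open>s = 1 - t\<^sup>2\<close>.
  Homogeneous sets have size up to about \<open>log n / log (1 / t)\<close>, and a set of size \<open>k\<close> has no
  bad outside vertex once \<open>n * s ^ k\<close> is small. If \<open>s < t\<close>, the second moment method yields suitable \<open>S\<close>
  with probability tending to \<open>1\<close>; if \<open>s > t\<close>, a union bound excludes them.

  The case \<open>s = t\<close> is the golden ratio. The expected number of non-maximal homogeneous sets of
  size \<open>m - 1\<close> without bad outside vertex is then about \<open>m\<close> times the \<open>m\<close>-th power of
  \<open>\<rho> * exp (1 - \<rho>)\<close>, where \<open>\<rho> = n * s ^ (m - 1) / m\<close>. This is bounded below for \<open>\<rho>\<close> near \<open>1\<close>, where the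
  second moment method gives a positive probability, and exponentially small in \<open>m\<close> if \<open>\<rho>\<close> stays away
  from \<open>1\<close> for all \<open>m\<close>; both happen for infinitely many \<open>n\<close>.
\<close>

subsection \<open>Depth-two types\<close>

definition adj :: "nat set set \<Rightarrow> nat \<Rightarrow> nat \<Rightarrow> bool" where
  "adj E x y \<longleftrightarrow> {x, y} \<in> E"

lemma adj_commute: "adj E x y = adj E y x"
  by (simp add: adj_def insert_commute)

definition nbh :: "nat set set \<Rightarrow> nat set \<Rightarrow> nat \<Rightarrow> bool set" where
  "nbh E X v = adj E v ` (X - {v})"

text \<open>The depth-one type of a vertex: its colour, and the adjacency values it realises towards the
  other vertices inside and outside \<open>S\<close>. By an Ehrenfeucht-Fraisse argument the set of realised types
  decides all sentences of depth two.\<close>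
definition vtype :: "nat set set \<Rightarrow> nat set \<Rightarrow> nat set \<Rightarrow> nat \<Rightarrow> bool \<times> bool set \<times> bool set" where
  "vtype E V S v = (v \<in> S, nbh E S v, nbh E (V - S) v)"

definition vtypes :: "nat set set \<Rightarrow> nat set \<Rightarrow> nat set \<Rightarrow> (bool \<times> bool set \<times> bool set) set" where
  "vtypes E V S = vtype E V S ` V"

lemma sat_cong_quantifier_free:
  assumes "qdepth f = 0"
    and "\<And>x y. x \<in> fv f \<Longrightarrow> y \<in> fv f \<Longrightarrow>
      (a x = a y \<longleftrightarrow> a' x = a' y) \<and> ({a x, a y} \<in> E \<longleftrightarrow> {a' x, a' y} \<in> E')"
    and "\<And>x. x \<in> fv f \<Longrightarrow> a x \<in> S \<longleftrightarrow> a' x \<in> S'"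
  shows "sat E V S a f \<longleftrightarrow> sat E' V' S' a' f"
  using assms by (induction f) auto

text \<open>Duplicator's reply in the last round: the type of \<open>v\<close> lists, separately
  inside and outside \<open>S\<close>, the adjacency values that occur at other vertices, so any
  \<open>u\<close> has a counterpart. Loop-freeness serves the case \<open>u = v\<close>, where
  \<open>{v, u}\<close> collapses to \<open>{v}\<close>.\<close>

lemma vtype_eq_imp_partner:
  assumes eq: "vtype E V S v = vtype E' V' S' v'"
    and v: "v \<in> V" "v' \<in> V'" and sub: "S' \<subseteq> V'"
    and loops: "{v} \<notin> E" "{v'} \<notin> E'" and u: "u \<in> V"
  shows "\<exists>u'\<in>V'. (u = v \<longleftrightarrow> u' = v') \<and> (u \<in> S \<longleftrightarrow> u' \<in> S') \<and> ({v, u} \<in> E \<longleftrightarrow> {v', u'} \<in> E')"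
proof (cases "u = v")
  case True
  then show ?thesis using eq v loops by (intro bexI[of _ v']) (auto simp: vtype_def)
next
  case False
  show ?thesis
  proof (cases "u \<in> S")
    case True
    then have "({v, u} \<in> E) \<in> nbh E' S' v'"
      using eq False by (auto simp: vtype_def nbh_def adj_def)
    then obtain u' where "u' \<in> S' - {v'}" "({v, u} \<in> E) = ({v', u'} \<in> E')"
      by (auto simp: nbh_def adj_def)
    then show ?thesis using True False sub by blast
  next
    case uS: False
    then have "({v, u} \<in> E) \<in> nbh E (V - S) v"
      using False u by (auto simp: nbh_def adj_def)
    then have "({v, u} \<in> E) \<in> nbh E' (V' - S') v'"
      using eq by (simp add: vtype_def)
    then obtain u' where "u' \<in> V' - S' - {v'}" "({v, u} \<in> E) = ({v', u'} \<in> E')"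
      by (auto simp: nbh_def adj_def)
    then show ?thesis using uS False by blast
  qed
qed

lemma sat_cong_depth1:
  assumes "qdepth f \<le> 1" "fv f \<subseteq> {x}"
    and eq: "vtype E V S (a x) = vtype E' V' S' (a' x)"
    and v: "a x \<in> V" "a' x \<in> V'" and sub: "S \<subseteq> V" "S' \<subseteq> V'"
    and loops: "\<And>v. {v} \<notin> E" "\<And>v. {v} \<notin> E'"
  shows "sat E V S a f \<longleftrightarrow> sat E' V' S' a' f"
  using assms(1,2)
proof (induction f)
  case (Ex y f)
  \<comment> \<open>Stated for arbitrary structures because it is applied in both directions, with
    the two sides exchanged.\<close>
  have one_way: "sat E' V' S' (a'(y := u')) f"
    if "vtype E V S (a x) = vtype E' V' S' (a' x)"
      "(u = a x \<longleftrightarrow> u' = a' x) \<and> (u \<in> S \<longleftrightarrow> u' \<in> S') \<and> ({a x, u} \<in> E \<longleftrightarrow> {a' x, u'} \<in> E')"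
      "sat E V S (a(y := u)) f"
      and loops: "\<And>v. {v} \<notin> E" "\<And>v. {v} \<notin> E'"
    for E V S a E' V' S' a' u u'
  proof -
    have fvf: "fv f \<subseteq> {x, y}" and q: "qdepth f = 0" using Ex.prems by auto
    have x: "a x \<in> S \<longleftrightarrow> a' x \<in> S'" using that(1) by (simp add: vtype_def)
    have u: "u = a x \<longleftrightarrow> u' = a' x" "u \<in> S \<longleftrightarrow> u' \<in> S'" "{a x, u} \<in> E \<longleftrightarrow> {a' x, u'} \<in> E'"
      using that(2) by auto
    then have u': "a x = u \<longleftrightarrow> a' x = u'" "{u, a x} \<in> E \<longleftrightarrow> {u', a' x} \<in> E'"
      by (auto simp: insert_commute)
    have atoms: "((a(y := u)) z = (a(y := u)) z' \<longleftrightarrow> (a'(y := u')) z = (a'(y := u')) z') \<and>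
        ({(a(y := u)) z, (a(y := u)) z'} \<in> E \<longleftrightarrow> {(a'(y := u')) z, (a'(y := u')) z'} \<in> E')"
      if "z \<in> {x, y}" "z' \<in> {x, y}" for z z'
      using that u u' loops by (cases "z = y"; cases "z' = y"; simp)
    have inS: "(a(y := u)) z \<in> S \<longleftrightarrow> (a'(y := u')) z \<in> S'" if "z \<in> {x, y}" for z
      using that u x by (cases "z = y"; simp)
    have "sat E V S (a(y := u)) f \<longleftrightarrow> sat E' V' S' (a'(y := u')) f"
      using fvf by (intro sat_cong_quantifier_free[OF q] atoms inS) auto
    then show ?thesis using that by blast
  qed
  show ?case
  proof
    assume "sat E V S a (Ex y f)"
    then obtain u where u: "u \<in> V" "sat E V S (a(y := u)) f" by auto
    obtain u' where u': "u' \<in> V'"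
      "(u = a x \<longleftrightarrow> u' = a' x) \<and> (u \<in> S \<longleftrightarrow> u' \<in> S') \<and> ({a x, u} \<in> E \<longleftrightarrow> {a' x, u'} \<in> E')"
      using vtype_eq_imp_partner[OF eq v sub(2) loops(1) loops(2) u(1)] by blast
    have "sat E' V' S' (a'(y := u')) f"
      by (rule one_way[of E V S a E' V' S' a' u u']) (use eq u' u loops in auto)
    then show "sat E' V' S' a' (Ex y f)" using u' by auto
  next
    assume "sat E' V' S' a' (Ex y f)"
    then obtain u where u: "u \<in> V'" "sat E' V' S' (a'(y := u)) f" by auto
    obtain u' where u': "u' \<in> V"
      "(u = a' x \<longleftrightarrow> u' = a x) \<and> (u \<in> S' \<longleftrightarrow> u' \<in> S) \<and> ({a' x, u} \<in> E' \<longleftrightarrow> {a x, u'} \<in> E)"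
      using vtype_eq_imp_partner[OF eq[symmetric] v(2,1) sub(1) loops(2) loops(1) u(1)] by blast
    have "sat E V S (a(y := u')) f"
      by (rule one_way[of E' V' S' a' E V S a u u']) (use eq u' u loops in auto)
    then show "sat E V S a (Ex y f)" using u' by auto
  qed
qed (use eq loops in \<open>auto simp: vtype_def\<close>)

lemma sat_cong_depth2:
  assumes "qdepth f \<le> 2" "fv f = {}"
    and eq: "vtypes E V S = vtypes E' V' S'"
    and sub: "S \<subseteq> V" "S' \<subseteq> V'"
    and loops: "\<And>v. {v} \<notin> E" "\<And>v. {v} \<notin> E'"
  shows "sat E V S a f \<longleftrightarrow> sat E' V' S' a' f"
  using assms(1,2)
proof (induction f)
  case (Ex x f)
  then have f: "qdepth f \<le> 1" "fv f \<subseteq> {x}" by auto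
  show ?case
  proof
    assume "sat E V S a (Ex x f)"
    then obtain u where u: "u \<in> V" "sat E V S (a(x := u)) f" by auto
    then have "vtype E V S u \<in> vtypes E' V' S'" using eq by (auto simp: vtypes_def)
    then obtain u' where u': "u' \<in> V'" "vtype E V S u = vtype E' V' S' u'"
      by (auto simp: vtypes_def)
    have "sat E' V' S' (a'(x := u')) f"
      using sat_cong_depth1[OF f, of E V S "a(x := u)" E' V' S' "a'(x := u')"] u u' sub loops by auto
    then show "sat E' V' S' a' (Ex x f)" using u' by auto
  next
    assume "sat E' V' S' a' (Ex x f)"
    then obtain u where u: "u \<in> V'" "sat E' V' S' (a'(x := u)) f" by auto
    then have "vtype E' V' S' u \<in> vtypes E V S" using eq by (auto simp: vtypes_def)
    then obtain u' where u': "u' \<in> V" "vtype E' V' S' u = vtype E V S u'"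
      by (auto simp: vtypes_def)
    have "sat E V S (a(x := u')) f"
      using sat_cong_depth1[OF f, of E V S "a(x := u')" E' V' S' "a'(x := u)"] u u' sub loops by auto
    then show "sat E V S a (Ex x f)" using u' by auto
  qed
qed auto

lemma models_E12_cong:
  assumes "E12 \<phi>"
    and "vtypes E V ` Pow V = vtypes E' V' ` Pow V'"
    and "\<And>v. {v} \<notin> E" "\<And>v. {v} \<notin> E'"
  shows "models_E12 E V \<phi> \<longleftrightarrow> models_E12 E' V' \<phi>"
proof -
  have one_way: "models_E12 E' V' \<phi>"
    if m: "models_E12 E V \<phi>" and sub: "vtypes E V ` Pow V \<subseteq> vtypes E' V' ` Pow V'"
      and "\<And>v. {v} \<notin> E" "\<And>v. {v} \<notin> E'" for E V E' V'
  proof -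
    obtain S where S: "S \<subseteq> V" "sat E V S (\<lambda>_. 0) \<phi>" using m by (auto simp: models_E12_def)
    then have "vtypes E V S \<in> vtypes E' V' ` Pow V'" using sub by blast
    then obtain S' where S': "S' \<subseteq> V'" "vtypes E V S = vtypes E' V' S'" by auto
    have "sat E' V' S' (\<lambda>_. 0) \<phi>"
      using sat_cong_depth2[of \<phi> E V S E' V' S'] S S' that assms(1) by (auto simp: E12_def)
    then show ?thesis using S' by (auto simp: models_E12_def)
  qed
  show ?thesis using one_way[of E V E' V'] one_way[of E' V' E V] assms by blast
qed

subsection \<open>Type sets realised in a typical graph\<close>

definition homog :: "bool \<Rightarrow> nat set set \<Rightarrow> nat set \<Rightarrow> bool" where
  "homog b E X \<longleftrightarrow> (\<forall>x\<in>X. \<forall>y\<in>X. x \<noteq> y \<longrightarrow> adj E x y = b)"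

definition joined :: "bool \<Rightarrow> nat set set \<Rightarrow> nat \<Rightarrow> nat set \<Rightarrow> bool" where
  "joined b E u X \<longleftrightarrow> (\<forall>y\<in>X. adj E u y = b)"

lemma subset_doubleton_cases:
  assumes "R \<subseteq> {a, b}"
  shows "R = {} \<or> R = {a} \<or> R = {b} \<or> R = {a, b}"
  using assms by auto

lemma bool_set_cases:
  assumes "R \<noteq> {}"
  shows "R \<in> {{True}, {False}, UNIV}"
  using subset_doubleton_cases[OF subset_UNIV[of R, unfolded UNIV_bool]] assms
  unfolding UNIV_bool by blast

lemma image_eq_UNIV_iff: "f ` A = UNIV \<longleftrightarrow> (\<forall>b. \<exists>y\<in>A. f y = b)"
  unfolding set_eq_iff image_iff by (metis UNIV_I)

lemma image_eq_singleton_iff: "f ` A = {b} \<longleftrightarrow> A \<noteq> {} \<and> (\<forall>y\<in>A. f y = b)"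
  by auto

lemma nbh_eq_UNIV_iff: "nbh E X v = UNIV \<longleftrightarrow> (\<forall>b. \<exists>y\<in>X - {v}. adj E v y = b)"
  unfolding nbh_def by (rule image_eq_UNIV_iff)

lemma nbh_eq_singleton_iff:
  "nbh E X v = {b} \<longleftrightarrow> X - {v} \<noteq> {} \<and> joined b E v (X - {v})"
  unfolding nbh_def joined_def by (rule image_eq_singleton_iff)

text \<open>\<open>I\<close> and \<open>J\<close> collect the values \<open>nbh E S v\<close> for \<open>v\<close> inside and outside \<open>S\<close>; the first two patterns
  belong to empty and one-element \<open>S\<close>. An inner set \<open>I = {{b}}\<close> means that \<open>S\<close> is a clique or an
  independent set, and \<open>P b\<close> says that such sets can be so large that no outside vertex is joined to
  them uniformly in the opposite way.\<close>
definition small_patterns :: "(bool \<Rightarrow> bool) \<Rightarrow> (bool \<times> bool set) set set" where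
  "small_patterns P =
     {{(False, {})}, {(True, {}), (False, {True}), (False, {False})}} \<union>
     {Pair True ` I \<union> Pair False ` J | I J. J \<subseteq> {{True}, {False}, UNIV} \<and> UNIV \<in> J \<and>
        (I = {UNIV} \<or> (\<exists>b. I = {UNIV, {b}}) \<or> (\<exists>b. I = {{b}} \<and> ({\<not> b} \<in> J \<or> P b)))}"

text \<open>Up to one vertex \<open>x\<close> the set \<open>S\<close> is the (non-)neighbourhood of \<open>x\<close>, or every vertex sees both
  adjacency values outside \<open>S\<close>, or the same holds for the complement of \<open>S\<close>.\<close>
definition patterns :: "(bool \<Rightarrow> bool) \<Rightarrow> (bool \<times> bool set \<times> bool set) set set" where
  "patterns P =
     {{(c, {b}, {\<not> b}), (True, UNIV, UNIV), (False, UNIV, UNIV)} | b c. True} \<union>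
     (`) (\<lambda>(c, r). (c, r, UNIV)) ` small_patterns P \<union>
     (`) (\<lambda>(c, r). (\<not> c, UNIV, r)) ` small_patterns P"

text \<open>The set \<open>H\<close> will be one half of the vertices, so that witnesses exist both inside and outside
  a set carved out of \<open>H\<close>.\<close>
definition extension :: "nat set set \<Rightarrow> nat set \<Rightarrow> nat set \<Rightarrow> bool" where
  "extension E V H \<longleftrightarrow> (\<forall>F A. \<forall>U\<in>{H, V - H}. F \<subseteq> V \<longrightarrow> finite F \<longrightarrow> card F \<le> 4 \<longrightarrow>
     (\<exists>y\<in>U - F. \<forall>f\<in>F. adj E y f = (f \<in> A)))"

text \<open>Colour reversal: when every vertex sees both adjacency values inside \<open>S\<close>,
  the complement of \<open>S\<close> takes over the role of \<open>S\<close>.\<close>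

lemma vtypes_complement:
  assumes "S \<subseteq> V"
  shows "vtypes E V (V - S) = (\<lambda>(c, r, r'). (\<not> c, r', r)) ` vtypes E V S"
proof -
  have "V - (V - S) = S" using assms by auto
  then have "vtype E V (V - S) v = (\<lambda>(c, r, r'). (\<not> c, r', r)) (vtype E V S v)" if "v \<in> V" for v
    using that by (simp add: vtype_def)
  then show ?thesis unfolding vtypes_def image_image by (rule image_cong[OF refl])
qed

lemma image_split_by_membership:
  assumes "S \<subseteq> V"
  shows "(\<lambda>v. (v \<in> S, f v)) ` V = Pair True ` (f ` S) \<union> Pair False ` (f ` (V - S))"
proof -
  have "V = S \<union> (V - S)" using assms by blast
  then have "(\<lambda>v. (v \<in> S, f v)) ` V = (\<lambda>v. (v \<in> S, f v)) ` S \<union> (\<lambda>v. (v \<in> S, f v)) ` (V - S)"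
    by (metis image_Un)
  then show ?thesis unfolding image_image by simp
qed

lemma subset_tripleton_cases:
  assumes "I \<subseteq> {a, c, u}" "I \<noteq> {}" "\<not> (a \<in> I \<and> c \<in> I)"
  shows "I = {u} \<or> I = {u, a} \<or> I = {u, c} \<or> I = {a} \<or> I = {c}"
  using assms by auto

text \<open>The almost sure properties that determine the realised type sets; \<open>P b\<close>
  will be the comparison \<open>s < t\<close> for the value \<open>b\<close>.
  \<open>maximal_homog\<close> is unconditional because there the outside vertices to be avoided are
  joined by the same value \<open>b\<close> as inside the set, and
  \<open>bp p b < sqrt (bp p b)\<close> always holds. Avoiding the opposite value is possible only
  under \<open>P b\<close>. The vertex \<open>w\<close> guarantees that the other uniform value does
  occur outside.\<close>

locale typical_graph =
  fixes E :: "nat set set" and V H :: "nat set" and P :: "bool \<Rightarrow> bool"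
  assumes ext: "extension E V H" and HV: "H \<subseteq> V"
    and maximal_homog: "\<exists>X\<subseteq>V. 2 \<le> card X \<and> homog b E X \<and>
      (\<exists>w\<in>V - X. joined (\<not> b) E w X) \<and> (\<forall>u\<in>V - X. \<not> joined b E u X)"
    and extendible_homog: "P b \<Longrightarrow> \<exists>X\<subseteq>V. 2 \<le> card X \<and> homog b E X \<and>
      (\<exists>w\<in>V - X. joined b E w X) \<and> (\<forall>u\<in>V - X. \<not> joined (\<not> b) E u X)"
    and no_homog: "\<not> P b \<Longrightarrow> X \<subseteq> V \<Longrightarrow> X \<noteq> {} \<Longrightarrow> homog b E X \<Longrightarrow>
      \<exists>u\<in>V - X. joined (\<not> b) E u X"
    and finV: "finite V"
begin

section \<open>Every type set of a typical graph is a pattern\<close>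

lemma extH:
  assumes "F \<subseteq> V" "finite F" "card F \<le> 4"
  obtains y where "y \<in> H - F" "\<And>f. f \<in> F \<Longrightarrow> adj E f y = (f \<in> A)"
proof -
  have "\<exists>y\<in>H - F. \<forall>f\<in>F. adj E y f = (f \<in> A)"
    by (rule ext[unfolded extension_def, rule_format, OF _ assms]) simp
  then obtain y where y: "y \<in> H - F" "\<forall>f\<in>F. adj E y f = (f \<in> A)" by blast
  have "adj E f y = (f \<in> A)" if "f \<in> F" for f
    using y(2) that by (subst adj_commute) blast
  then show ?thesis by (rule that[OF y(1)])
qed

lemma extHc:
  assumes "F \<subseteq> V" "finite F" "card F \<le> 4"
  obtains y where "y \<in> V - H - F" "\<And>f. f \<in> F \<Longrightarrow> adj E f y = (f \<in> A)"
proof -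
  have "\<exists>y\<in>V - H - F. \<forall>f\<in>F. adj E y f = (f \<in> A)"
    by (rule ext[unfolded extension_def, rule_format, OF _ assms]) simp
  then obtain y where y: "y \<in> V - H - F" "\<forall>f\<in>F. adj E y f = (f \<in> A)" by blast
  have "adj E f y = (f \<in> A)" if "f \<in> F" for f
    using y(2) that by (subst adj_commute) blast
  then show ?thesis by (rule that[OF y(1)])
qed

lemma ext1H:
  assumes "x \<in> V"
  shows "\<exists>y\<in>H - {x}. adj E x y = b"
proof -
  have "card {x} \<le> 4" "{x} \<subseteq> V" "finite {x}" using assms by auto
  then obtain y where "y \<in> H - {x}" "\<And>f. f \<in> {x} \<Longrightarrow> adj E f y = (f \<in> {z. b})"
    using extH[of "{x}" "{z. b}"] by blast
  then show ?thesis by (intro bexI[of _ y]) simp_all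
qed

lemma ext4H:
  assumes "x \<in> V" "y \<in> V" "z \<in> V" "u \<in> V"
    and "u \<notin> {x, y, z}" "z \<notin> {x, y}" "x \<noteq> y"
  shows "\<exists>w\<in>H - {x, y, z, u}. adj E x w = a \<and> adj E y w = b \<and> adj E z w = c \<and> adj E u w = d"
proof -
  define A where "A = (if a then {x} else {}) \<union> (if b then {y} else {}) \<union> (if c then {z} else {}) \<union> (if d then {u} else {})"
  have c: "card {x, y, z, u} \<le> 4" by (simp add: card_insert_if)
  have A: "x \<in> A \<longleftrightarrow> a" "y \<in> A \<longleftrightarrow> b" "z \<in> A \<longleftrightarrow> c" "u \<in> A \<longleftrightarrow> d"
    using assms by (auto simp: A_def)
  obtain w where "w \<in> H - {x, y, z, u}" "\<And>f. f \<in> {x, y, z, u} \<Longrightarrow> adj E f w = (f \<in> A)"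
    using extH[of "{x, y, z, u}" A] c assms by auto
  then show ?thesis using A by (intro bexI[of _ w]) auto
qed

lemma ext3H:
  assumes "x \<in> V" "y \<in> V" "z \<in> V" "z \<notin> {x, y}" "x \<noteq> y"
  shows "\<exists>w\<in>H - {x, y, z}. adj E x w = a \<and> adj E y w = b \<and> adj E z w = c"
proof -
  define A where "A = (if a then {x} else {}) \<union> (if b then {y} else {}) \<union> (if c then {z} else {})"
  have c: "card {x, y, z} \<le> 4" by (simp add: card_insert_if)
  have A: "x \<in> A \<longleftrightarrow> a" "y \<in> A \<longleftrightarrow> b" "z \<in> A \<longleftrightarrow> c"
    using assms by (auto simp: A_def)
  obtain w where "w \<in> H - {x, y, z}" "\<And>f. f \<in> {x, y, z} \<Longrightarrow> adj E f w = (f \<in> A)"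
    using extH[of "{x, y, z}" A] c assms by auto
  then show ?thesis using A by (intro bexI[of _ w]) auto
qed

lemma ext2H:
  assumes "x \<in> V" "y \<in> V" "x \<noteq> y"
  shows "\<exists>w\<in>H - {x, y}. adj E x w = a \<and> adj E y w = b"
proof -
  define A where "A = (if a then {x} else {}) \<union> (if b then {y} else {})"
  have c: "card {x, y} \<le> 4" by (simp add: card_insert_if)
  have A: "x \<in> A \<longleftrightarrow> a" "y \<in> A \<longleftrightarrow> b"
    using assms by (auto simp: A_def)
  obtain w where "w \<in> H - {x, y}" "\<And>f. f \<in> {x, y} \<Longrightarrow> adj E f w = (f \<in> A)"
    using extH[of "{x, y}" A] c assms by auto
  then show ?thesis using A by (intro bexI[of _ w]) auto
qed

lemma outside_H: "finite F \<Longrightarrow> F \<subseteq> V \<Longrightarrow> card F \<le> 4 \<Longrightarrow> \<exists>y\<in>V - H. y \<notin> F"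
  by (rule extHc[of F "{}"]) auto

text \<open>A vertex set all of whose outside vertices are joined uniformly to it would contain every
  vertex separating two of its members, hence one adjacent and one non-adjacent to any vertex.\<close>
lemma no_module:
  assumes "S \<subseteq> V" "x \<in> S" "x' \<in> S" "x \<noteq> x'" "u \<in> V - S"
  shows "\<exists>u\<in>V - S. nbh E S u = UNIV"
proof (rule ccontr)
  assume none: "\<not> ?thesis"
  have mem: "w \<in> S" if "w \<in> V" "adj E x w \<noteq> adj E x' w" for w
  proof (rule ccontr)
    assume w: "w \<notin> S"
    have "nbh E S w = UNIV" unfolding nbh_eq_UNIV_iff
    proof
      fix b
      show "\<exists>y\<in>S - {w}. adj E w y = b"
      proof (cases "adj E x w = b")
        case True
        then show ?thesis using assms(2) w by (intro bexI[of _ x]) (simp add: adj_commute, blast)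
      next
        case False
        then have "adj E w x' = b" using that(2) by (simp add: adj_commute[of E w])
        then show ?thesis using assms(3) w by blast
      qed
    qed
    then show False using none w that(1) by blast
  qed
  have "nbh E S u = UNIV" unfolding nbh_eq_UNIV_iff
  proof
    fix b
    obtain w where w: "w \<in> H - {x, x', u}" "adj E x w" "\<not> adj E x' w" "adj E u w = b"
      using ext3H[of x x' u True False b] assms by blast
    then have "w \<in> S" using mem[of w] HV by blast
    then show "\<exists>y\<in>S - {u}. adj E u y = b" using w by blast
  qed
  then show False using none assms by blast
qed

text \<open>If some \<open>x\<close> had all vertices joined to it by \<open>c\<close> in
  \<open>S\<close>, the extension property would give two of them that are joined to each other by
  \<open>\<not> b\<close>, against homogeneity.\<close>

lemma homog_imp_outside_mixed:
  assumes "homog b E S" "x \<in> V"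
  shows "nbh E (V - S) x = UNIV"
  unfolding nbh_eq_UNIV_iff
proof (rule allI, rule ccontr)
  fix c
  assume none: "\<not> (\<exists>y\<in>V - S - {x}. adj E x y = c)"
  have S: "y \<in> S" if "y \<in> V" "y \<noteq> x" "adj E x y = c" for y
  proof (rule ccontr)
    assume "y \<notin> S"
    then have "y \<in> V - S - {x}" using that(1,2) by simp
    then show False using none that(3) by (elim notE) (rule bexI)
  qed
  obtain y where y: "y \<in> H - {x}" "adj E x y = c" using ext1H[OF assms(2), of c] by (elim bexE)
  then have yV: "y \<in> V" "x \<noteq> y" using HV by auto
  obtain z where z: "z \<in> H - {x, y}" "adj E x z = c" "adj E y z = (\<not> b)"
    using ext2H[OF assms(2) yV, of c "\<not> b"] by (elim bexE conjE)
  then have zV: "z \<in> V" "z \<noteq> x" "y \<noteq> z" using HV by auto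
  have "y \<in> S" "z \<in> S" using S[OF yV(1) yV(2)[symmetric] y(2)] S[OF zV(1,2) z(2)] by auto
  then have "adj E y z = b" using assms(1) zV(3) unfolding homog_def by simp
  then show False using z(3) by simp
qed

lemma vtypes_small:
  assumes "\<And>v. v \<in> V \<Longrightarrow> nbh E (V - S) v = UNIV"
  shows "vtypes E V S = (\<lambda>(c, r). (c, r, UNIV)) ` ((\<lambda>v. (v \<in> S, nbh E S v)) ` V)"
  unfolding vtypes_def image_image using assms by (intro image_cong refl) (simp add: vtype_def)

lemma pattern_empty: "(\<lambda>v. (v \<in> {}, nbh E {} v)) ` V = {(False, {})}"
  unfolding image_eq_singleton_iff using outside_H[of "{}"] by (auto simp: nbh_def)

lemma pattern_singleton:
  assumes x: "x \<in> V"
  shows "(\<lambda>v. (v \<in> {x}, nbh E {x} v)) ` V = {(True, {}), (False, {True}), (False, {False})}"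
    (is "?L = ?R")
proof
  obtain y where y: "y \<in> H - {x}" "adj E x y" using ext1H[OF x, of True] by auto
  obtain z where z: "z \<in> H - {x}" "\<not> adj E x z" using ext1H[OF x, of False] by auto
  have n: "nbh E {x} v = (if v = x then {} else {adj E x v})" for v
    by (auto simp: nbh_def adj_commute)
  show "?L \<subseteq> ?R"
  proof (rule image_subsetI)
    fix v
    show "(v \<in> {x}, nbh E {x} v) \<in> ?R"
      using n[of v] by (cases "v = x"; cases "adj E x v") simp_all
  qed
  have "(True, {}) \<in> ?L" using n[of x] x by (intro image_eqI[where x = x]) simp_all
  moreover have "(False, {True}) \<in> ?L" using n[of y] y HV by (intro image_eqI[where x = y]) auto
  moreover have "(False, {False}) \<in> ?L" using n[of z] z HV by (intro image_eqI[where x = z]) auto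
  ultimately show "?R \<subseteq> ?L" by blast
qed

text \<open>If \<open>S\<close> has two elements, every vertex sees something in \<open>S\<close>.
  Two inner vertices with constant values \<open>b\<close> and \<open>\<not> b\<close> would
  disagree on the pair they form, so \<open>I\<close> contains at most one singleton.
  \<open>no_module\<close> puts \<open>UNIV\<close> into \<open>J\<close>. If
  \<open>I = {{b}}\<close>, then \<open>S\<close> is homogeneous and \<open>no_homog\<close> puts
  \<open>{\<not> b}\<close> into \<open>J\<close> unless \<open>P b\<close>.\<close>

lemma small_in_small_patterns:
  assumes S: "S \<subseteq> V" and mixed: "\<And>v. v \<in> V \<Longrightarrow> nbh E (V - S) v = UNIV"
  shows "(\<lambda>v. (v \<in> S, nbh E S v)) ` V \<in> small_patterns P"
proof -
  obtain v0 where v0: "v0 \<in> V" using outside_H[of "{}"] by auto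
  consider "S = {}" | x where "S = {x}" | x x' where "x \<in> S" "x' \<in> S" "x \<noteq> x'"
    using is_singletonI'[of S] by (auto elim: is_singletonE)
  then show ?thesis
  proof cases
    case 1
    then show ?thesis using pattern_empty by (simp add: small_patterns_def)
  next
    case 2
    then show ?thesis using pattern_singleton[of x] S by (simp add: small_patterns_def)
  next
    case 3
    let ?I = "nbh E S ` S" and ?J = "nbh E S ` (V - S)"
    have ne: "nbh E S v \<noteq> {}" for v using 3 by (auto simp: nbh_def)
    have vals: "nbh E S v \<in> {{True}, {False}, UNIV}" for v
      using ne by (rule bool_set_cases)
    have "nbh E (V - S) v0 = UNIV" using mixed v0 by blast
    then obtain u where "u \<in> V - S" by (auto simp: nbh_def)
    then have UJ: "UNIV \<in> ?J" using no_module[OF S 3] by force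
    have not_both: False if both: "{b} \<in> ?I" "{\<not> b} \<in> ?I" for b
    proof -
      obtain x where x: "x \<in> S" "{b} = nbh E S x" using both(1) by (rule imageE)
      obtain y where y: "y \<in> S" "{\<not> b} = nbh E S y" using both(2) by (rule imageE)
      have "x \<noteq> y"
      proof
        assume "x = y"
        then have "{b} = {\<not> b}" using x(2) y(2) by simp
        then show False by simp
      qed
      moreover have "joined b E x (S - {x})" "joined (\<not> b) E y (S - {y})"
        using x(2)[symmetric] y(2)[symmetric] unfolding nbh_eq_singleton_iff by blast+
      ultimately have "adj E x y = b" "adj E y x = (\<not> b)" using x(1) y(1) by (simp_all add: joined_def)
      then show False by (simp add: adj_commute)
    qed
    have I: "?I = {UNIV} \<or> (\<exists>b. ?I = {UNIV, {b}}) \<or> (\<exists>b. ?I = {{b}})"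
    proof -
      have "?I \<subseteq> {{True}, {False}, UNIV}" using vals by (rule image_subsetI)
      moreover have "?I \<noteq> {}" using 3(1) by blast
      moreover have "\<not> ({True} \<in> ?I \<and> {False} \<in> ?I)" using not_both[of True] by (simp only: simp_thms) blast
      ultimately have "?I = {UNIV} \<or> ?I = {UNIV, {True}} \<or> ?I = {UNIV, {False}} \<or> ?I = {{True}} \<or> ?I = {{False}}"
        by (rule subset_tripleton_cases)
      then show ?thesis by (elim disjE) (intro disjI1, assumption | intro disjI2 disjI1 exI, assumption | intro disjI2 exI, assumption)+
    qed
    have last: "{\<not> b} \<in> ?J \<or> P b" if I_eq: "?I = {{b}}" for b
    proof (rule disjCI)
      assume nP: "\<not> P b"
      have "homog b E S" unfolding homog_def
      proof (intro ballI impI)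
        fix x y assume xy: "x \<in> S" "y \<in> S" "x \<noteq> y"
        have "nbh E S x \<in> {{b}}" using imageI[OF xy(1), of "nbh E S"] unfolding I_eq .
        then have "nbh E S x = {b}" by (rule singletonD)
        then have "joined b E x (S - {x})" unfolding nbh_eq_singleton_iff by (rule conjunct2)
        then show "adj E x y = b" using xy by (simp add: joined_def)
      qed
      moreover have "S \<noteq> {}" using 3(1) by blast
      ultimately have "\<exists>u\<in>V - S. joined (\<not> b) E u S" using no_homog[OF nP S] by simp
      then obtain u where u: "u \<in> V - S" "joined (\<not> b) E u S" by (rule bexE)
      then have uS: "S - {u} = S" by blast
      have "nbh E S u = {\<not> b}" unfolding nbh_eq_singleton_iff uS
        using \<open>S \<noteq> {}\<close> u(2) by (rule conjI)
      then show "{\<not> b} \<in> ?J" using u(1) by (intro image_eqI[OF sym])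
    qed
    have J: "?J \<subseteq> {{True}, {False}, UNIV}" using vals by (rule image_subsetI)
    have I': "?I = {UNIV} \<or> (\<exists>b. ?I = {UNIV, {b}}) \<or> (\<exists>b. ?I = {{b}} \<and> ({\<not> b} \<in> ?J \<or> P b))"
      using I
    proof (elim disjE exE)
      fix b assume b: "?I = {{b}}"
      have "\<exists>b. ?I = {{b}} \<and> ({\<not> b} \<in> ?J \<or> P b)" by (rule exI[of _ b], rule conjI[OF b last[OF b]])
      then show ?thesis by (intro disjI2)
    qed (intro disjI1, assumption | intro disjI2 disjI1 exI, assumption)+
    show ?thesis unfolding image_split_by_membership[OF S] small_patterns_def
      by (rule UnI2, rule CollectI, rule exI[of _ ?I], rule exI[of _ ?J]) (intro conjI refl J UJ I')
  qed
qed

text \<open>Membership in \<open>S\<close> of a vertex other than \<open>x\<close> is encoded by its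
  adjacency to \<open>x\<close>. The extension property prescribes adjacency to \<open>x\<close> and
  to \<open>y\<close> independently, so every \<open>y\<close> other than \<open>x\<close> sees both
  values inside and outside \<open>S\<close>.\<close>

lemma vtypes_singular:
  assumes S: "S \<subseteq> V" and x: "x \<in> V"
    and inS: "\<And>y. y \<in> V \<Longrightarrow> y \<noteq> x \<Longrightarrow> y \<in> S \<longleftrightarrow> adj E x y = b"
  shows "vtypes E V S = {(x \<in> S, {b}, {\<not> b}), (True, UNIV, UNIV), (False, UNIV, UNIV)}"
proof -
  have mix: "nbh E S y = UNIV" "nbh E (V - S) y = UNIV" if y: "y \<in> V" "y \<noteq> x" for y
  proof -
    have *: "\<exists>w\<in>H - {x, y}. (w \<in> S \<longleftrightarrow> d) \<and> adj E y w = e" for d e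
    proof -
      obtain w where w: "w \<in> H - {x, y}" "adj E x w = (b = d)" "adj E y w = e"
        using ext2H[OF x y(1) y(2)[symmetric], of "b = d" e] by blast
      have "w \<in> S \<longleftrightarrow> adj E x w = b" using inS w(1) HV by blast
      then have "(w \<in> S) = d" using w(2) by (cases b; cases d) simp_all
      then show ?thesis using w(1,3) by blast
    qed
    show "nbh E S y = UNIV" unfolding nbh_eq_UNIV_iff
    proof
      fix e
      obtain w where w: "w \<in> H - {x, y}" "w \<in> S" "adj E y w = e" using *[of True e] by blast
      then have "w \<in> S - {y}" by blast
      then show "\<exists>w\<in>S - {y}. adj E y w = e" using w(3) by (rule bexI[rotated])
    qed
    show "nbh E (V - S) y = UNIV" unfolding nbh_eq_UNIV_iff
    proof
      fix e
      obtain w where w: "w \<in> H - {x, y}" "w \<notin> S" "adj E y w = e" using *[of False e] by blast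
      then have "w \<in> V - S - {y}" using HV by blast
      then show "\<exists>w\<in>V - S - {y}. adj E y w = e" using w(3) by (rule bexI[rotated])
    qed
  qed
  obtain y where y: "y \<in> H - {x}" "adj E x y = b" using ext1H[OF x, of b] by blast
  obtain y' where y': "y' \<in> H - {x}" "adj E x y' = (\<not> b)" using ext1H[OF x, of "\<not> b"] by blast
  have yx: "y \<noteq> x" "y' \<noteq> x" and yV: "y \<in> V" "y' \<in> V" using y(1) y'(1) HV by blast+
  have mem: "y \<in> S" "y' \<notin> S"
    using y(2) y'(2) by (simp_all add: inS[OF yV(1) yx(1)] inS[OF yV(2) yx(2)])
  note mem = mem yV
  have x1: "nbh E S x = {b}" unfolding nbh_eq_singleton_iff joined_def
  proof (intro conjI ballI)
    show "S - {x} \<noteq> {}" using mem y(1) by blast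
    fix w assume "w \<in> S - {x}"
    then have "w \<in> S" "w \<in> V" "w \<noteq> x" using S by auto
    then show "adj E x w = b" by (simp add: inS)
  qed
  have x2: "nbh E (V - S) x = {\<not> b}" unfolding nbh_eq_singleton_iff joined_def
  proof (intro conjI ballI)
    show "V - S - {x} \<noteq> {}" using mem y'(1) by blast
    fix w assume "w \<in> V - S - {x}"
    then have "w \<notin> S" "w \<in> V" "w \<noteq> x" by auto
    then show "adj E x w = (\<not> b)" by (simp add: inS)
  qed
  have tx: "vtype E V S x = (x \<in> S, {b}, {\<not> b})" by (simp only: vtype_def x1 x2)
  have tv: "vtype E V S v = (v \<in> S, UNIV, UNIV)" if "v \<in> V" "v \<noteq> x" for v
    by (simp only: vtype_def mix[OF that])
  show "vtypes E V S = {(x \<in> S, {b}, {\<not> b}), (True, UNIV, UNIV), (False, UNIV, UNIV)}" (is "?L = ?R")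
  proof
    show "?L \<subseteq> ?R" unfolding vtypes_def
    proof (rule image_subsetI)
      fix v assume v: "v \<in> V"
      show "vtype E V S v \<in> ?R"
      proof (cases "v = x")
        case True
        show ?thesis unfolding True tx by (rule insertI1)
      next
        case vx: False
        show ?thesis
        proof (cases "v \<in> S")
          case True
          then have t: "vtype E V S v = (True, UNIV, UNIV)" using tv[OF v vx] by (simp only: simp_thms)
          show ?thesis unfolding t by (rule insertI2, rule insertI1)
        next
          case False
          then have t: "vtype E V S v = (False, UNIV, UNIV)" using tv[OF v vx] by (simp only: simp_thms)
          show ?thesis unfolding t by (rule insertI2, rule insertI2, rule insertI1)
        qed
      qed
    qed
    have "(x \<in> S, {b}, {\<not> b}) \<in> ?L" unfolding vtypes_def
      by (rule image_eqI[where x = x], rule tx[symmetric], rule x)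
    moreover have "(True, UNIV, UNIV) \<in> ?L"
      unfolding vtypes_def using tv[OF mem(3) yx(1)] mem(1)
      by (intro image_eqI[where x = y]) (simp_all only: simp_thms mem(3))
    moreover have "(False, UNIV, UNIV) \<in> ?L"
      unfolding vtypes_def using tv[OF mem(4) yx(2)] mem(2)
      by (intro image_eqI[where x = y']) (simp_all only: simp_thms mem(4))
    ultimately show "?R \<subseteq> ?L" by (intro insert_subsetI empty_subsetI)
  qed
qed

lemma vtypes_in_patterns:
  assumes S: "S \<subseteq> V"
  shows "vtypes E V S \<in> patterns P"
proof -
  consider "\<And>v. v \<in> V \<Longrightarrow> nbh E (V - S) v = UNIV" | "\<And>v. v \<in> V \<Longrightarrow> nbh E S v = UNIV"
    | x z where "x \<in> V" "z \<in> V" "nbh E (V - S) x \<noteq> UNIV" "nbh E S z \<noteq> UNIV"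
    by blast
  then show ?thesis
  proof cases
    case 1
    have "(\<lambda>v. (v \<in> S, nbh E S v)) ` V \<in> small_patterns P"
      by (rule small_in_small_patterns[OF S]) (rule 1)
    moreover have "vtypes E V S = (\<lambda>(c, r). (c, r, UNIV)) ` ((\<lambda>v. (v \<in> S, nbh E S v)) ` V)"
      by (rule vtypes_small) (rule 1)
    ultimately show ?thesis unfolding patterns_def by (intro UnI1 UnI2) (rule image_eqI)
  next
    case 2
    have VV: "V - (V - S) = S" using S by auto
    have "vtypes E V (V - S) = (\<lambda>(c, r). (c, r, UNIV)) ` ((\<lambda>v. (v \<in> V - S, nbh E (V - S) v)) ` V)"
      by (rule vtypes_small) (simp add: VV 2)
    then have "vtypes E V S = (\<lambda>(c, r). (\<not> c, UNIV, r)) ` ((\<lambda>v. (v \<in> V - S, nbh E (V - S) v)) ` V)"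
      using vtypes_complement[of "V - S" V E] VV by (simp add: image_image)
    moreover have "(\<lambda>v. (v \<in> V - S, nbh E (V - S) v)) ` V \<in> small_patterns P"
      by (rule small_in_small_patterns) (simp_all add: VV 2)
    ultimately show ?thesis unfolding patterns_def by (intro UnI2) (rule image_eqI)
  next
    \<comment> \<open>Let \<open>b\<close> be missing at \<open>x\<close> outside \<open>S\<close>
      and \<open>c\<close> at \<open>z\<close> inside \<open>S\<close>. A vertex joined to
      \<open>x\<close> by \<open>b\<close> and to \<open>z\<close> by \<open>c\<close> could lie on
      neither side, and the extension property supplies one unless \<open>x = z\<close> and the two
      missing values are opposite. Then \<open>S\<close> is the neighbourhood or non-neighbourhood
      of \<open>x\<close>, up to \<open>x\<close> itself.\<close>
    case 3
    obtain b where b: "adj E x y \<noteq> b" if "y \<in> V - S - {x}" for y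
      using 3(3) unfolding nbh_eq_UNIV_iff by blast
    obtain c where c: "adj E z y \<noteq> c" if "y \<in> S - {z}" for y
      using 3(4) unfolding nbh_eq_UNIV_iff by blast
    have xz: "x = z"
    proof (rule ccontr)
      assume "x \<noteq> z"
      obtain w where "w \<in> H - {x, z}" "adj E x w = b" "adj E z w = c"
        using ext2H[OF 3(1,2) \<open>x \<noteq> z\<close>, of b c] by blast
      then show False using b[of w] c[of w] HV by blast
    qed
    have cb: "c = (\<not> b)"
    proof (rule ccontr)
      assume "c \<noteq> (\<not> b)"
      then have "c = b" by auto
      moreover obtain w where "w \<in> H - {x}" "adj E x w = b" using ext1H[OF 3(1), of b] by blast
      ultimately show False using b[of w] c[of w] HV xz by blast
    qed
    have inS: "y \<in> S \<longleftrightarrow> adj E x y = b" if "y \<in> V" "y \<noteq> x" for y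
      using that b[of y] c[of y] xz cb by (cases "y \<in> S") blast+
    have "vtypes E V S = {(x \<in> S, {b}, {\<not> b}), (True, UNIV, UNIV), (False, UNIV, UNIV)}"
      using S 3(1) inS by (rule vtypes_singular)
    then show ?thesis unfolding patterns_def by (intro UnI1 CollectI exI conjI TrueI)
  qed
qed

end

lemma eq_of_tripleton_membership:
  assumes "J \<subseteq> {a, c, u}" "J' \<subseteq> {a, c, u}" "u \<in> J" "u \<in> J'"
    and "a \<in> J \<longleftrightarrow> a \<in> J'" "c \<in> J \<longleftrightarrow> c \<in> J'"
  shows "J = J'"
proof (rule set_eqI)
  fix x
  show "x \<in> J \<longleftrightarrow> x \<in> J'"
  proof (cases "x \<in> {a, c, u}")
    case True
    then have "x = a \<or> x = c \<or> x = u" by simp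
    then show ?thesis using assms(3-6) by (elim disjE) simp_all
  qed (use assms(1,2) in blast)
qed

lemma singleton_bool_neq_UNIV: "{b :: bool} \<noteq> UNIV"
proof
  assume eq: "{b} = UNIV"
  have "(\<not> b) \<in> {b}" unfolding eq by (rule UNIV_I)
  then show False by simp
qed

section \<open>Every pattern is realised in a typical graph\<close>

context typical_graph
begin

text \<open>If both uniform values shall occur outside, a suitable pair of vertices suffices; if
  only \<open>\<not> b\<close> shall occur, \<open>maximal_homog\<close> applies. Otherwise
  \<open>P b\<close> gives a set \<open>X\<close> by \<open>extendible_homog\<close>, and if
  \<open>b\<close> shall be avoided as well, \<open>X\<close> is enlarged to a maximal homogeneous
  set: maximality excludes \<open>b\<close>, and a vertex joined by \<open>\<not> b\<close> to the
  larger set would be joined so to \<open>X\<close>.\<close>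

lemma homog_realises:
  assumes "\<gamma> \<or> P b"
  shows "\<exists>S\<subseteq>V. 2 \<le> card S \<and> homog b E S \<and> (\<exists>u\<in>V - S. joined b E u S) = \<beta> \<and>
    (\<exists>u\<in>V - S. joined (\<not> b) E u S) = \<gamma>"
proof -
  consider "\<gamma>" "\<beta>" | "\<gamma>" "\<not> \<beta>" | "\<not> \<gamma>" by blast
  then show ?thesis
  proof cases
    case 1
    obtain x where x: "x \<in> V" using outside_H[of "{}"] by auto
    obtain y where y: "y \<in> H - {x}" "adj E x y = b" using ext1H[OF x, of b] by (rule bexE)
    then have yV: "y \<in> V" "x \<noteq> y" using HV by auto
    have ex: "\<exists>u\<in>V - {x, y}. joined c E u {x, y}" for c
    proof -
      obtain u where u: "u \<in> H - {x, y}" "adj E x u = c" "adj E y u = c"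
        using ext2H[OF x yV, of c c] by (elim bexE conjE)
      have "joined c E u {x, y}" using u(2,3) by (simp add: joined_def adj_commute)
      moreover have "u \<in> V - {x, y}" using u(1) HV by auto
      ultimately show ?thesis by (rule bexI)
    qed
    have "homog b E {x, y}" using y(2) by (simp add: homog_def adj_commute)
    moreover have "{x, y} \<subseteq> V" "2 \<le> card {x, y}" using x yV by auto
    ultimately show ?thesis using 1 ex[of b] ex[of "\<not> b"] by (intro exI[of _ "{x, y}"]) simp
  next
    case 2
    obtain X where X: "X \<subseteq> V" "2 \<le> card X" "homog b E X" "\<exists>w\<in>V - X. joined (\<not> b) E w X"
      "\<forall>u\<in>V - X. \<not> joined b E u X" using maximal_homog[of b] by (elim exE conjE)
    then show ?thesis using 2 by (intro exI[of _ X]) simp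
  next
    case 3
    then have "P b" using assms by blast
    from extendible_homog[OF this]
    obtain X where X: "X \<subseteq> V" "2 \<le> card X" "homog b E X" "\<exists>w\<in>V - X. joined b E w X"
      "\<forall>u\<in>V - X. \<not> joined (\<not> b) E u X" by (elim exE conjE)
    show ?thesis
    proof (cases \<beta>)
      case True
      then show ?thesis using 3 X by (intro exI[of _ X]) simp
    next
      case False
      let ?F = "{Y. X \<subseteq> Y \<and> Y \<subseteq> V \<and> homog b E Y}"
      have "finite ?F" by (rule finite_subset[of _ "Pow V"]) (use finV in auto)
      moreover have "X \<in> ?F" using X by simp
      ultimately have "\<exists>Y\<in>?F. \<forall>Z\<in>?F. Y \<subseteq> Z \<longrightarrow> Y = Z"
        by (intro finite_has_maximal) blast+
      then obtain Y where Y: "Y \<in> ?F" "\<forall>Z\<in>?F. Y \<subseteq> Z \<longrightarrow> Y = Z" by (rule bexE)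
      from Y(1) have YV: "Y \<subseteq> V" "X \<subseteq> Y" "homog b E Y" by simp_all
      have nb: "\<not> joined b E u Y" if u: "u \<in> V - Y" for u
      proof
        assume j: "joined b E u Y"
        have "homog b E (insert u Y)" unfolding homog_def
        proof (intro ballI impI)
          fix x y assume xy: "x \<in> insert u Y" "y \<in> insert u Y" "x \<noteq> y"
          consider "x = u" "y \<in> Y" | "y = u" "x \<in> Y" | "x \<in> Y" "y \<in> Y" using xy by auto
          then show "adj E x y = b"
          proof cases
            case 1
            then show ?thesis using j by (simp add: joined_def)
          next
            case 2
            then have "adj E u x = b" using j by (simp add: joined_def)
            then show ?thesis using adj_commute[of E x u] 2 by simp
          next
            case 3
            then show ?thesis using YV(3) xy(3) by (simp add: homog_def)
          qed
        qed
        moreover have "X \<subseteq> insert u Y" "insert u Y \<subseteq> V" using YV(1,2) u by blast+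
        ultimately have "insert u Y \<in> ?F" by simp
        from Y(2)[rule_format, OF this] have "Y = insert u Y" by (simp add: subset_insertI)
        then show False using u by (metis DiffD2 insertI1)
      qed
      moreover have "\<not> joined (\<not> b) E u Y" if u: "u \<in> V - Y" for u
      proof
        assume "joined (\<not> b) E u Y"
        then have "joined (\<not> b) E u X" using YV(2) unfolding joined_def by (metis subsetD)
        moreover have "u \<in> V - X" using u YV(2) by blast
        ultimately show False using X(5) by (metis (no_types))
      qed
      moreover have "2 \<le> card Y" using X(2) card_mono[OF finite_subset[OF YV(1) finV] YV(2)] by simp
      ultimately show ?thesis using 3 False YV by (intro exI[of _ Y]) simp
    qed
  qed
qed

lemma homog_pattern_realised:
  assumes J: "J \<subseteq> {{True}, {False}, UNIV}" "UNIV \<in> J" and "{\<not> b} \<in> J \<or> P b"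
  shows "\<exists>S\<subseteq>V. (\<forall>v\<in>V. nbh E (V - S) v = UNIV) \<and> nbh E S ` S = {{b}} \<and> nbh E S ` (V - S) = J"
proof -
  obtain S where S: "S \<subseteq> V" "2 \<le> card S" "homog b E S" "(\<exists>u\<in>V - S. joined b E u S) = ({b} \<in> J)"
    "(\<exists>u\<in>V - S. joined (\<not> b) E u S) = ({\<not> b} \<in> J)"
    using homog_realises[OF assms(3), of "{b} \<in> J"] by (elim exE conjE)
  have "finite S" using S(1) finV by (rule finite_subset)
  then obtain x x' where x: "x \<in> S" "x' \<in> S" "x \<noteq> x'"
    using S(2) card_le_Suc0_iff_eq[of S] by fastforce
  have mixed: "\<forall>v\<in>V. nbh E (V - S) v = UNIV" using homog_imp_outside_mixed[OF S(3)] by (rule ballI)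
  have "x \<in> V" using x S by blast
  then have "nbh E (V - S) x = UNIV" by (rule mixed[rule_format])
  then have "V - S - {x} \<noteq> {}" unfolding nbh_def by (metis image_empty UNIV_not_empty)
  then obtain u0 where u0: "u0 \<in> V - S" by blast
  have "nbh E S ` S = {{b}}" unfolding image_eq_singleton_iff
  proof (intro conjI ballI)
    show "S \<noteq> {}" using x by blast
    fix y assume y: "y \<in> S"
    show "nbh E S y = {b}" unfolding nbh_eq_singleton_iff
    proof
      show "S - {y} \<noteq> {}" using x by blast
      show "joined b E y (S - {y})" using S(3) y by (simp add: joined_def homog_def)
    qed
  qed
  moreover have "nbh E S ` (V - S) = J"
  proof (rule eq_of_tripleton_membership[of _ "{True}" "{False}" UNIV])
    have "nbh E S v \<noteq> {}" for v unfolding nbh_def using x by blast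
    then show "nbh E S ` (V - S) \<subseteq> {{True}, {False}, UNIV}" by (intro image_subsetI bool_set_cases)
    have "\<exists>u\<in>V - S. nbh E S u = UNIV" by (rule no_module[OF S(1) x u0])
    then show "UNIV \<in> nbh E S ` (V - S)" by (elim bexE) (intro image_eqI[OF sym])
    have mem: "{c} \<in> nbh E S ` (V - S) \<longleftrightarrow> (\<exists>u\<in>V - S. joined c E u S)" for c
    proof -
      have "nbh E S u = {c} \<longleftrightarrow> joined c E u S" if "u \<in> V - S" for u
      proof -
        have "S - {u} = S" using that by blast
        then show ?thesis unfolding nbh_eq_singleton_iff using x(1) by auto
      qed
      then show ?thesis unfolding image_iff by (metis (no_types))
    qed
    have both: "({b} \<in> nbh E S ` (V - S)) = ({b} \<in> J)" "({\<not> b} \<in> nbh E S ` (V - S)) = ({\<not> b} \<in> J)"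
      unfolding mem by (rule S(4), rule S(5))
    show "({True} \<in> nbh E S ` (V - S)) = ({True} \<in> J)"
      using both by (cases b) (simp_all only: simp_thms)
    show "({False} \<in> nbh E S ` (V - S)) = ({False} \<in> J)"
      using both by (cases b) (simp_all only: simp_thms)
  qed (rule J)+
  ultimately show ?thesis using S(1) mixed by (intro exI[of _ S] conjI)
qed

text \<open>\<open>S\<^sub>0\<close> is carved out of \<open>H\<close> by adjacency conditions, so
  that \<open>v\<close> becomes the only inner vertex with constant value, and \<open>p\<close> and
  \<open>q\<close> the only outside vertices constantly \<open>True\<close> and
  \<open>False\<close>, each on demand. The choice of \<open>p\<close> adjacent and \<open>q\<close>
  non-adjacent to \<open>v\<close> keeps their values constant when \<open>v\<close> joins
  \<open>S\<close>. Any other vertex is mixed because adjacency to \<open>v\<close>,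
  \<open>p\<close>, \<open>q\<close> and to it can be prescribed at once, hence the bound 4 in
  \<open>extension\<close>. The half outside \<open>H\<close> makes every vertex mixed towards the
  complement of \<open>S\<close>.\<close>

lemma mixed_pattern_realised:
  assumes J: "J \<subseteq> {{True}, {False}, UNIV}" "UNIV \<in> J"
  shows "\<exists>S\<subseteq>V. (\<forall>v\<in>V. nbh E (V - S) v = UNIV) \<and>
    nbh E S ` S = (if f then {{b}} else {}) \<union> {UNIV} \<and> nbh E S ` (V - S) = J"
proof -
  obtain v where v: "v \<in> V" using outside_H[of "{}"] by auto
  obtain p where p: "p \<in> H - {v}" "adj E v p" using ext1H[OF v, of True] by auto
  obtain q where q: "q \<in> H - {v}" "\<not> adj E v q" using ext1H[OF v, of False] by auto
  have V: "v \<in> V" "p \<in> V" "q \<in> V" and d: "q \<notin> {v, p}" "v \<noteq> p" using v p q HV by auto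
  define g h where "g = ({True} \<in> J)" and "h = ({False} \<in> J)"
  define S\<^sub>0 where "S\<^sub>0 = {y \<in> H - {v, p, q}. (f \<longrightarrow> adj E v y = b) \<and> (g \<longrightarrow> adj E p y) \<and> (h \<longrightarrow> \<not> adj E q y)}"
  define S where "S = (if f then {v} else {}) \<union> S\<^sub>0"
  have S0: "S\<^sub>0 \<subseteq> S" "S\<^sub>0 \<subseteq> H - {v, p, q}" by (auto simp: S_def S\<^sub>0_def)
  have SV: "S \<subseteq> V" using S0 v HV by (auto simp: S_def)
  have mixedI: "nbh E S u = UNIV" if both: "\<And>c. \<exists>y\<in>S\<^sub>0 - {u}. adj E u y = c" for u
    unfolding nbh_eq_UNIV_iff
  proof
    fix c
    obtain y where y: "y \<in> S\<^sub>0 - {u}" "adj E u y = c" using both[of c] by (rule bexE)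
    then have "y \<in> S - {u}" using S0 by blast
    then show "\<exists>y\<in>S - {u}. adj E u y = c" using y(2) by (rule bexI[rotated])
  qed
  have other: "nbh E S u = UNIV" if u: "u \<in> V" "u \<notin> {v, p, q}" for u
  proof (rule mixedI)
    fix c
    obtain y where "y \<in> H - {v, p, q, u}" "adj E v y = b" "adj E p y = True" "adj E q y = False" "adj E u y = c"
      using ext4H[OF V u d, of b True False c] by (elim bexE conjE)
    then show "\<exists>y\<in>S\<^sub>0 - {u}. adj E u y = c" by (intro bexI[of _ y]) (simp_all add: S\<^sub>0_def)
  qed
  have three: "\<exists>y. y \<in> H - {v, p, q} \<and> adj E v y = \<alpha> \<and> adj E p y = \<beta> \<and> adj E q y = \<gamma>" for \<alpha> \<beta> \<gamma>
    using ext3H[OF V d, of \<alpha> \<beta> \<gamma>] unfolding Bex_def by simp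
  obtain y\<^sub>0 where "y\<^sub>0 \<in> H - {v, p, q}" "adj E v y\<^sub>0 = b" "adj E p y\<^sub>0 = True" "adj E q y\<^sub>0 = False"
    using three[of b True False] by (elim exE conjE)
  then have y0: "y\<^sub>0 \<in> S\<^sub>0" by (simp add: S\<^sub>0_def)
  have nv: "nbh E S v = (if f then {b} else UNIV)"
  proof (cases f)
    case True
    have "S - {v} = S\<^sub>0" using True S0 by (auto simp: S_def)
    moreover have "joined b E v S\<^sub>0" using True by (simp add: joined_def S\<^sub>0_def)
    ultimately have "nbh E S v = {b}" unfolding nbh_eq_singleton_iff using y0 by auto
    then show ?thesis using True by (simp only: if_True)
  next
    case False
    have "nbh E S v = UNIV"
    proof (rule mixedI)
      fix c
      obtain y where "y \<in> H - {v, p, q}" "adj E v y = c" "adj E p y = True" "adj E q y = False"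
        using three[of c True False] by (elim exE conjE)
      then show "\<exists>y\<in>S\<^sub>0 - {v}. adj E v y = c" using False by (intro bexI[of _ y]) (simp_all add: S\<^sub>0_def)
    qed
    then show ?thesis using False by (simp only: if_False)
  qed
  have np: "nbh E S p = (if g then {True} else UNIV)"
  proof (cases g)
    case True
    have "S - {p} \<noteq> {}" using y0 S0 by auto
    moreover have "joined True E p (S - {p})"
      using True p(2) by (auto simp: joined_def S\<^sub>0_def S_def adj_commute[of E p v] split: if_splits)
    ultimately have "nbh E S p = {True}" unfolding nbh_eq_singleton_iff by (rule conjI)
    then show ?thesis using True by (simp only: if_True)
  next
    case False
    have "nbh E S p = UNIV"
    proof (rule mixedI)
      fix c
      obtain y where "y \<in> H - {v, p, q}" "adj E v y = b" "adj E p y = c" "adj E q y = False"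
        using three[of b c False] by (elim exE conjE)
      then show "\<exists>y\<in>S\<^sub>0 - {p}. adj E p y = c" using False by (intro bexI[of _ y]) (simp_all add: S\<^sub>0_def)
    qed
    then show ?thesis using False by (simp only: if_False)
  qed
  have nq: "nbh E S q = (if h then {False} else UNIV)"
  proof (cases h)
    case True
    have "S - {q} \<noteq> {}" using y0 S0 by auto
    moreover have "joined False E q (S - {q})"
      using True q(2) by (auto simp: joined_def S\<^sub>0_def S_def adj_commute[of E q v] split: if_splits)
    ultimately have "nbh E S q = {False}" unfolding nbh_eq_singleton_iff by (rule conjI)
    then show ?thesis using True by (simp only: if_True)
  next
    case False
    have "nbh E S q = UNIV"
    proof (rule mixedI)
      fix c
      obtain y where "y \<in> H - {v, p, q}" "adj E v y = b" "adj E p y = True" "adj E q y = c"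
        using three[of b True c] by (elim exE conjE)
      then show "\<exists>y\<in>S\<^sub>0 - {q}. adj E q y = c" using False by (intro bexI[of _ y]) (simp_all add: S\<^sub>0_def)
    qed
    then show ?thesis using False by (simp only: if_False)
  qed
  have mixed: "nbh E (V - S) u = UNIV" if u: "u \<in> V" for u
    unfolding nbh_eq_UNIV_iff
  proof
    fix c
    have "card {u, v, p, q} \<le> 4" by (simp add: card_insert_if)
    then obtain y where y: "y \<in> V - H - {u, v, p, q}" "\<And>f. f \<in> {u, v, p, q} \<Longrightarrow> adj E f y = (f \<in> {z. c})"
      using extHc[of "{u, v, p, q}" "{z. c}"] u V by blast
    have "adj E u y = c" using y(2)[of u] by simp
    moreover have "y \<in> V - S - {u}" using y(1) S0 by (auto simp: S_def)
    ultimately show "\<exists>y\<in>V - S - {u}. adj E u y = c" by (rule bexI)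
  qed
  have "nbh E S ` S\<^sub>0 = {UNIV}" unfolding image_eq_singleton_iff
    using y0 S0 HV by (intro conjI ballI other) blast+
  then have imS: "nbh E S ` S = (if f then {{b}} else {}) \<union> {UNIV}"
    using nv by (cases f) (simp_all only: S_def image_Un image_insert image_empty if_True if_False)
  have "\<exists>u\<in>V - H. u \<notin> {v, p, q}" using outside_H[of "{v, p, q}"] V by (simp add: card_insert_if)
  then obtain u0 where u0: "u0 \<in> V - H" "u0 \<notin> {v, p, q}" by blast
  let ?R = "V - S - {v, p, q}"
  have "u0 \<in> ?R" using u0 S0 by (auto simp: S_def)
  then have "nbh E S ` ?R = {UNIV}" unfolding image_eq_singleton_iff
    by (intro conjI ballI other) blast+
  then have imU: "nbh E S ` ({p, q} \<union> (if f then {} else {v}) \<union> ?R) =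
      {nbh E S p, nbh E S q} \<union> (if f then {} else {nbh E S v}) \<union> {UNIV}"
    by (cases f) (simp_all only: image_Un image_insert image_empty if_True if_False)
  have "V - S = {p, q} \<union> (if f then {} else {v}) \<union> ?R"
    using V d S0 by (auto simp: S_def)
  from arg_cong[OF this, of "image (nbh E S)"]
  have imR: "nbh E S ` (V - S) = {nbh E S p, nbh E S q} \<union> (if f then {} else {nbh E S v}) \<union> {UNIV}"
    unfolding imU .
  have "nbh E S ` (V - S) = (if g then {{True}} else {}) \<union> (if h then {{False}} else {}) \<union> {UNIV}"
    unfolding imR nv np nq by (cases f; cases g; cases h) (simp_all add: insert_commute)
  also have "\<dots> = J"
    using J unfolding g_def h_def by (intro eq_of_tripleton_membership[of _ "{True}" "{False}" UNIV])
      (simp_all add: singleton_bool_neq_UNIV)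
  finally have imVS: "nbh E S ` (V - S) = J" .
  show ?thesis by (intro exI[of _ S] conjI ballI SV mixed imS imVS)
qed

lemma small_patterns_realised:
  assumes "T \<in> small_patterns P"
  shows "\<exists>S\<subseteq>V. vtypes E V S = (\<lambda>(c, r). (c, r, UNIV)) ` T"
proof -
  have "T = {(False, {})} \<or> T = {(True, {}), (False, {True}), (False, {False})} \<or>
      (\<exists>I J. T = Pair True ` I \<union> Pair False ` J \<and> J \<subseteq> {{True}, {False}, UNIV} \<and> UNIV \<in> J \<and>
        (I = {UNIV} \<or> (\<exists>b. I = {UNIV, {b}}) \<or> (\<exists>b. I = {{b}} \<and> ({\<not> b} \<in> J \<or> P b))))"
    using assms unfolding small_patterns_def Un_iff insert_iff empty_iff mem_Collect_eq
    by (simp only: simp_thms disj_assoc)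
  then have "\<exists>S\<subseteq>V. (\<forall>v\<in>V. nbh E (V - S) v = UNIV) \<and> (\<lambda>v. (v \<in> S, nbh E S v)) ` V = T"
  proof (elim disjE)
    assume T: "T = {(False, {})}"
    have "homog True E {}" by (simp add: homog_def)
    then show ?thesis unfolding T
      by (intro exI[of _ "{}"] conjI ballI empty_subsetI pattern_empty) (rule homog_imp_outside_mixed)
  next
    assume T: "T = {(True, {}), (False, {True}), (False, {False})}"
    obtain x where x: "x \<in> V" using outside_H[of "{}"] by auto
    then have "{x} \<subseteq> V" "homog True E {x}" by (simp_all add: homog_def)
    then show ?thesis unfolding T
      by (intro exI[of _ "{x}"] conjI ballI pattern_singleton x) (assumption, rule homog_imp_outside_mixed)
  next
    assume "\<exists>I J. T = Pair True ` I \<union> Pair False ` J \<and> J \<subseteq> {{True}, {False}, UNIV} \<and> UNIV \<in> J \<and>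
        (I = {UNIV} \<or> (\<exists>b. I = {UNIV, {b}}) \<or> (\<exists>b. I = {{b}} \<and> ({\<not> b} \<in> J \<or> P b)))"
    then obtain I J where T: "T = Pair True ` I \<union> Pair False ` J"
      and J: "J \<subseteq> {{True}, {False}, UNIV}" "UNIV \<in> J"
      and I: "I = {UNIV} \<or> (\<exists>b. I = {UNIV, {b}}) \<or> (\<exists>b. I = {{b}} \<and> ({\<not> b} \<in> J \<or> P b))"
      by (elim exE conjE)
    have "\<exists>S\<subseteq>V. (\<forall>v\<in>V. nbh E (V - S) v = UNIV) \<and> nbh E S ` S = I \<and> nbh E S ` (V - S) = J"
      using I
    proof (elim disjE exE conjE)
      assume I: "I = {UNIV}"
      have "(if False then {{True}} else {}) \<union> {UNIV} = I" unfolding I if_False by (rule Un_empty_left)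
      with mixed_pattern_realised[OF J, of False True] show ?thesis by (simp only:)
    next
      fix b assume I: "I = {UNIV, {b}}"
      have "(if True then {{b}} else {}) \<union> {UNIV} = I" unfolding I if_True by (simp add: insert_commute)
      with mixed_pattern_realised[OF J, of True b] show ?thesis by (simp only:)
    next
      fix b assume I: "I = {{b}}" and c: "{\<not> b} \<in> J"
      show ?thesis unfolding I by (rule homog_pattern_realised[OF J disjI1[OF c]])
    next
      fix b assume I: "I = {{b}}" and c: "P b"
      show ?thesis unfolding I by (rule homog_pattern_realised[OF J disjI2[OF c]])
    qed
    then obtain S where S: "S \<subseteq> V" "\<forall>v\<in>V. nbh E (V - S) v = UNIV" "nbh E S ` S = I" "nbh E S ` (V - S) = J"
      by (elim exE conjE)
    have "(\<lambda>v. (v \<in> S, nbh E S v)) ` V = T"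
      unfolding image_split_by_membership[OF S(1)] S(3,4) T ..
    with S(1,2) show ?thesis by (intro exI[of _ S] conjI)
  qed
  then obtain S where S: "S \<subseteq> V" "\<forall>v\<in>V. nbh E (V - S) v = UNIV" "(\<lambda>v. (v \<in> S, nbh E S v)) ` V = T"
    by (elim exE conjE)
  have "vtypes E V S = (\<lambda>(c, r). (c, r, UNIV)) ` T"
    unfolding S(3)[symmetric] by (rule vtypes_small) (rule S(2)[rule_format])
  with S(1) show ?thesis by (intro exI conjI)
qed

lemma singular_pattern_realised:
  "\<exists>S\<subseteq>V. vtypes E V S = {(c, {b}, {\<not> b}), (True, UNIV, UNIV), (False, UNIV, UNIV)}"
proof -
  obtain x where x: "x \<in> V" using outside_H[of "{}"] by auto
  define S where "S = {y \<in> V - {x}. adj E x y = b} \<union> (if c then {x} else {})"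
  have S: "S \<subseteq> V" "x \<in> S \<longleftrightarrow> c" using x by (auto simp: S_def)
  have inS: "y \<in> S \<longleftrightarrow> adj E x y = b" if "y \<in> V" "y \<noteq> x" for y
    using that by (simp add: S_def)
  show ?thesis using vtypes_singular[OF S(1) x inS] S by (intro exI[of _ S]) (simp only: simp_thms)
qed

text \<open>The right-hand side depends on \<open>P\<close> alone. Through
  \<open>models_E12_cong\<close>, loop-free typical graphs of all sizes with the same
  \<open>P\<close> therefore agree on every sentence of the class.\<close>

lemma realised_vtypes: "vtypes E V ` Pow V = patterns P"
proof
  show "vtypes E V ` Pow V \<subseteq> patterns P"
    by (rule image_subsetI) (rule vtypes_in_patterns, erule PowD)
  show "patterns P \<subseteq> vtypes E V ` Pow V"
  proof
    fix T assume "T \<in> patterns P"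
    then have "\<exists>S\<subseteq>V. vtypes E V S = T" unfolding patterns_def Un_iff mem_Collect_eq
    proof (elim disjE exE conjE imageE)
      fix b c assume T: "T = {(c, {b}, {\<not> b}), (True, UNIV, UNIV), (False, UNIV, UNIV)}"
      show ?thesis unfolding T by (rule singular_pattern_realised)
    next
      fix T' assume T: "T = (\<lambda>(c, r). (c, r, UNIV)) ` T'" and T': "T' \<in> small_patterns P"
      show ?thesis unfolding T by (rule small_patterns_realised[OF T'])
    next
      fix T' assume T: "T = (\<lambda>(c, r). (\<not> c, UNIV, r)) ` T'" and T': "T' \<in> small_patterns P"
      obtain S where S: "S \<subseteq> V" "vtypes E V S = (\<lambda>(c, r). (c, r, UNIV)) ` T'"
        using small_patterns_realised[OF T'] by (elim exE conjE)
      have "vtypes E V (V - S) = T"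
        unfolding vtypes_complement[OF S(1)] S(2) T image_image
        by (rule image_cong[OF refl]) (simp only: split_beta fst_conv snd_conv)
      then show ?thesis by (intro exI[of _ "V - S"] conjI Diff_subset)
    qed
    then obtain S where "S \<subseteq> V" "vtypes E V S = T" by (elim exE conjE)
    then show "T \<in> vtypes E V ` Pow V" by (intro image_eqI[where x = S] PowI) (rule sym)
  qed
qed

end

subsection \<open>Random subsets\<close>

text \<open>\<open>pr p B A\<close> is the probability of \<open>A\<close> for the random subset of \<open>B\<close> that contains every element
  independently with probability \<open>p\<close>.\<close>
definition wt :: "real \<Rightarrow> 'a set \<Rightarrow> 'a set \<Rightarrow> real" where
  "wt p B E = (\<Prod>e\<in>B. if e \<in> E then p else 1 - p)"

definition pr :: "real \<Rightarrow> 'a set \<Rightarrow> ('a set \<Rightarrow> bool) \<Rightarrow> real" where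
  "pr p B A = (\<Sum>E\<in>Pow B. if A E then wt p B E else 0)"

text \<open>Measurability with respect to the coordinates in \<open>D\<close>; disjoint coordinate
  sets yield independence in \<open>pr_indep\<close>.\<close>

definition depends_on :: "('a set \<Rightarrow> bool) \<Rightarrow> 'a set \<Rightarrow> bool" where
  "depends_on A D \<longleftrightarrow> (\<forall>E. A E = A (E \<inter> D))"

text \<open>Carrying the adjacency value \<open>b\<close> along as a parameter treats cliques and
  independent sets together.\<close>

definition bp :: "real \<Rightarrow> bool \<Rightarrow> real" where
  "bp p b = (if b then p else 1 - p)"

lemma sum_Pow_Un:
  assumes "finite B" "finite C" "B \<inter> C = {}"
  shows "(\<Sum>E\<in>Pow (B \<union> C). f E) = (\<Sum>X\<in>Pow B. \<Sum>Y\<in>Pow C. f (X \<union> Y))"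
proof -
  have "(\<Sum>X\<in>Pow B. \<Sum>Y\<in>Pow C. f (X \<union> Y)) = (\<Sum>(X, Y)\<in>Pow B \<times> Pow C. f (X \<union> Y))"
    by (rule sum.cartesian_product)
  also have "\<dots> = (\<Sum>E\<in>Pow (B \<union> C). f E)"
    by (rule sum.reindex_bij_witness[of _ "\<lambda>E. (E \<inter> B, E \<inter> C)" "\<lambda>(X, Y). X \<union> Y"])
      (use assms in \<open>auto simp flip: Int_Un_distrib\<close>)
  finally show ?thesis ..
qed

lemma wt_Un:
  assumes "finite B" "finite C" "B \<inter> C = {}" "X \<subseteq> B" "Y \<subseteq> C"
  shows "wt p (B \<union> C) (X \<union> Y) = wt p B X * wt p C Y"
proof -
  have "wt p (B \<union> C) (X \<union> Y) = (\<Prod>e\<in>B. if e \<in> X \<union> Y then p else 1 - p) * (\<Prod>e\<in>C. if e \<in> X \<union> Y then p else 1 - p)"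
    unfolding wt_def using assms by (intro prod.union_disjoint)
  also have "(\<Prod>e\<in>B. if e \<in> X \<union> Y then p else 1 - p) = wt p B X"
    unfolding wt_def using assms by (intro prod.cong) auto
  also have "(\<Prod>e\<in>C. if e \<in> X \<union> Y then p else 1 - p) = wt p C Y"
    unfolding wt_def using assms by (intro prod.cong) auto
  finally show ?thesis .
qed

lemma pr_product:
  assumes "finite B" "finite C" "B \<inter> C = {}"
  shows "pr p (B \<union> C) (\<lambda>E. A (E \<inter> B) \<and> A' (E \<inter> C)) = pr p B A * pr p C A'"
proof -
  have "pr p (B \<union> C) (\<lambda>E. A (E \<inter> B) \<and> A' (E \<inter> C)) =
      (\<Sum>X\<in>Pow B. \<Sum>Y\<in>Pow C. (if A X then wt p B X else 0) * (if A' Y then wt p C Y else 0))"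
    unfolding pr_def sum_Pow_Un[OF assms]
  proof (intro sum.cong refl)
    fix X Y assume "X \<in> Pow B" "Y \<in> Pow C"
    then have "(X \<union> Y) \<inter> B = X" "(X \<union> Y) \<inter> C = Y" "X \<subseteq> B" "Y \<subseteq> C" using assms by auto
    then show "(if A ((X \<union> Y) \<inter> B) \<and> A' ((X \<union> Y) \<inter> C) then wt p (B \<union> C) (X \<union> Y) else 0) =
        (if A X then wt p B X else 0) * (if A' Y then wt p C Y else 0)"
      using wt_Un[OF assms, of X Y] by simp
  qed
  also have "\<dots> = pr p B A * pr p C A'" unfolding pr_def sum_product ..
  finally show ?thesis .
qed

lemma pr_cong: "(\<And>E. E \<subseteq> B \<Longrightarrow> A E = A' E) \<Longrightarrow> pr p B A = pr p B A'"
  unfolding pr_def by (intro sum.cong) auto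

lemma pr_True: "finite B \<Longrightarrow> pr p B (\<lambda>_. True) = 1"
proof (induction B rule: finite_induct)
  case empty
  show ?case by (simp add: pr_def wt_def)
next
  case (insert x B)
  have "pr p {x} (\<lambda>_. True) = 1" by (simp add: pr_def wt_def Pow_insert)
  then show ?case using pr_product[of "{x}" B p "\<lambda>_. True" "\<lambda>_. True"] insert by simp
qed

locale edge_probability =
  fixes p :: real
  assumes p0: "0 < p" and p1: "p < 1"
begin

lemma bp_pos: "0 < bp p b" and bp_less_1: "bp p b < 1"
  using p0 p1 by (auto simp: bp_def)

lemma wt_nonneg: "0 \<le> wt p B E"
  unfolding wt_def using p0 p1 by (intro prod_nonneg) auto

lemma pr_nonneg: "0 \<le> pr p B A"
  unfolding pr_def by (intro sum_nonneg) (auto simp: wt_nonneg)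

lemma pr_mono: "finite B \<Longrightarrow> (\<And>E. E \<subseteq> B \<Longrightarrow> A E \<Longrightarrow> A' E) \<Longrightarrow> pr p B A \<le> pr p B A'"
  unfolding pr_def by (intro sum_mono) (auto simp: wt_nonneg)

lemma pr_le_1: "finite B \<Longrightarrow> pr p B A \<le> 1"
  using pr_mono[of B A "\<lambda>_. True"] pr_True[of B p] by simp

lemma pr_not: "finite B \<Longrightarrow> pr p B (\<lambda>E. \<not> A E) = 1 - pr p B A"
proof -
  assume B: "finite B"
  have "pr p B (\<lambda>E. \<not> A E) + pr p B A = pr p B (\<lambda>_. True)"
    unfolding pr_def sum.distrib[symmetric] by (intro sum.cong) auto
  then show ?thesis using pr_True[OF B, of p] by simp
qed

lemma pr_Bex_le:
  assumes "finite B" "finite I"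
  shows "pr p B (\<lambda>E. \<exists>i\<in>I. A i E) \<le> (\<Sum>i\<in>I. pr p B (A i))"
proof -
  have "(\<Sum>i\<in>I. pr p B (A i)) = (\<Sum>E\<in>Pow B. \<Sum>i\<in>I. if A i E then wt p B E else 0)"
    unfolding pr_def by (rule sum.swap)
  moreover have "(if \<exists>i\<in>I. A i E then wt p B E else 0) \<le> (\<Sum>i\<in>I. if A i E then wt p B E else 0)" for E
  proof (cases "\<exists>i\<in>I. A i E")
    case True
    then obtain i where i: "i \<in> I" "A i E" by blast
    have "(if A i E then wt p B E else 0) \<le> (\<Sum>i\<in>I. if A i E then wt p B E else 0)"
      using i assms by (intro member_le_sum) (auto simp: wt_nonneg)
    then show ?thesis using i True by auto
  qed (simp add: sum_nonneg wt_nonneg)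
  ultimately show ?thesis unfolding pr_def by (simp add: sum_mono)
qed

lemma pr_conj_ge:
  assumes "finite B"
  shows "pr p B A + pr p B A' - 1 \<le> pr p B (\<lambda>E. A E \<and> A' E)"
proof -
  have "pr p B A + pr p B A' \<le> pr p B (\<lambda>E. A E \<and> A' E) + pr p B (\<lambda>_. True)"
    unfolding pr_def sum.distrib[symmetric] by (intro sum_mono) (auto simp: wt_nonneg)
  then show ?thesis using pr_True[OF assms, of p] by simp
qed

lemma pr_indep:
  assumes B: "finite B" and A: "depends_on A D" and A': "depends_on A' D'" and disj: "D \<inter> D' = {}"
  shows "pr p B (\<lambda>E. A E \<and> A' E) = pr p B A * pr p B A'"
proof -
  define X Y where "X = B \<inter> D" and "Y = B - D"
  have XY: "finite X" "finite Y" "X \<inter> Y = {}" "B = X \<union> Y" using B by (auto simp: X_def Y_def)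
  have AX: "A E \<longleftrightarrow> A (E \<inter> X)" if "E \<subseteq> B" for E
  proof -
    have "E \<inter> X = E \<inter> D" using that by (auto simp: X_def)
    then show ?thesis using A unfolding depends_on_def by metis
  qed
  have AY: "A' E \<longleftrightarrow> A' (E \<inter> Y)" if "E \<subseteq> B" for E
  proof -
    have "E \<inter> Y \<inter> D' = E \<inter> D'" using that disj by (auto simp: Y_def)
    then show ?thesis using A' unfolding depends_on_def by metis
  qed
  have "pr p B (\<lambda>E. A E \<and> A' E) = pr p (X \<union> Y) (\<lambda>E. A (E \<inter> X) \<and> A' (E \<inter> Y))"
    unfolding XY(4)[symmetric] using AX AY by (intro pr_cong) blast
  also have "\<dots> = pr p X A * pr p Y A'" by (rule pr_product[OF XY(1-3)])
  also have "pr p X A = pr p (X \<union> Y) (\<lambda>E. A (E \<inter> X) \<and> True)"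
    using pr_product[OF XY(1-3), of p A "\<lambda>_. True"] pr_True[OF XY(2), of p] by simp
  also have "\<dots> = pr p B A" unfolding XY(4)[symmetric] using AX by (intro pr_cong) blast
  also have "pr p Y A' = pr p (X \<union> Y) (\<lambda>E. True \<and> A' (E \<inter> Y))"
    using pr_product[OF XY(1-3), of p "\<lambda>_. True" A'] pr_True[OF XY(1), of p] by simp
  also have "\<dots> = pr p B A'" unfolding XY(4)[symmetric] using AY by (intro pr_cong) blast
  finally show ?thesis .
qed

lemma depends_on_mono: "depends_on A D \<Longrightarrow> D \<subseteq> D' \<Longrightarrow> depends_on A D'"
  unfolding depends_on_def by (metis Int_absorb2 Int_assoc inf_commute)

lemma depends_on_Ball:
  assumes "\<And>i. i \<in> I \<Longrightarrow> depends_on (A i) (D i)"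
  shows "depends_on (\<lambda>E. \<forall>i\<in>I. A i E) (\<Union>i\<in>I. D i)"
proof -
  have "depends_on (A i) (\<Union>i\<in>I. D i)" if "i \<in> I" for i
    using depends_on_mono[OF assms[OF that]] that by blast
  then show ?thesis unfolding depends_on_def by metis
qed

lemma depends_on_all_eq: "depends_on (\<lambda>E. \<forall>e\<in>D. (e \<in> E) = b) D"
  unfolding depends_on_def by auto

lemma depends_on_not: "depends_on A D \<Longrightarrow> depends_on (\<lambda>E. \<not> A E) D"
  unfolding depends_on_def by metis

lemma depends_on_conj: "depends_on A D \<Longrightarrow> depends_on A' D \<Longrightarrow> depends_on (\<lambda>E. A E \<and> A' E) D"
  unfolding depends_on_def by metis

lemma pr_Ball:
  assumes "finite B" "finite I" "\<And>i. i \<in> I \<Longrightarrow> depends_on (A i) (D i)"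
    and "\<And>i j. i \<in> I \<Longrightarrow> j \<in> I \<Longrightarrow> i \<noteq> j \<Longrightarrow> D i \<inter> D j = {}"
  shows "pr p B (\<lambda>E. \<forall>i\<in>I. A i E) = (\<Prod>i\<in>I. pr p B (A i))"
  using assms(2,3,4)
proof (induction I rule: finite_induct)
  case empty
  then show ?case by (simp add: pr_True assms(1))
next
  case (insert i I)
  have "pr p B (\<lambda>E. \<forall>j\<in>insert i I. A j E) = pr p B (\<lambda>E. A i E \<and> (\<forall>j\<in>I. A j E))" by simp
  also have "\<dots> = pr p B (A i) * pr p B (\<lambda>E. \<forall>j\<in>I. A j E)"
  proof (rule pr_indep[OF assms(1)])
    show "depends_on (A i) (D i)" using insert.prems by simp
    show "depends_on (\<lambda>E. \<forall>j\<in>I. A j E) (\<Union>j\<in>I. D j)"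
      using insert.prems by (intro depends_on_Ball) simp
    have "D i \<inter> D j = {}" if "j \<in> I" for j using insert.prems(2)[of i j] insert.hyps that by auto
    then show "D i \<inter> (\<Union>j\<in>I. D j) = {}" by blast
  qed
  also have "\<dots> = (\<Prod>j\<in>insert i I. pr p B (A j))" using insert by simp
  finally show ?case .
qed

lemma pr_single: "finite B \<Longrightarrow> e \<in> B \<Longrightarrow> pr p B (\<lambda>E. (e \<in> E) = b) = bp p b"
proof -
  assume B: "finite B" "e \<in> B"
  then have B': "finite {e}" "finite (B - {e})" "{e} \<inter> (B - {e}) = {}" "B = {e} \<union> (B - {e})" by auto
  have "pr p B (\<lambda>E. (e \<in> E) = b) = pr p ({e} \<union> (B - {e})) (\<lambda>E. (e \<in> E \<inter> {e}) = b \<and> True)"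
    unfolding B'(4)[symmetric] by simp
  also have "\<dots> = pr p {e} (\<lambda>E. (e \<in> E) = b)"
    unfolding pr_product[OF B'(1-3), of p "\<lambda>E. (e \<in> E) = b" "\<lambda>_. True"] by (simp add: pr_True[OF B'(2)])
  also have "\<dots> = bp p b" by (cases b) (simp_all add: pr_def wt_def Pow_insert bp_def)
  finally show ?thesis .
qed

lemma pr_all_eq:
  assumes "finite B" "D \<subseteq> B"
  shows "pr p B (\<lambda>E. \<forall>e\<in>D. (e \<in> E) = b) = bp p b ^ card D"
proof -
  have D: "finite D" using assms finite_subset by blast
  have "pr p B (\<lambda>E. \<forall>e\<in>D. (e \<in> E) = b) = (\<Prod>e\<in>D. pr p B (\<lambda>E. (e \<in> E) = b))"
    by (rule pr_Ball[where D = "\<lambda>e. {e}"]) (use assms D in \<open>auto simp: depends_on_def\<close>)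
  also have "\<dots> = (\<Prod>e\<in>D. bp p b)" using assms by (intro prod.cong) (auto simp: pr_single)
  finally show ?thesis by simp
qed

text \<open>Cauchy-Schwarz for the number \<open>Z\<close> of events that occur and the indicator of
  \<open>Z \<noteq> 0\<close>, with the weight split into two square roots. The uncentred form
  serves both for limits equal to 1 and for a positive lower bound when the second moment is only
  within a constant factor of the squared first moment.\<close>

lemma second_moment:
  assumes B: "finite B" and I: "finite I"
  shows "(\<Sum>i\<in>I. pr p B (A i))\<^sup>2 \<le>
    pr p B (\<lambda>E. \<exists>i\<in>I. A i E) * (\<Sum>i\<in>I. \<Sum>j\<in>I. pr p B (\<lambda>E. A i E \<and> A j E))"
proof -
  define Z where "Z E = (\<Sum>i\<in>I. if A i E then 1 else 0 :: real)" for E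
  let ?s = "\<lambda>E. sqrt (wt p B E)"
  have sq: "?s E * ?s E = wt p B E" for E by (simp add: wt_nonneg)
  have m1: "(\<Sum>i\<in>I. pr p B (A i)) = (\<Sum>E\<in>Pow B. wt p B E * Z E)"
    unfolding pr_def sum.swap[of _ _ I] Z_def sum_distrib_left by (intro sum.cong refl) auto
  have m2: "(\<Sum>i\<in>I. \<Sum>j\<in>I. pr p B (\<lambda>E. A i E \<and> A j E)) = (\<Sum>E\<in>Pow B. wt p B E * (Z E)\<^sup>2)"
  proof -
    have "(Z E)\<^sup>2 = (\<Sum>i\<in>I. \<Sum>j\<in>I. if A i E \<and> A j E then 1 else 0)" for E
      unfolding Z_def power2_eq_square sum_product by (intro sum.cong refl) auto
    then have "wt p B E * (Z E)\<^sup>2 = (\<Sum>i\<in>I. \<Sum>j\<in>I. if A i E \<and> A j E then wt p B E else 0)" for E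
      by (simp add: sum_distrib_left if_distrib cong: if_cong)
    then show ?thesis unfolding pr_def
      by (simp add: sum.swap[of _ "Pow B"])
  qed
  have pos: "Z E \<noteq> 0 \<longleftrightarrow> (\<exists>i\<in>I. A i E)" for E
    unfolding Z_def using I by (subst sum_nonneg_eq_0_iff) auto
  define u where "u E = (if \<exists>i\<in>I. A i E then ?s E else 0)" for E
  have "(\<Sum>E\<in>Pow B. wt p B E * Z E) = (\<Sum>E\<in>Pow B. u E * (?s E * Z E))"
  proof (intro sum.cong refl)
    fix E
    show "wt p B E * Z E = u E * (?s E * Z E)"
      using pos[of E] sq[of E] by (cases "\<exists>i\<in>I. A i E") (auto simp: u_def)
  qed
  also have "(\<dots>)\<^sup>2 \<le> (\<Sum>E\<in>Pow B. (u E)\<^sup>2) * (\<Sum>E\<in>Pow B. (?s E * Z E)\<^sup>2)"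
    by (rule Cauchy_Schwarz_ineq_sum)
  also have "(\<Sum>E\<in>Pow B. (u E)\<^sup>2) = pr p B (\<lambda>E. \<exists>i\<in>I. A i E)"
    unfolding pr_def by (intro sum.cong refl) (simp add: u_def wt_nonneg)
  also have "(\<Sum>E\<in>Pow B. (?s E * Z E)\<^sup>2) = (\<Sum>E\<in>Pow B. wt p B E * (Z E)\<^sup>2)"
    by (intro sum.cong refl) (auto simp: power_mult_distrib wt_nonneg)
  finally show ?thesis unfolding m1 m2 .
qed

end

subsection \<open>Cliques and independent sets in the random graph\<close>

definition pairs :: "nat set \<Rightarrow> nat set set" where
  "pairs A = {e. e \<subseteq> A \<and> card e = 2}"

definition star :: "nat \<Rightarrow> nat set \<Rightarrow> nat set set" where
  "star u X = (\<lambda>y. {u, y}) ` X"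

lemma all_pairs_eq_pairs: "all_pairs n = pairs {1..n}"
proof
  show "all_pairs n \<subseteq> pairs {1..n}" by (auto simp: all_pairs_def pairs_def)
  show "pairs {1..n} \<subseteq> all_pairs n"
  proof
    fix e assume e: "e \<in> pairs {1..n}"
    then obtain x y where xy: "e = {x, y}" "x \<noteq> y" by (auto simp: pairs_def card_2_iff)
    have "\<exists>i j. 1 \<le> i \<and> i < j \<and> j \<le> n \<and> e = {i, j}"
    proof (cases "x < y")
      case True
      then show ?thesis using e xy by (intro exI[of _ x] exI[of _ y]) (auto simp: pairs_def)
    next
      case False
      then show ?thesis using e xy by (intro exI[of _ y] exI[of _ x]) (auto simp: pairs_def)
    qed
    then show "e \<in> all_pairs n" by (simp add: all_pairs_def)
  qed
qed

lemma finite_pairs [simp]: "finite A \<Longrightarrow> finite (pairs A)"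
  unfolding pairs_def by (rule finite_subset[of _ "Pow A"]) auto

lemma card_pairs: "finite A \<Longrightarrow> card (pairs A) = card A choose 2"
  unfolding pairs_def by (rule n_subsets)

lemma pairs_mono: "A \<subseteq> B \<Longrightarrow> pairs A \<subseteq> pairs B"
  by (auto simp: pairs_def)

lemma pairs_Int: "pairs A \<inter> pairs B = pairs (A \<inter> B)"
  by (auto simp: pairs_def)

lemma no_loops: "E \<subseteq> pairs A \<Longrightarrow> {v} \<notin> E"
  by (auto simp: pairs_def)

lemma card_star: "card (star u X) = card X"
  unfolding star_def by (intro card_image) (auto simp: inj_on_def doubleton_eq_iff)

lemma star_subset_pairs: "u \<in> A \<Longrightarrow> X \<subseteq> A \<Longrightarrow> u \<notin> X \<Longrightarrow> star u X \<subseteq> pairs A"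
  by (auto simp: star_def pairs_def card_2_iff)

lemma star_Int_star: "u \<noteq> u' \<Longrightarrow> u \<notin> W \<Longrightarrow> u' \<notin> W \<Longrightarrow> star u W \<inter> star u' W = {}"
  by (auto simp: star_def doubleton_eq_iff)

lemma pairs_Int_star: "u \<notin> W \<Longrightarrow> pairs W \<inter> star u X = {}"
  by (auto simp: star_def pairs_def)

lemma homog_iff_pairs: "homog b E X \<longleftrightarrow> (\<forall>e\<in>pairs X. (e \<in> E) = b)"
proof
  assume h: "homog b E X"
  show "\<forall>e\<in>pairs X. (e \<in> E) = b"
  proof
    fix e assume "e \<in> pairs X"
    then obtain x y where "e = {x, y}" "x \<noteq> y" "x \<in> X" "y \<in> X" by (auto simp: pairs_def card_2_iff)
    then show "(e \<in> E) = b" using h by (simp add: homog_def adj_def)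
  qed
next
  assume h: "\<forall>e\<in>pairs X. (e \<in> E) = b"
  show "homog b E X" unfolding homog_def adj_def
  proof (intro ballI impI)
    fix x y assume "x \<in> X" "y \<in> X" "x \<noteq> y"
    then have "{x, y} \<in> pairs X" by (auto simp: pairs_def card_2_iff)
    then show "({x, y} \<in> E) = b" using h by (rule bspec[rotated])
  qed
qed

lemma joined_iff_star: "joined b E u X \<longleftrightarrow> (\<forall>e\<in>star u X. (e \<in> E) = b)"
  by (simp add: joined_def star_def adj_def)

text \<open>Writing the probability of a pair as a square removes the division by two from the
  exponent, so that \<open>t = sqrt (bp p b)\<close> can be compared with \<open>s\<close>
  directly.\<close>

lemma choose_two_square: "(x ^ 2) ^ (l choose 2) = (x :: real) ^ (l * (l - 1))"
proof -
  have "2 * (l choose 2) = l * (l - 1)"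
    unfolding choose_two by (rule dvd_mult_div_cancel) (cases l; simp)
  then show ?thesis by (simp flip: power_mult)
qed

text \<open>Factor by factor, \<open>(k - i) / (n - i) \<le> k / n\<close>.\<close>

lemma choose_ratio_le:
  fixes k n l :: nat
  assumes "l \<le> k" "k \<le> n" "0 < n"
  shows "real (k choose l) / real (n choose l) \<le> (real k / real n) ^ l"
  using assms(1)
proof (induction l)
  case (Suc l)
  have abs: "real (k choose Suc l) * (1 + real l) = real (k choose l) * (real k - real l)" if "Suc l \<le> k" for k
    using binomial_absorb_comp[of k l] that
    by (metis Suc_leD binomial_absorption mult.commute of_nat_Suc of_nat_diff of_nat_mult Suc_times_binomial_eq binomial_absorb_comp times_binomial_minus1_eq)
  have "real (k choose Suc l) / real (n choose Suc l) =
      (real (k choose l) / real (n choose l)) * ((real k - real l) / (real n - real l))"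
  proof -
    have "real (k choose Suc l) = real (k choose l) * (real k - real l) / (1 + real l)"
      "real (n choose Suc l) = real (n choose l) * (real n - real l) / (1 + real l)"
      using abs[of k] abs[of n] Suc.prems assms by (simp_all add: eq_divide_eq)
    then show ?thesis by (simp only: times_divide_times_eq) (simp add: divide_divide_eq_left divide_divide_eq_right)
  qed
  also have "\<dots> \<le> (real k / real n) ^ l * (real k / real n)"
  proof (rule mult_mono)
    show "(real k - real l) / (real n - real l) \<le> real k / real n"
      using Suc.prems assms mult_right_mono[of "real k" "real n" "real l"] by (simp add: field_simps)
    show "0 \<le> (real k - real l) / (real n - real l)" using Suc.prems assms by simp
  qed (use Suc in auto)
  finally show ?case by (simp add: mult.commute)
qed simp

text \<open>\<open>Y\<close> is split into \<open>Z = X \<inter> Y\<close> and the rest. The rest is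
  counted in \<open>V - Z\<close> instead of \<open>V - X\<close>; this overcounts, but
  \<open>choose_mult\<close> then turns the count for overlap \<open>l\<close> into
  \<open>N choose k\<close> times a ratio of binomials, the form that a second moment is compared
  with.\<close>

lemma sum_over_subsets_by_intersection:
  fixes f :: "nat \<Rightarrow> real"
  assumes V: "finite V" "card V = N" and X: "X \<subseteq> V" "card X = k" and f: "\<And>l. 0 \<le> f l"
  shows "(\<Sum>Y\<in>{Y. Y \<subseteq> V \<and> card Y = k}. f (card (X \<inter> Y))) \<le>
    real (N choose k) * (\<Sum>l\<le>k. real (k choose l) ^ 2 / real (N choose l) * f l)"
proof -
  let ?F = "{Y. Y \<subseteq> V \<and> card Y = k}"
  have finX: "finite X" using X V finite_subset by blast
  have kN: "k \<le> N" using X V card_mono by blast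
  have finF: "finite ?F" by (rule finite_subset[of _ "Pow V"]) (use V in auto)
  have le: "card (X \<inter> Y) \<le> k" for Y using X finX by (metis card_mono inf_le1)
  have "(\<Sum>Y\<in>?F. f (card (X \<inter> Y))) = (\<Sum>l\<le>k. \<Sum>Y\<in>{Y \<in> ?F. card (X \<inter> Y) = l}. f (card (X \<inter> Y)))"
    by (rule sum.group[symmetric]) (use finF le in auto)
  also have "\<dots> = (\<Sum>l\<le>k. real (card {Y \<in> ?F. card (X \<inter> Y) = l}) * f l)" by simp
  also have "\<dots> \<le> (\<Sum>l\<le>k. real (N choose k) * (real (k choose l) ^ 2 / real (N choose l) * f l))"
  proof (rule sum_mono)
    fix l assume "l \<in> {..k}"
    then have l: "l \<le> k" by simp
    let ?S = "SIGMA Z:{Z. Z \<subseteq> X \<and> card Z = l}. {Y. Y \<subseteq> V - Z \<and> card Y = k - l}"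
    have inj: "inj_on (\<lambda>Y. (X \<inter> Y, Y - X)) {Y \<in> ?F. card (X \<inter> Y) = l}" by (auto simp: inj_on_def)
    have sub: "(\<lambda>Y. (X \<inter> Y, Y - X)) ` {Y \<in> ?F. card (X \<inter> Y) = l} \<subseteq> ?S"
    proof (rule image_subsetI)
      fix Y assume Y: "Y \<in> {Y \<in> ?F. card (X \<inter> Y) = l}"
      then have fY: "finite Y" using V finite_subset by blast
      have "Y - X = Y - (X \<inter> Y)" by blast
      then have "card (Y - X) = k - l" using Y fY by (simp add: card_Diff_subset)
      then show "(X \<inter> Y, Y - X) \<in> ?S" using Y by auto
    qed
    have c2: "card {Y. Y \<subseteq> V - Z \<and> card Y = k - l} = (N - l) choose (k - l)"
      if "Z \<in> {Z. Z \<subseteq> X \<and> card Z = l}" for Z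
    proof -
      have "card (V - Z) = N - l" using that X V finX finite_subset[of Z X] by (subst card_Diff_subset) auto
      then show ?thesis using V n_subsets[of "V - Z" "k - l"] by simp
    qed
    have finZ: "finite {Z. Z \<subseteq> X \<and> card Z = l}"
      by (rule finite_subset[of _ "Pow X"]) (use finX in auto)
    have finY: "finite {Y. Y \<subseteq> V - Z \<and> card Y = k - l}" for Z
      by (rule finite_subset[of _ "Pow V"]) (use V in auto)
    have finS: "finite ?S" by (intro finite_SigmaI finZ finY)
    have "card {Y \<in> ?F. card (X \<inter> Y) = l} \<le> card ?S"
      by (rule card_inj_on_le[OF inj sub finS])
    also have "card ?S = (\<Sum>Z\<in>{Z. Z \<subseteq> X \<and> card Z = l}. (N - l) choose (k - l))"
      using card_SigmaI[OF finZ, of "\<lambda>Z. {Y. Y \<subseteq> V - Z \<and> card Y = k - l}"] finY c2 by simp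
    also have "\<dots> = (k choose l) * ((N - l) choose (k - l))" using n_subsets[OF finX, of l] X by simp
    finally have "card {Y \<in> ?F. card (X \<inter> Y) = l} \<le> (k choose l) * ((N - l) choose (k - l))" .
    then have "real (card {Y \<in> ?F. card (X \<inter> Y) = l}) \<le> real (k choose l) * real ((N - l) choose (k - l))"
      by (simp only: of_nat_mult[symmetric] of_nat_le_iff)
    also have "real ((N - l) choose (k - l)) = real (N choose k) * real (k choose l) / real (N choose l)"
    proof -
      have "(N choose k) * (k choose l) = (N choose l) * ((N - l) choose (k - l))"
        using choose_mult[OF l kN] .
      then have "real (N choose k) * real (k choose l) = real (N choose l) * real ((N - l) choose (k - l))"
        by (metis of_nat_mult)
      moreover have "real (N choose l) > 0" using l kN by simp
      ultimately show ?thesis by (simp add: field_simps)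
    qed
    finally have "real (card {Y \<in> ?F. card (X \<inter> Y) = l}) * f l \<le>
        (real (k choose l) * (real (N choose k) * real (k choose l) / real (N choose l))) * f l"
      using f by (intro mult_right_mono)
    then show "real (card {Y \<in> ?F. card (X \<inter> Y) = l}) * f l \<le>
        real (N choose k) * (real (k choose l) ^ 2 / real (N choose l) * f l)"
      by (simp add: power2_eq_square algebra_simps)
  qed
  also have "\<dots> = real (N choose k) * (\<Sum>l\<le>k. real (k choose l) ^ 2 / real (N choose l) * f l)"
    by (rule sum_distrib_left[symmetric])
  finally show ?thesis .
qed

context edge_probability
begin

abbreviation Pr :: "nat \<Rightarrow> (nat set set \<Rightarrow> bool) \<Rightarrow> real" where
  "Pr n A \<equiv> pr p (pairs {1..n}) A"

lemma prob_Gnp_eq_Pr: "prob_Gnp n p \<phi> = Pr n (\<lambda>E. models_E12 E {1..n} \<phi>)"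
proof -
  have "p ^ card E * (1 - p) ^ (card (pairs {1..n}) - card E) = wt p (pairs {1..n}) E"
    if "E \<in> Pow (pairs {1..n})" for E
  proof -
    let ?B = "pairs {1..n}"
    have "wt p ?B E = (\<Prod>e\<in>E. if e \<in> E then p else 1 - p) * (\<Prod>e\<in>?B - E. if e \<in> E then p else 1 - p)"
      unfolding wt_def using that by (subst prod.subset_diff[of E ?B]) (auto simp: mult.commute)
    also have "\<dots> = p ^ card E * (1 - p) ^ card (?B - E)" by simp
    also have "card (?B - E) = card ?B - card E"
      using that finite_subset[of E ?B] by (intro card_Diff_subset) auto
    finally show ?thesis ..
  qed
  then show ?thesis unfolding prob_Gnp_def pr_def all_pairs_eq_pairs by (intro sum.cong) auto
qed

text \<open>The pairs inside \<open>W\<close> and the stars from different outside vertices to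
  \<open>W\<close> are pairwise disjoint sets of edges, so the events living on them are
  independent.\<close>

lemma pr_inside_outside:
  assumes B: "finite B" and U: "finite U" "W \<inter> U = {}"
    and A: "depends_on A (pairs W)" and N: "\<And>u. u \<in> U \<Longrightarrow> depends_on (N u) (star u W)"
  shows "pr p B (\<lambda>E. A E \<and> (\<forall>u\<in>U. N u E)) = pr p B A * (\<Prod>u\<in>U. pr p B (N u))"
proof -
  have "pr p B (\<lambda>E. A E \<and> (\<forall>u\<in>U. N u E)) = pr p B A * pr p B (\<lambda>E. \<forall>u\<in>U. N u E)"
  proof (rule pr_indep[OF B A])
    show "depends_on (\<lambda>E. \<forall>u\<in>U. N u E) (\<Union>u\<in>U. star u W)" using N by (rule depends_on_Ball)
    show "pairs W \<inter> (\<Union>u\<in>U. star u W) = {}" using pairs_Int_star U(2) by blast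
  qed
  also have "pr p B (\<lambda>E. \<forall>u\<in>U. N u E) = (\<Prod>u\<in>U. pr p B (N u))"
    using star_Int_star U(2) by (intro pr_Ball[OF B U(1) N]) blast+
  finally show ?thesis .
qed

lemma depends_on_homog: "depends_on (\<lambda>E. homog b E X) (pairs X)"
  unfolding homog_iff_pairs by (rule depends_on_all_eq)

lemma depends_on_joined: "depends_on (\<lambda>E. joined b E u X) (star u X)"
  unfolding joined_iff_star by (rule depends_on_all_eq)

lemma pr_homog: "X \<subseteq> {1..n} \<Longrightarrow> Pr n (\<lambda>E. homog b E X) = bp p b ^ (card X choose 2)"
  unfolding homog_iff_pairs
  by (subst pr_all_eq) (auto simp: pairs_mono card_pairs[OF finite_subset[of X "{1..n}"]])

lemma pr_joined:
  "u \<in> {1..n} \<Longrightarrow> X \<subseteq> {1..n} \<Longrightarrow> u \<notin> X \<Longrightarrow> Pr n (\<lambda>E. joined b E u X) = bp p b ^ card X"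
  unfolding joined_iff_star by (subst pr_all_eq) (auto simp: star_subset_pairs card_star)

lemma pr_not_joined:
  "u \<in> {1..n} \<Longrightarrow> X \<subseteq> {1..n} \<Longrightarrow> u \<notin> X \<Longrightarrow> Pr n (\<lambda>E. \<not> joined b E u X) = 1 - bp p b ^ card X"
  using pr_not[of "pairs {1..n}" "\<lambda>E. joined b E u X"] pr_joined[of u n X b] by simp

lemma pr_two_homog:
  assumes "X \<subseteq> {1..n}" "Y \<subseteq> {1..n}"
  shows "Pr n (\<lambda>E. homog b E X \<and> homog b E Y) =
    bp p b ^ (card X choose 2) * bp p b ^ (card Y choose 2) / bp p b ^ (card (X \<inter> Y) choose 2)"
proof -
  have fin: "finite X" "finite Y" using assms finite_subset by blast+
  have "Pr n (\<lambda>E. homog b E X \<and> homog b E Y) = Pr n (\<lambda>E. \<forall>e\<in>pairs X \<union> pairs Y. (e \<in> E) = b)"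
    unfolding homog_iff_pairs by (rule pr_cong) blast
  also have "\<dots> = bp p b ^ card (pairs X \<union> pairs Y)"
    using assms by (intro pr_all_eq) (auto simp: pairs_mono)
  also have "\<dots> = bp p b ^ (card X choose 2) * bp p b ^ (card Y choose 2) / bp p b ^ (card (X \<inter> Y) choose 2)"
  proof -
    have "card (pairs X \<union> pairs Y) + (card (X \<inter> Y) choose 2) = (card X choose 2) + (card Y choose 2)"
      using card_Un_Int[of "pairs X" "pairs Y"] fin by (simp add: pairs_Int card_pairs)
    then have "bp p b ^ card (pairs X \<union> pairs Y) * bp p b ^ (card (X \<inter> Y) choose 2) =
        bp p b ^ (card X choose 2) * bp p b ^ (card Y choose 2)" by (simp flip: power_add)
    then show ?thesis using bp_pos[of b] by (simp add: field_simps)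
  qed
  finally show ?thesis .
qed

lemma pr_neither:
  assumes "finite B"
  shows "pr p B (\<lambda>E. \<not> A E \<and> \<not> A' E) = 1 - pr p B A - pr p B A' + pr p B (\<lambda>E. A E \<and> A' E)"
proof -
  have "pr p B (\<lambda>E. \<not> A E \<and> \<not> A' E) + pr p B A + pr p B A' = pr p B (\<lambda>_. True) + pr p B (\<lambda>E. A E \<and> A' E)"
    unfolding pr_def sum.distrib[symmetric] by (intro sum.cong) auto
  then show ?thesis using pr_True[OF assms, of p] by simp
qed

lemma pr_joined_neither:
  assumes "u \<in> {1..n}" "X \<subseteq> {1..n}" "u \<notin> X" "Y \<subseteq> {1..n}" "u \<notin> Y"
  shows "Pr n (\<lambda>E. \<not> joined b E u X \<and> \<not> joined b E u Y) =
    1 - bp p b ^ card X - bp p b ^ card Y + bp p b ^ card (X \<union> Y)"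
proof -
  have "(\<lambda>E. joined b E u X \<and> joined b E u Y) = (\<lambda>E. joined b E u (X \<union> Y))"
    by (auto simp: joined_def)
  then show ?thesis
    using pr_neither[of "pairs {1..n}" "\<lambda>E. joined b E u X" "\<lambda>E. joined b E u Y"] assms
      pr_joined[of u n X b] pr_joined[of u n Y b] pr_joined[of u n "X \<union> Y" b] by simp
qed

end

lemma sum_power_le_geometric:
  fixes x :: real
  assumes "0 \<le> x" "x < 1"
  shows "(\<Sum>l\<le>k. x ^ l) \<le> 1 / (1 - x)"
proof -
  have "(1 - x) * (\<Sum>l\<le>k. x ^ l) = 1 - x ^ Suc k" by (rule sum_gp_basic)
  also have "\<dots> \<le> 1" using assms by simp
  finally show ?thesis using assms by (simp add: field_simps)
qed

lemma binomial_le_power: "n choose k \<le> n ^ k"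
  by (cases "k \<le> n") (simp_all add: binomial_le_pow binomial_eq_0)

lemma binomial_le_power_real: "real (n choose k) \<le> real n ^ k"
  using binomial_le_power[of n k] by (simp flip: of_nat_power)

section \<open>Moment bounds for homogeneous sets and for the extension property\<close>

context edge_probability
begin

lemma pr_homog_joined:
  assumes "X \<subseteq> {1..n}" "v \<in> {1..n}" "v \<notin> X"
  shows "Pr n (\<lambda>E. homog b E X \<and> joined c E v X) = bp p b ^ (card X choose 2) * bp p c ^ card X"
proof -
  have "Pr n (\<lambda>E. homog b E X \<and> joined c E v X) = Pr n (\<lambda>E. homog b E X) * Pr n (\<lambda>E. joined c E v X)"
    by (rule pr_indep[OF _ depends_on_homog depends_on_joined]) (auto simp: pairs_Int_star assms)
  then show ?thesis using pr_homog[OF assms(1), of b] pr_joined[OF assms(2,1,3), of c] by simp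
qed

lemma pr_two_homog_joined:
  assumes XY: "X \<subseteq> {1..n}" "Y \<subseteq> {1..n}" and v: "v \<in> {1..n}" "v \<notin> X" "v \<notin> Y"
    and k: "card X = k" "card Y = k"
  shows "Pr n (\<lambda>E. (homog b E X \<and> joined c E v X) \<and> (homog b E Y \<and> joined c E v Y)) =
    (bp p b ^ (k choose 2) * bp p c ^ k)\<^sup>2 / (bp p b ^ (card (X \<inter> Y) choose 2) * bp p c ^ card (X \<inter> Y))"
proof -
  have fin: "finite X" "finite Y" using XY finite_subset by blast+
  have "Pr n (\<lambda>E. (homog b E X \<and> joined c E v X) \<and> (homog b E Y \<and> joined c E v Y)) =
      Pr n (\<lambda>E. (homog b E X \<and> homog b E Y) \<and> joined c E v (X \<union> Y))"
    by (rule pr_cong) (auto simp: joined_def)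
  also have "\<dots> = Pr n (\<lambda>E. homog b E X \<and> homog b E Y) * Pr n (\<lambda>E. joined c E v (X \<union> Y))"
  proof (rule pr_indep[OF _ _ depends_on_joined])
    show "depends_on (\<lambda>E. homog b E X \<and> homog b E Y) (pairs (X \<union> Y))"
      by (intro depends_on_conj depends_on_mono[OF depends_on_homog] pairs_mono) auto
    show "pairs (X \<union> Y) \<inter> star v (X \<union> Y) = {}" using v by (intro pairs_Int_star) auto
  qed simp
  also have "Pr n (\<lambda>E. joined c E v (X \<union> Y)) = bp p c ^ card (X \<union> Y)"
    using XY v by (intro pr_joined) auto
  also have "\<dots> = bp p c ^ k * bp p c ^ k / bp p c ^ card (X \<inter> Y)"
  proof -
    have "card (X \<union> Y) + card (X \<inter> Y) = k + k" using card_Un_Int[OF fin] k by simp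
    then have "bp p c ^ card (X \<union> Y) * bp p c ^ card (X \<inter> Y) = bp p c ^ k * bp p c ^ k"
      by (simp flip: power_add)
    then show ?thesis using bp_pos[of c] by (simp add: field_simps)
  qed
  finally show ?thesis unfolding pr_two_homog[OF XY] k by (simp add: power2_eq_square)
qed

text \<open>The apex is fixed to be vertex \<open>n\<close> and \<open>X\<close> ranges over sets of
  other vertices. The condition on the remaining vertices is kept in the first moment only, which
  costs the factor \<open>(1 - s ^ k) ^ (2 * (n - 1 - k))\<close>, at least
  \<open>1 - 2 * n * s ^ k\<close> by Bernoulli's inequality. Relative to the squared first moment
  without that condition, the pairs with overlap \<open>l\<close> contribute at most
  \<open>x ^ l\<close>.\<close>

lemma homog_with_apex_lower_bound:
  fixes n k :: nat and b c d :: bool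
  defines "x \<equiv> real k ^ 2 / (real (n - 1) * bp p c * sqrt (bp p b) ^ k)"
  assumes n: "2 \<le> n" "k < n" and x: "x < 1"
  shows "(1 - 2 * real n * bp p d ^ k) * (1 - x) \<le>
    Pr n (\<lambda>E. \<exists>X\<in>{X. X \<subseteq> {1..n-1} \<and> card X = k}. (homog b E X \<and> joined c E n X) \<and>
      (\<forall>u\<in>{1..n-1} - X. \<not> joined d E u X))"
proof -
  let ?I = "{X. X \<subseteq> {1..n-1} \<and> card X = k}"
  define q r s t where "q = bp p b" and "r = bp p c" and "s = bp p d" and "t = sqrt q"
  have pos: "0 < q" "q < 1" "0 < r" "r < 1" "0 < s" "s < 1"
    using bp_pos bp_less_1 by (auto simp: q_def r_def s_def)
  have t: "0 < t" "t < 1" "q = t\<^sup>2" using pos by (auto simp: t_def)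
  have sub: "{1..n-1} \<subseteq> {1..n}" "n \<notin> {1..n-1}" "n \<in> {1..n}" using n by auto
  have inI: "X \<subseteq> {1..n}" "n \<notin> X" "card X = k" "finite X" if "X \<in> ?I" for X
    using that sub finite_subset[of X "{1..n-1}"] by blast+
  have x0: "0 \<le> x" using bp_pos[of b] bp_pos[of c] by (simp add: x_def)
  let ?A = "\<lambda>X E. (homog b E X \<and> joined c E n X) \<and> (\<forall>u\<in>{1..n-1} - X. \<not> joined d E u X)"
  define \<mu> where "\<mu> = q ^ (k choose 2) * r ^ k"
  define M where "M = real ((n - 1) choose k)"
  have \<mu>: "0 < \<mu>" using pos by (simp add: \<mu>_def)
  have M: "0 < M" using n by (simp add: M_def)
  have finI: "finite ?I" by (rule finite_subset[of _ "Pow {1..n-1}"]) auto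
  have cardI: "real (card ?I) = M" unfolding M_def by (subst n_subsets) auto
  have P1: "Pr n (?A X) = \<mu> * (1 - s ^ k) ^ (n - 1 - k)" if X: "X \<in> ?I" for X
  proof -
    have X': "X \<subseteq> {1..n}" "n \<in> {1..n}" "n \<notin> X" "finite X" using inI[OF X] sub(3) by blast+
    have "Pr n (?A X) = Pr n (\<lambda>E. homog b E X \<and> joined c E n X) *
        (\<Prod>u\<in>{1..n-1} - X. Pr n (\<lambda>E. \<not> joined d E u X))"
    proof (rule pr_inside_outside[where W = "insert n X"])
      show "insert n X \<inter> ({1..n-1} - X) = {}" using n by auto
      have "star n X \<subseteq> pairs (insert n X)" using X' by (intro star_subset_pairs) auto
      then show "depends_on (\<lambda>E. homog b E X \<and> joined c E n X) (pairs (insert n X))"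
        by (intro depends_on_conj depends_on_mono[OF depends_on_homog] depends_on_mono[OF depends_on_joined] pairs_mono) auto
      show "depends_on (\<lambda>E. \<not> joined d E u X) (star u (insert n X))" for u
        by (rule depends_on_mono[OF depends_on_not[OF depends_on_joined]]) (auto simp: star_def)
    qed auto
    also have "(\<Prod>u\<in>{1..n-1} - X. Pr n (\<lambda>E. \<not> joined d E u X)) = (\<Prod>u\<in>{1..n-1} - X. 1 - s ^ k)"
    proof (rule prod.cong[OF refl])
      fix u assume "u \<in> {1..n-1} - X"
      then have "u \<in> {1..n}" "u \<notin> X" by auto
      then show "Pr n (\<lambda>E. \<not> joined d E u X) = 1 - s ^ k" using pr_not_joined[of u n X d] X X' by (simp add: s_def)
    qed
    also have "\<dots> = (1 - s ^ k) ^ (n - 1 - k)" using X X' by (simp add: card_Diff_subset)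
    also have "Pr n (\<lambda>E. homog b E X \<and> joined c E n X) = \<mu>"
      using pr_homog_joined[OF X'(1-3), of b c] X by (simp add: \<mu>_def q_def r_def)
    finally show ?thesis .
  qed
  have P2: "Pr n (\<lambda>E. ?A X E \<and> ?A Y E) \<le> \<mu>\<^sup>2 / (q ^ (card (X \<inter> Y) choose 2) * r ^ card (X \<inter> Y))"
    if X: "X \<in> ?I" and Y: "Y \<in> ?I" for X Y
  proof -
    have X': "X \<subseteq> {1..n}" "Y \<subseteq> {1..n}" "n \<in> {1..n}" "n \<notin> X" "n \<notin> Y" "card X = k" "card Y = k"
      using inI[OF X] inI[OF Y] sub(3) by blast+
    have "Pr n (\<lambda>E. ?A X E \<and> ?A Y E) \<le>
        Pr n (\<lambda>E. (homog b E X \<and> joined c E n X) \<and> (homog b E Y \<and> joined c E n Y))"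
      by (rule pr_mono) auto
    then show ?thesis unfolding pr_two_homog_joined[OF X'] \<mu>_def q_def r_def .
  qed
  have bnd: "real (k choose l) ^ 2 / real ((n - 1) choose l) * (\<mu>\<^sup>2 / (q ^ (l choose 2) * r ^ l)) \<le> \<mu>\<^sup>2 * x ^ l"
    if l: "l \<le> k" for l
  proof -
    have a: "real (k choose l) \<le> real k ^ l"
      by (rule binomial_le_power_real)
    have b: "real (k choose l) / real ((n - 1) choose l) \<le> (real k / real (n - 1)) ^ l"
      using n l by (intro choose_ratio_le) auto
    \<comment> \<open>The crude estimate of \<open>l - 1\<close> by \<open>k\<close> makes the
      overlap bounds a geometric progression with ratio \<open>x\<close>.\<close>
    have "t ^ (k * l) \<le> t ^ (l * (l - 1))"
    proof (rule power_decreasing)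
      have "l * (l - 1) \<le> l * k" using l by (intro mult_le_mono2) auto
      then show "l * (l - 1) \<le> k * l" by (simp add: mult.commute)
    qed (use t in auto)
    then have c: "(t ^ k) ^ l \<le> q ^ (l choose 2)" unfolding t(3) choose_two_square by (simp add: power_mult)
    have "real (k choose l) ^ 2 / real ((n - 1) choose l) * (\<mu>\<^sup>2 / (q ^ (l choose 2) * r ^ l)) =
        \<mu>\<^sup>2 * (real (k choose l) * (real (k choose l) / real ((n - 1) choose l)) * (1 / (q ^ (l choose 2) * r ^ l)))"
      by (simp add: power2_eq_square)
    also have "\<dots> \<le> \<mu>\<^sup>2 * (real k ^ l * (real k / real (n - 1)) ^ l * (1 / ((t ^ k) ^ l * r ^ l)))"
      using a b c pos t
      by (intro mult_left_mono mult_mono divide_left_mono mult_right_mono mult_pos_pos) auto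
    also have "\<dots> = \<mu>\<^sup>2 * x ^ l"
      by (simp add: x_def q_def[symmetric] r_def[symmetric] t_def[symmetric] power_divide power_mult_distrib
          power2_eq_square power_mult[symmetric] mult.commute)
    finally show ?thesis .
  qed
  have "(\<Sum>X\<in>?I. \<Sum>Y\<in>?I. Pr n (\<lambda>E. ?A X E \<and> ?A Y E)) \<le> (\<Sum>X\<in>?I. M * (\<mu>\<^sup>2 / (1 - x)))"
  proof (rule sum_mono)
    fix X assume X: "X \<in> ?I"
    have "(\<Sum>Y\<in>?I. Pr n (\<lambda>E. ?A X E \<and> ?A Y E)) \<le>
        (\<Sum>Y\<in>?I. \<mu>\<^sup>2 / (q ^ (card (X \<inter> Y) choose 2) * r ^ card (X \<inter> Y)))"
      using X by (intro sum_mono P2) auto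
    also have "\<dots> \<le> real ((n - 1) choose k) * (\<Sum>l\<le>k. real (k choose l) ^ 2 / real ((n - 1) choose l) *
        (\<mu>\<^sup>2 / (q ^ (l choose 2) * r ^ l)))"
      using X pos by (intro sum_over_subsets_by_intersection) auto
    also have "\<dots> \<le> M * (\<Sum>l\<le>k. \<mu>\<^sup>2 * x ^ l)"
      unfolding M_def by (intro mult_left_mono sum_mono bnd) auto
    also have "\<dots> \<le> M * (\<mu>\<^sup>2 * (1 / (1 - x)))"
      unfolding sum_distrib_left[symmetric] using M x x0
      by (intro mult_left_mono sum_power_le_geometric) auto
    finally show "(\<Sum>Y\<in>?I. Pr n (\<lambda>E. ?A X E \<and> ?A Y E)) \<le> M * (\<mu>\<^sup>2 / (1 - x))" by simp
  qed
  also have "\<dots> = M\<^sup>2 * \<mu>\<^sup>2 / (1 - x)" using cardI by (simp add: power2_eq_square)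
  finally have second: "(\<Sum>X\<in>?I. \<Sum>Y\<in>?I. Pr n (\<lambda>E. ?A X E \<and> ?A Y E)) \<le> M\<^sup>2 * \<mu>\<^sup>2 / (1 - x)" .
  have first: "(\<Sum>X\<in>?I. Pr n (?A X)) = M * (\<mu> * (1 - s ^ k) ^ (n - 1 - k))"
    using P1 cardI by simp
  let ?P = "Pr n (\<lambda>E. \<exists>X\<in>?I. ?A X E)"
  have "(M * (\<mu> * (1 - s ^ k) ^ (n - 1 - k)))\<^sup>2 \<le> ?P * (\<Sum>X\<in>?I. \<Sum>Y\<in>?I. Pr n (\<lambda>E. ?A X E \<and> ?A Y E))"
    unfolding first[symmetric] by (rule second_moment) (auto simp: finI)
  also have "\<dots> \<le> ?P * (M\<^sup>2 * \<mu>\<^sup>2 / (1 - x))"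
    by (intro mult_left_mono second pr_nonneg)
  finally have "M\<^sup>2 * \<mu>\<^sup>2 * ((1 - s ^ k) ^ (n - 1 - k))\<^sup>2 \<le> M\<^sup>2 * \<mu>\<^sup>2 * (?P / (1 - x))"
    by (simp add: power_mult_distrib mult.commute mult.assoc mult.left_commute)
  then have "((1 - s ^ k) ^ (n - 1 - k))\<^sup>2 \<le> ?P / (1 - x)"
    using M \<mu> by (subst (asm) mult_le_cancel_left_pos) auto
  then have main: "((1 - s ^ k) ^ (n - 1 - k))\<^sup>2 * (1 - x) \<le> ?P"
    using x by (simp add: field_simps)
  have "1 + real ((n - 1 - k) * 2) * (- (s ^ k)) \<le> (1 + - (s ^ k)) ^ ((n - 1 - k) * 2)"
    by (rule Bernoulli_inequality) (use pos in \<open>simp add: power_le_one\<close>)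
  then have "1 - real ((n - 1 - k) * 2) * s ^ k \<le> ((1 - s ^ k) ^ (n - 1 - k))\<^sup>2"
    by (simp add: power_mult)
  moreover have "real ((n - 1 - k) * 2) * s ^ k \<le> 2 * real n * s ^ k"
    using pos by (intro mult_right_mono) auto
  ultimately have "1 - 2 * real n * s ^ k \<le> ((1 - s ^ k) ^ (n - 1 - k))\<^sup>2" by linarith
  then have "(1 - 2 * real n * s ^ k) * (1 - x) \<le> ((1 - s ^ k) ^ (n - 1 - k))\<^sup>2 * (1 - x)"
    using x by (intro mult_right_mono) auto
  then show ?thesis using main unfolding s_def by linarith
qed

lemma homog_dominating_upper_bound:
  "Pr n (\<lambda>E. \<exists>X. X \<subseteq> {1..n} \<and> X \<noteq> {} \<and> homog b E X \<and> (\<forall>u\<in>{1..n} - X. \<not> joined c E u X)) \<le>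
    (\<Sum>k=1..n. real (n choose k) * bp p b ^ (k choose 2) * (1 - bp p c ^ k) ^ (n - k))"
proof -
  let ?I = "\<lambda>k. {X. X \<subseteq> {1..n} \<and> card X = k}"
  let ?A = "\<lambda>X E. homog b E X \<and> (\<forall>u\<in>{1..n} - X. \<not> joined c E u X)"
  have finI: "finite (?I k)" for k by (rule finite_subset[of _ "Pow {1..n}"]) auto
  have P1: "Pr n (?A X) = bp p b ^ (k choose 2) * (1 - bp p c ^ k) ^ (n - k)" if X: "X \<in> ?I k" for X k
  proof -
    have X': "X \<subseteq> {1..n}" "finite X" using X finite_subset[of X "{1..n}"] by auto
    have "Pr n (?A X) = Pr n (\<lambda>E. homog b E X) * (\<Prod>u\<in>{1..n} - X. Pr n (\<lambda>E. \<not> joined c E u X))"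
      by (rule pr_inside_outside[OF _ _ _ depends_on_homog depends_on_not[OF depends_on_joined]]) auto
    also have "(\<Prod>u\<in>{1..n} - X. Pr n (\<lambda>E. \<not> joined c E u X)) = (\<Prod>u\<in>{1..n} - X. 1 - bp p c ^ k)"
    proof (rule prod.cong[OF refl])
      fix u assume "u \<in> {1..n} - X"
      then show "Pr n (\<lambda>E. \<not> joined c E u X) = 1 - bp p c ^ k" using pr_not_joined[of u n X c] X by simp
    qed
    also have "\<dots> = (1 - bp p c ^ k) ^ (n - k)" using X X' by (simp add: card_Diff_subset)
    finally show ?thesis using pr_homog[OF X'(1), of b] X by simp
  qed
  have "Pr n (\<lambda>E. \<exists>X. X \<subseteq> {1..n} \<and> X \<noteq> {} \<and> homog b E X \<and> (\<forall>u\<in>{1..n} - X. \<not> joined c E u X)) \<le>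
      Pr n (\<lambda>E. \<exists>k\<in>{1..n}. \<exists>X\<in>?I k. ?A X E)"
  proof (rule pr_mono)
    fix E
    assume "\<exists>X. X \<subseteq> {1..n} \<and> X \<noteq> {} \<and> homog b E X \<and> (\<forall>u\<in>{1..n} - X. \<not> joined c E u X)"
    then obtain X where X: "X \<subseteq> {1..n}" "X \<noteq> {}" "?A X E" by blast
    have "finite X" using X(1) finite_subset by blast
    then have "card X \<in> {1..n}" using X card_mono[of "{1..n}" X] by (auto simp: Suc_le_eq card_gt_0_iff)
    then show "\<exists>k\<in>{1..n}. \<exists>X\<in>?I k. ?A X E" using X by blast
  qed simp
  also have "\<dots> \<le> (\<Sum>k=1..n. Pr n (\<lambda>E. \<exists>X\<in>?I k. ?A X E))" by (rule pr_Bex_le) auto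
  also have "\<dots> \<le> (\<Sum>k=1..n. \<Sum>X\<in>?I k. Pr n (?A X))" by (intro sum_mono pr_Bex_le finI) simp
  also have "\<dots> = (\<Sum>k=1..n. real (n choose k) * bp p b ^ (k choose 2) * (1 - bp p c ^ k) ^ (n - k))"
  proof (rule sum.cong[OF refl])
    fix k
    have "card (?I k) = n choose k" by (subst n_subsets) auto
    then show "(\<Sum>X\<in>?I k. Pr n (?A X)) = real (n choose k) * bp p b ^ (k choose 2) * (1 - bp p c ^ k) ^ (n - k)"
      using P1 by simp
  qed
  finally show ?thesis .
qed

text \<open>Union bound: 160 is 5 * 16 * 2, for at most \<open>5 * n ^ 4\<close> sets
  \<open>F\<close>, at most 16 subsets of each, and the two halves. For each choice at least
  \<open>n div 2 - 4\<close> vertices of the half fail independently to be a witness, each with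
  probability at most \<open>1 - \<delta> ^ 4\<close>.\<close>

lemma extension_failure_bound:
  fixes n :: nat
  defines "\<delta> \<equiv> min p (1 - p)"
  assumes n: "1 \<le> n"
  shows "Pr n (\<lambda>E. \<not> extension E {1..n} {1..n div 2}) \<le> 160 * real n ^ 4 * (1 - \<delta> ^ 4) ^ (n div 2 - 4)"
proof -
  let ?V = "{1..n}" and ?H = "{1..n div 2}"
  have \<delta>: "0 < \<delta>" "\<delta> < 1" using p0 p1 by (auto simp: \<delta>_def)
  have \<delta>4: "0 < \<delta> ^ 4" "\<delta> ^ 4 < 1" using \<delta> by (simp_all add: power_less_one_iff)
  let ?FF = "{F. F \<subseteq> ?V \<and> card F \<le> 4}"
  let ?J = "(SIGMA F:?FF. Pow F) \<times> {?H, ?V - ?H}"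
  let ?bad = "\<lambda>F A U E. \<forall>y\<in>U - F. \<not> (\<forall>f\<in>F. adj E y f = (f \<in> A))"
  have finF: "finite F" if "F \<in> ?FF" for F
    using that finite_subset[of F ?V] by blast
  have finFF: "finite ?FF" by (rule finite_subset[of _ "Pow ?V"]) auto
  have cardFF: "real (card ?FF) \<le> 5 * real n ^ 4"
  proof -
    have "?FF = (\<Union>i\<in>{..4}. {F. F \<subseteq> ?V \<and> card F = i})" by auto
    then have "card ?FF \<le> (\<Sum>i\<in>{..4}. card {F. F \<subseteq> ?V \<and> card F = i})" by (simp add: card_UN_le)
    also have "\<dots> = (\<Sum>i\<in>{..4}. n choose i)" by (subst n_subsets) auto
    also have "\<dots> \<le> (\<Sum>i\<in>{..4::nat}. n ^ 4)"
    proof (rule sum_mono)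
      fix i :: nat assume "i \<in> {..4}"
      then have "n ^ i \<le> n ^ 4" using n by (intro power_increasing) auto
      then show "n choose i \<le> n ^ 4" using binomial_le_power[of n i] by simp
    qed
    finally have "card ?FF \<le> 5 * n ^ 4" by simp
    then have "real (card ?FF) \<le> real (5 * n ^ 4)" by (simp only: of_nat_le_iff)
    then show ?thesis by simp
  qed
  have P1: "Pr n (?bad F A U) \<le> (1 - \<delta> ^ 4) ^ (n div 2 - 4)"
    if F: "F \<subseteq> ?V" "card F \<le> 4" and U: "U \<in> {?H, ?V - ?H}" for F A U
  proof -
    have finF: "finite F" by (rule finite_subset[OF F(1)]) simp
    have UV: "U \<subseteq> ?V" using U by auto
    have hit: "\<delta> ^ 4 \<le> Pr n (\<lambda>E. \<forall>f\<in>F. adj E y f = (f \<in> A))" if y: "y \<in> U - F" for y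
    proof -
      have "Pr n (\<lambda>E. \<forall>f\<in>F. adj E y f = (f \<in> A)) = (\<Prod>f\<in>F. Pr n (\<lambda>E. adj E y f = (f \<in> A)))"
      proof (rule pr_Ball[where D = "\<lambda>f. {{y, f}}"])
        show "depends_on (\<lambda>E. adj E y f = (f \<in> A)) {{y, f}}" for f
          by (simp add: depends_on_def adj_def)
      qed (use finF in \<open>auto simp: doubleton_eq_iff\<close>)
      also have "\<dots> = (\<Prod>f\<in>F. bp p (f \<in> A))"
      proof (rule prod.cong[OF refl])
        fix f assume "f \<in> F"
        then have "{y, f} \<in> pairs ?V" using y F UV by (auto simp: pairs_def card_2_iff)
        then show "Pr n (\<lambda>E. adj E y f = (f \<in> A)) = bp p (f \<in> A)"
          unfolding adj_def using pr_single[of "pairs ?V" "{y, f}" "f \<in> A"] by simp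
      qed
      also have "\<dots> \<ge> (\<Prod>f\<in>F. \<delta>)" using \<delta> by (intro prod_mono) (auto simp: \<delta>_def bp_def)
      moreover have "\<delta> ^ 4 \<le> \<delta> ^ card F" using F \<delta> by (intro power_decreasing) auto
      ultimately show ?thesis by simp
    qed
    have dep: "depends_on (\<lambda>E. \<not> (\<forall>f\<in>F. adj E y f = (f \<in> A))) (star y F)" for y
      by (simp add: depends_on_def adj_def star_def)
    have "Pr n (?bad F A U) = Pr n (\<lambda>E. True \<and> ?bad F A U E)" by simp
    also have "\<dots> = Pr n (\<lambda>_. True) * (\<Prod>y\<in>U - F. Pr n (\<lambda>E. \<not> (\<forall>f\<in>F. adj E y f = (f \<in> A))))"
      by (rule pr_inside_outside[where W = F]) (use UV dep finite_subset[of U ?V] in \<open>auto simp: depends_on_def\<close>)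
    also have "\<dots> \<le> 1 * (\<Prod>y\<in>U - F. 1 - \<delta> ^ 4)"
    proof (intro mult_mono prod_mono)
      fix y assume "y \<in> U - F"
      then show "0 \<le> Pr n (\<lambda>E. \<not> (\<forall>f\<in>F. adj E y f = (f \<in> A))) \<and>
          Pr n (\<lambda>E. \<not> (\<forall>f\<in>F. adj E y f = (f \<in> A))) \<le> 1 - \<delta> ^ 4"
        using hit[of y] pr_not[of "pairs ?V" "\<lambda>E. \<forall>f\<in>F. adj E y f = (f \<in> A)"] pr_nonneg
          pr_le_1[of "pairs ?V" "\<lambda>E. \<forall>f\<in>F. adj E y f = (f \<in> A)"] by simp
    qed (auto simp: pr_le_1 prod_nonneg pr_nonneg)
    also have "\<dots> = (1 - \<delta> ^ 4) ^ card (U - F)" by simp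
    also have "\<dots> \<le> (1 - \<delta> ^ 4) ^ (n div 2 - 4)"
    proof (rule power_decreasing)
      have "card U \<ge> n div 2" using U by (auto simp: card_Diff_subset)
      then show "n div 2 - 4 \<le> card (U - F)" using F diff_card_le_card_Diff[OF finF, of U] by linarith
    qed (use \<delta>4 in auto)
    finally show ?thesis .
  qed
  have finJ: "finite ?J"
    using finFF finF by (intro finite_cartesian_product finite_SigmaI) blast+
  have "Pr n (\<lambda>E. \<not> extension E ?V ?H) \<le> Pr n (\<lambda>E. \<exists>j\<in>?J. ?bad (fst (fst j)) (snd (fst j)) (snd j) E)"
  proof (rule pr_mono)
    fix E assume not_ext: "\<not> extension E ?V ?H"
    show "\<exists>j\<in>?J. ?bad (fst (fst j)) (snd (fst j)) (snd j) E"
    proof (rule ccontr)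
      assume none: "\<not> ?thesis"
      have "extension E ?V ?H" unfolding extension_def
      proof (intro allI ballI impI, rule ccontr)
        fix F A U
        assume FU: "U \<in> {?H, ?V - ?H}" "F \<subseteq> ?V" "card F \<le> 4"
          and no: "\<not> (\<exists>y\<in>U - F. \<forall>f\<in>F. adj E y f = (f \<in> A))"
        \<comment> \<open>Only the part of \<open>A\<close> inside \<open>F\<close> matters, which
          leaves finitely many choices for the union bound.\<close>
        have "?bad F (A \<inter> F) U E" using no by simp
        moreover have "((F, A \<inter> F), U) \<in> ?J" using FU by simp
        ultimately have "\<exists>j\<in>?J. ?bad (fst (fst j)) (snd (fst j)) (snd j) E"
          by (intro bexI[of _ "((F, A \<inter> F), U)"]) simp_all
        then show False using none by (rule notE[rotated])
      qed
      then show False using not_ext by (rule notE[rotated])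
    qed
  qed simp
  also have "\<dots> \<le> (\<Sum>j\<in>?J. Pr n (?bad (fst (fst j)) (snd (fst j)) (snd j)))"
    by (rule pr_Bex_le) (use finJ in auto)
  also have "\<dots> \<le> (\<Sum>j\<in>?J. (1 - \<delta> ^ 4) ^ (n div 2 - 4))"
    by (rule sum_mono) (rule P1, auto)
  also have "\<dots> = real (card ?J) * (1 - \<delta> ^ 4) ^ (n div 2 - 4)" by simp
  also have "\<dots> \<le> (160 * real n ^ 4) * (1 - \<delta> ^ 4) ^ (n div 2 - 4)"
  proof (rule mult_right_mono)
    have "card (SIGMA F:?FF. Pow F) = (\<Sum>F\<in>?FF. card (Pow F))"
      using finFF finF by (intro card_SigmaI) blast+
    also have "\<dots> \<le> (\<Sum>F\<in>?FF. 16)"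
    proof (rule sum_mono)
      fix F assume F: "F \<in> ?FF"
      then have "finite F" by (rule finF)
      moreover have "(2::nat) ^ card F \<le> 2 ^ 4" using F by (intro power_increasing) auto
      ultimately show "card (Pow F) \<le> 16" by (simp add: card_Pow)
    qed
    finally have "card (SIGMA F:?FF. Pow F) \<le> 16 * card ?FF" by simp
    moreover have "card {?H, ?V - ?H} \<le> 2" by (simp add: card_insert_if)
    ultimately have "card ?J \<le> (16 * card ?FF) * 2" unfolding card_cartesian_product by (rule mult_le_mono)
    then have "real (card ?J) \<le> 32 * real (card ?FF)" by linarith
    then show "real (card ?J) \<le> 160 * real n ^ 4" using cardFF by linarith
  qed (use \<delta>4 in auto)
  finally show ?thesis .
qed

end

subsection \<open>Limits away from the golden ratio\<close>

text \<open>Taking \<open>j\<close>-th roots reduces this to the sequence \<open>n * h ^ n\<close>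
  with \<open>h ^ j = a\<close>.\<close>

lemma poly_times_power_tendsto_0:
  fixes a :: real
  assumes "0 \<le> a" "a < 1"
  shows "(\<lambda>n. real n ^ j * a ^ n) \<longlonglongrightarrow> 0"
proof (cases "j = 0")
  case True
  then show ?thesis using assms by (simp add: LIMSEQ_power_zero)
next
  case False
  define h where "h = root j a"
  have h: "0 \<le> h" "h < 1" "h ^ j = a"
    using assms False real_root_less_iff[of j a 1] by (auto simp: h_def real_root_pow_pos2)
  have "(\<lambda>n. real n * h ^ n) \<longlonglongrightarrow> 0" using h by (intro powser_times_n_limit_0) auto
  then have "(\<lambda>n. (real n * h ^ n) ^ j) \<longlonglongrightarrow> 0 ^ j" by (rule tendsto_power)
  moreover have "(real n * h ^ n) ^ j = real n ^ j * a ^ n" for n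
    by (simp add: power_mult_distrib h(3)[symmetric] power_mult[symmetric] mult.commute)
  ultimately show ?thesis using False by (simp add: zero_power)
qed

text \<open>The discrete logarithm to base \<open>1 / w\<close>; all asymptotics are expressed through it.\<close>
definition level :: "real \<Rightarrow> nat \<Rightarrow> nat" where
  "level w n = (LEAST k. real n * w ^ k \<le> 1)"

lemma level_properties:
  assumes w: "0 < w" "w < 1"
  shows level_le: "real n * w ^ level w n \<le> 1"
    and level_gt: "1 < n \<Longrightarrow> w < real n * w ^ level w n"
    and level_leI: "real n * w ^ k \<le> 1 \<Longrightarrow> level w n \<le> k"
    and level_at_top: "filterlim (level w) at_top sequentially"
    and level_le_half: "\<forall>\<^sub>F n in sequentially. level w n \<le> n div 2"
proof -
  have ex: "\<exists>k. real n * w ^ k \<le> 1" for n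
  proof -
    have "(\<lambda>k. real n * w ^ k) \<longlonglongrightarrow> real n * 0" using w by (intro tendsto_intros) auto
    then have "\<forall>\<^sub>F k in sequentially. real n * w ^ k < 1" by (rule order_tendstoD) simp
    then obtain N where "\<forall>k\<ge>N. real n * w ^ k < 1" unfolding eventually_sequentially by (rule exE)
    then show ?thesis by (intro exI[of _ N]) (simp add: less_imp_le)
  qed
  show le: "real n * w ^ level w n \<le> 1" for n unfolding level_def using ex by (rule LeastI_ex)
  show leI: "real n * w ^ k \<le> 1 \<Longrightarrow> level w n \<le> k" for n k unfolding level_def by (rule Least_le)
  show "w < real n * w ^ level w n" if "1 < n"
  proof (cases "level w n")
    case 0
    then show ?thesis using le[of n] that by simp
  next
    case (Suc j)
    then have "\<not> real n * w ^ j \<le> 1" using leI[of n j] by auto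
    then have "w * 1 < w * (real n * w ^ j)" using w by (intro mult_strict_left_mono) auto
    then show ?thesis using Suc by (simp add: mult.left_commute)
  qed
  show "filterlim (level w) at_top sequentially"
    unfolding filterlim_at_top
  proof
    fix K :: nat
    obtain N :: nat where N: "(1 / w) ^ K < real N" using reals_Archimedean2 by blast
    show "\<forall>\<^sub>F n in sequentially. K \<le> level w n" unfolding eventually_sequentially
    proof (intro exI allI impI)
      fix n assume n: "N \<le> n"
      show "K \<le> level w n"
      proof (rule ccontr)
        assume "\<not> K \<le> level w n"
        then have "w ^ K \<le> w ^ level w n" using w by (intro power_decreasing) auto
        then have "real n * w ^ K \<le> real n * w ^ level w n" by (intro mult_left_mono) auto
        then have "real n * w ^ K \<le> 1" using le[of n] by linarith
        then have "real n \<le> (1 / w) ^ K" using w by (simp add: field_simps power_divide)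
        then show False using N n by linarith
      qed
    qed
  qed
  have "(\<lambda>n. real n * sqrt w ^ n / w) \<longlonglongrightarrow> 0 / w"
    using poly_times_power_tendsto_0[of "sqrt w" 1] w by (intro tendsto_divide) auto
  then have "\<forall>\<^sub>F n in sequentially. real n * sqrt w ^ n / w < 1" by (rule order_tendstoD) simp
  then show "\<forall>\<^sub>F n in sequentially. level w n \<le> n div 2"
  proof eventually_elim
    case (elim n)
    have "w ^ (n div 2) * w = sqrt w ^ (2 * (n div 2) + 2)"
      using w by (simp add: power_mult power_add)
    also have "\<dots> \<le> sqrt w ^ n" using w by (intro power_decreasing) auto
    finally have "w ^ (n div 2) \<le> sqrt w ^ n / w" using w by (simp add: field_simps)
    then have "real n * w ^ (n div 2) \<le> real n * (sqrt w ^ n / w)" by (intro mult_left_mono) auto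
    then show ?case using elim by (intro leI) simp
  qed
qed

context edge_probability
begin

text \<open>Take \<open>w\<close> strictly between \<open>s\<close> and \<open>t\<close>, and sets
  of size \<open>k = level w n\<close>, so that \<open>n * w ^ k\<close> lies in
  \<open>(w, 1]\<close>. Then \<open>n * s ^ k\<close> is at most \<open>(s / w) ^ k\<close>, and
  the overlap ratio \<open>x\<close> is at most a constant times \<open>k ^ 2 * (w / t) ^ k\<close>;
  both tend to 0. The cases \<open>d = b\<close> and \<open>d = (\<not> b)\<close> give the two
  existence properties of \<open>typical_graph\<close>.\<close>

lemma homog_with_apex_whp:
  assumes st: "bp p d < sqrt (bp p b)"
  shows "(\<lambda>n. Pr n (\<lambda>E. \<exists>X\<subseteq>{1..n}. 2 \<le> card X \<and> homog b E X \<and>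
    (\<exists>w\<in>{1..n} - X. joined (\<not> d) E w X) \<and> (\<forall>u\<in>{1..n} - X. \<not> joined d E u X))) \<longlonglongrightarrow> 1"
    (is "(\<lambda>n. Pr n (?Q n)) \<longlonglongrightarrow> 1")
proof -
  define r s t where "r = bp p (\<not> d)" and "s = bp p d" and "t = sqrt (bp p b)"
  define w where "w = (s + t) / 2"
  have pos: "0 < r" "0 < s" "0 < t" "t < 1" using bp_pos bp_less_1 by (auto simp: r_def s_def t_def)
  have w: "0 < w" "w < 1" "s < w" "w < t" using pos st[folded s_def t_def] by (auto simp: w_def)
  let ?k = "level w"
  define g where "g k = 2 / (r * w) * (real k ^ 2 * (w / t) ^ k)" for k
  have "g \<longlonglongrightarrow> 2 / (r * w) * 0"
    unfolding g_def using w pos by (intro tendsto_mult tendsto_const poly_times_power_tendsto_0) auto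
  then have "(\<lambda>n. g (?k n)) \<longlonglongrightarrow> 0" using filterlim_compose[OF _ level_at_top[OF w(1,2)]] by auto
  note g = this
  have "(\<lambda>k. (s / w) ^ k) \<longlonglongrightarrow> 0" using w pos by (intro LIMSEQ_power_zero) auto
  then have "(\<lambda>n. (s / w) ^ ?k n) \<longlonglongrightarrow> 0" using filterlim_compose[OF _ level_at_top[OF w(1,2)]] by auto
  note sw = this
  have ev_s: "\<forall>\<^sub>F n in sequentially. (s / w) ^ ?k n < 1 / 2" using sw by (rule order_tendstoD) simp
  from sw have lim: "(\<lambda>n. (1 - 2 * (s / w) ^ ?k n) * (1 - g (?k n))) \<longlonglongrightarrow> (1 - 2 * 0) * (1 - 0)"
    by (intro tendsto_intros g)
  have ev_g: "\<forall>\<^sub>F n in sequentially. g (?k n) < 1" using g by (rule order_tendstoD) simp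
  have ev_k: "\<forall>\<^sub>F n in sequentially. 2 \<le> ?k n" using level_at_top[OF w(1,2)] by (simp add: filterlim_at_top)
  have low: "\<forall>\<^sub>F n in sequentially. (1 - 2 * (s / w) ^ ?k n) * (1 - g (?k n)) \<le> Pr n (?Q n)"
    using ev_g ev_k ev_s level_le_half[OF w(1,2)] eventually_ge_at_top[of 2]
  proof eventually_elim
    case (elim n)
    define k where "k = ?k n"
    have kn: "k < n" using elim by (simp add: k_def)
    define x where "x = real k ^ 2 / (real (n - 1) * r * t ^ k)"
    have nw: "w < real n * w ^ k" "real n * w ^ k \<le> 1"
      using level_gt[OF w(1,2), of n] level_le[OF w(1,2), of n] elim by (auto simp: k_def)
    have "x \<le> g k"
    proof -
      have "w < 2 * real (n - 1) * w ^ k"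
      proof -
        have "real n * w ^ k \<le> 2 * real (n - 1) * w ^ k" using elim w by (intro mult_right_mono) auto
        then show ?thesis using nw by linarith
      qed
      then have "1 / real (n - 1) \<le> 2 / w * w ^ k" using w elim by (simp add: field_simps)
      then have "real k ^ 2 / (r * t ^ k) * (1 / real (n - 1)) \<le> real k ^ 2 / (r * t ^ k) * (2 / w * w ^ k)"
        using pos by (intro mult_left_mono) auto
      then show ?thesis by (simp add: x_def g_def power_divide mult_ac)
    qed
    then have x: "x < 1" using elim by (simp add: k_def)
    have ns: "real n * s ^ k \<le> (s / w) ^ k"
    proof -
      have "real n * s ^ k = (real n * w ^ k) * (s / w) ^ k" using w by (simp add: power_divide)
      also have "\<dots> \<le> 1 * (s / w) ^ k" using nw w pos by (intro mult_right_mono) auto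
      finally show ?thesis by simp
    qed
    have "(1 - 2 * (s / w) ^ k) * (1 - g k) \<le> (1 - 2 * real n * s ^ k) * (1 - x)"
      using ns \<open>x \<le> g k\<close> elim by (intro mult_mono) (auto simp: k_def)
    also have "\<dots> \<le> Pr n (\<lambda>E. \<exists>X\<in>{X. X \<subseteq> {1..n-1} \<and> card X = k}.
        (homog b E X \<and> joined (\<not> d) E n X) \<and> (\<forall>u\<in>{1..n-1} - X. \<not> joined d E u X))"
      using homog_with_apex_lower_bound[of n k "\<not> d" b d] elim kn x
      unfolding x_def r_def s_def t_def by simp
    also have "\<dots> \<le> Pr n (?Q n)"
    proof (rule pr_mono)
      fix E
      assume "\<exists>X\<in>{X. X \<subseteq> {1..n-1} \<and> card X = k}.
        (homog b E X \<and> joined (\<not> d) E n X) \<and> (\<forall>u\<in>{1..n-1} - X. \<not> joined d E u X)"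
      then obtain X where X: "X \<subseteq> {1..n-1}" "card X = k" "homog b E X" "joined (\<not> d) E n X"
        "\<forall>u\<in>{1..n-1} - X. \<not> joined d E u X" by blast
      have sub: "{1..n-1} \<subseteq> {1..n}" "n \<notin> {1..n-1}" "n \<in> {1..n}" "{1..n} - {1..n-1} \<subseteq> {n}" using elim by auto
      have "X \<noteq> {}" using X(2) elim by (auto simp: k_def)
      then have nd: "\<not> joined d E n X" using X(4) by (auto simp: joined_def)
      have "\<forall>u\<in>{1..n} - X. \<not> joined d E u X"
      proof
        fix u assume "u \<in> {1..n} - X"
        then have "u = n \<or> u \<in> {1..n-1} - X" using sub(4) by blast
        then show "\<not> joined d E u X" using nd X(5) by (elim disjE) simp_all
      qed
      moreover have "X \<subseteq> {1..n}" "n \<in> {1..n} - X" using X(1) sub by blast+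
      moreover have "2 \<le> card X" using X(2) elim by (simp add: k_def)
      ultimately show "?Q n E" using X(3,4) by (intro exI[of _ X] conjI bexI[of _ n])
    qed simp
    finally show ?case by (simp add: k_def)
  qed
  have up: "\<forall>\<^sub>F n in sequentially. Pr n (?Q n) \<le> 1" by (simp add: pr_le_1)
  show ?thesis by (rule tendsto_sandwich[OF low up]) (use lim in simp_all)
qed

text \<open>With \<open>w\<close> strictly between \<open>t\<close> and \<open>s\<close>, the union
  bound is split at \<open>K = level w n\<close>. For sizes up to \<open>K\<close> there are at most
  \<open>exp (L * K ^ 2)\<close> sets, while the absence of a \<open>c\<close>-joined vertex has
  probability at most \<open>exp (- (w / 2 * \<rho> ^ K))\<close>. For sizes above \<open>K\<close>
  homogeneity alone is unlikely: \<open>n * t ^ (k - 1)\<close> is at most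
  \<open>\<theta> ^ K\<close>, which leaves a geometric series.\<close>

lemma no_homog_dominating_whp:
  assumes ts: "sqrt (bp p b) < bp p c"
  shows "(\<lambda>n. Pr n (\<lambda>E. \<exists>X. X \<subseteq> {1..n} \<and> X \<noteq> {} \<and> homog b E X \<and>
    (\<forall>u\<in>{1..n} - X. \<not> joined c E u X))) \<longlonglongrightarrow> 0"
    (is "(\<lambda>n. Pr n (?Q n)) \<longlonglongrightarrow> 0")
proof -
  define s t where "s = bp p c" and "t = sqrt (bp p b)"
  define w where "w = (s + t) / 2"
  have pos: "0 < s" "s < 1" "0 < t" "t < 1" using bp_pos bp_less_1 by (auto simp: s_def t_def)
  have t2: "bp p b = t\<^sup>2" using bp_pos[of b] by (simp add: t_def)
  have w: "0 < w" "w < 1" "t < w" "w < s" using pos ts[folded s_def t_def] by (auto simp: w_def)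
  let ?k = "level w"
  define \<rho> \<theta> L where "\<rho> = s / w" and "\<theta> = t / w" and "L = ln (1 / w)"
  have \<rho>: "1 < \<rho>" "0 < \<theta>" "\<theta> < 1" "0 < L" using w pos by (auto simp: \<rho>_def \<theta>_def L_def)
  define g where "g k = 4 / w * (real k * (1 / \<rho>) ^ k) + 2 * \<theta> ^ k" for k
  have "g \<longlonglongrightarrow> 4 / w * 0 + 2 * 0"
    unfolding g_def using \<rho> poly_times_power_tendsto_0[of "1 / \<rho>" 1]
    by (intro tendsto_add tendsto_mult tendsto_const LIMSEQ_power_zero) auto
  then have glim: "(\<lambda>n. g (?k n)) \<longlonglongrightarrow> 0" using filterlim_compose[OF _ level_at_top[OF w(1,2)]] by auto
  have "(\<lambda>k. L * (real k ^ 2 * (1 / \<rho>) ^ k)) \<longlonglongrightarrow> L * 0"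
    using \<rho> by (intro tendsto_mult tendsto_const poly_times_power_tendsto_0) auto
  then have "\<forall>\<^sub>F k in sequentially. L * (real k ^ 2 * (1 / \<rho>) ^ k) < w / 4"
    using w by (intro order_tendstoD) auto
  then have "\<forall>\<^sub>F n in sequentially. L * (real (?k n) ^ 2 * (1 / \<rho>) ^ ?k n) < w / 4"
    by (rule eventually_compose_filterlim[OF _ level_at_top[OF w(1,2)]])
  then have ev1: "\<forall>\<^sub>F n in sequentially. L * real (?k n) ^ 2 < w / 4 * \<rho> ^ ?k n"
    using \<rho> by (simp add: power_divide field_simps)
  have "(\<lambda>n. \<theta> ^ ?k n) \<longlonglongrightarrow> 0"
    using filterlim_compose[OF _ level_at_top[OF w(1,2)], of "\<lambda>k. \<theta> ^ k"] \<rho> LIMSEQ_power_zero[of \<theta>] by auto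
  then have ev2: "\<forall>\<^sub>F n in sequentially. \<theta> ^ ?k n < 1 / 2" by (rule order_tendstoD) simp
  have up: "\<forall>\<^sub>F n in sequentially. Pr n (?Q n) \<le> g (?k n)"
    using ev1 ev2 level_le_half[OF w(1,2)] eventually_ge_at_top[of 2]
  proof eventually_elim
    case (elim n)
    define K where "K = ?k n"
    have nw: "w < real n * w ^ K" "real n * w ^ K \<le> 1"
      using level_gt[OF w(1,2), of n] level_le[OF w(1,2), of n] elim by (auto simp: K_def)
    have Kn: "2 * K \<le> n" using elim by (simp add: K_def)
    define y where "y = \<theta> ^ K"
    have y: "0 < y" "y < 1 / 2" using elim \<rho> by (auto simp: y_def K_def)
    define D where "D = 4 / w * (1 / \<rho>) ^ K"
    let ?T = "\<lambda>k. real (n choose k) * bp p b ^ (k choose 2) * (1 - s ^ k) ^ (n - k)"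
    have small: "?T k \<le> D" if k: "k \<in> {1..K}" for k
    proof -
      have skK: "s ^ K \<le> s ^ k" using k pos by (intro power_decreasing) auto
      have "real n \<le> (1 / w) ^ K" using nw w by (simp add: field_simps power_divide)
      also have "\<dots> = exp (real K * L)" using w by (simp add: L_def exp_of_nat_mult)
      finally have "real n ^ K \<le> exp (real K * L) ^ K" by (intro power_mono) auto
      then have nK: "real n ^ K \<le> exp (L * real K ^ 2)"
        by (simp add: exp_of_nat_mult[symmetric] power2_eq_square mult_ac)
      have "real (n choose k) \<le> real n ^ k" by (rule binomial_le_power_real)
      also have "\<dots> \<le> real n ^ K" using k elim by (intro power_increasing) auto
      finally have c1: "real (n choose k) \<le> exp (L * real K ^ 2)" using nK by linarith
      have c2: "bp p b ^ (k choose 2) \<le> 1" using bp_pos[of b] bp_less_1[of b] by (intro power_le_one) auto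
      have "w / 2 * \<rho> ^ K \<le> real (n - k) * s ^ k"
      proof -
        have "w * \<rho> ^ K \<le> (real n * w ^ K) * \<rho> ^ K" using nw \<rho> by (intro mult_right_mono) auto
        also have "\<dots> = real n * s ^ K" using w by (simp add: \<rho>_def power_divide)
        also have "\<dots> \<le> (2 * real (n - k)) * s ^ k"
        proof (intro mult_mono skK)
          show "real n \<le> 2 * real (n - k)" using k Kn by auto
        qed (use pos in auto)
        finally show ?thesis by simp
      qed
      then have "(1 - s ^ k) ^ (n - k) \<le> exp (- (w / 2 * \<rho> ^ K))"
      proof -
        have "1 - s ^ k \<le> exp (- (s ^ k))" using exp_ge_add_one_self[of "- (s ^ k)"] by simp
        then have "(1 - s ^ k) ^ (n - k) \<le> exp (- (s ^ k)) ^ (n - k)"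
          using pos by (intro power_mono) (auto simp: power_le_one)
        also have "\<dots> = exp (- (real (n - k) * s ^ k))" by (simp add: exp_of_nat_mult[symmetric])
        also have "\<dots> \<le> exp (- (w / 2 * \<rho> ^ K))" using \<open>w / 2 * \<rho> ^ K \<le> _\<close> by simp
        finally show ?thesis .
      qed
      then have "?T k \<le> exp (L * real K ^ 2) * 1 * exp (- (w / 2 * \<rho> ^ K))"
        using c1 c2 pos bp_pos[of b] by (intro mult_mono) (auto simp: power_le_one)
      also have "\<dots> = exp (L * real K ^ 2 - w / 2 * \<rho> ^ K)" by (simp flip: exp_add)
      also have "\<dots> \<le> exp (- (w / 4 * \<rho> ^ K))" using elim by (simp add: K_def)
      \<comment> \<open>The reciprocal is much weaker than the exponential, but it still beats the
        number \<open>K\<close> of small sizes and has a simple limit.\<close>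
      also have "\<dots> \<le> 1 / (w / 4 * \<rho> ^ K)"
      proof -
        have "w / 4 * \<rho> ^ K \<le> exp (w / 4 * \<rho> ^ K)" using exp_ge_add_one_self[of "w / 4 * \<rho> ^ K"] by linarith
        moreover have "0 < w / 4 * \<rho> ^ K" using w \<rho> by simp
        ultimately show ?thesis by (simp add: exp_minus field_simps)
      qed
      also have "\<dots> = D" by (simp add: D_def power_divide)
      finally show ?thesis .
    qed
    have large: "?T k \<le> y ^ k" if k: "k \<in> {K<..n}" for k
    proof -
      have k1: "K \<le> k - 1" using k by auto
      have "real (n choose k) \<le> real n ^ k" by (rule binomial_le_power_real)
      moreover have "bp p b ^ (k choose 2) = (t ^ (k - 1)) ^ k"
        unfolding t2 choose_two_square by (metis power_mult mult.commute)
      moreover have "(1 - s ^ k) ^ (n - k) \<le> 1" using pos by (intro power_le_one) (auto simp: power_le_one)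
      ultimately have "?T k \<le> real n ^ k * (t ^ (k - 1)) ^ k * 1"
        using pos by (intro mult_mono) (auto simp: power_le_one)
      also have "\<dots> = (real n * t ^ (k - 1)) ^ k" by (simp add: power_mult_distrib)
      also have "\<dots> \<le> y ^ k"
      proof (rule power_mono)
        have "real n * t ^ (k - 1) \<le> real n * t ^ K" using k1 pos by (intro mult_left_mono power_decreasing) auto
        also have "\<dots> = (real n * w ^ K) * \<theta> ^ K" using w by (simp add: \<theta>_def power_divide)
        also have "\<dots> \<le> 1 * \<theta> ^ K" using nw \<rho> by (intro mult_right_mono) auto
        finally show "real n * t ^ (k - 1) \<le> y" by (simp add: y_def)
      qed (use pos in auto)
      finally show ?thesis .
    qed
    have "Pr n (?Q n) \<le> (\<Sum>k=1..n. ?T k)" unfolding s_def by (rule homog_dominating_upper_bound)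
    also have "(\<Sum>k=1..n. ?T k) = (\<Sum>k\<in>{1..K} \<union> {K<..n}. ?T k)"
      by (rule sum.cong) (use Kn in auto)
    also have "(\<Sum>k\<in>{1..K} \<union> {K<..n}. ?T k) = (\<Sum>k\<in>{1..K}. ?T k) + (\<Sum>k\<in>{K<..n}. ?T k)"
      by (rule sum.union_disjoint) auto
    also have "\<dots> \<le> (\<Sum>k\<in>{1..K}. D) + (\<Sum>k\<in>{K<..n}. y ^ k)"
      by (intro add_mono sum_mono small large)
    also have "(\<Sum>k\<in>{1..K}. D) = 4 / w * (real K * (1 / \<rho>) ^ K)" by (simp add: D_def)
    also have "(\<Sum>k\<in>{K<..n}. y ^ k) \<le> 2 * y"
    proof -
      have "(\<Sum>k\<in>{K<..n}. y ^ k) \<le> (\<Sum>k\<in>{1..n}. y ^ k)"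
        using y by (intro sum_mono2) auto
      also have "\<dots> = y * (\<Sum>k<n. y ^ k)"
        unfolding sum_distrib_left
        by (rule sum.reindex_bij_witness[of _ Suc "\<lambda>k. k - 1"]) (auto simp flip: power_Suc)
      also have "\<dots> \<le> y * (\<Sum>k\<le>n. y ^ k)" using y by (intro mult_left_mono sum_mono2) auto
      also have "\<dots> \<le> y * (1 / (1 - y))" using y by (intro mult_left_mono sum_power_le_geometric) auto
      also have "\<dots> \<le> y * 2" using y by (intro mult_left_mono) (auto simp: field_simps)
      finally show ?thesis by simp
    qed
    finally show ?case by (simp add: g_def K_def y_def)
  qed
  have low: "\<forall>\<^sub>F n in sequentially. 0 \<le> Pr n (?Q n)" by (simp add: pr_nonneg)
  show ?thesis by (rule tendsto_sandwich[OF low up tendsto_const glim])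
qed

lemma extension_whp: "(\<lambda>n. Pr n (\<lambda>E. extension E {1..n} {1..n div 2})) \<longlonglongrightarrow> 1"
proof -
  define a where "a = 1 - min p (1 - p) ^ 4"
  have "0 < min p (1 - p) ^ 4" "min p (1 - p) ^ 4 < 1"
    using p0 p1 by (simp_all add: power_less_one_iff)
  then have a: "0 < a" "a < 1" by (auto simp: a_def)
  define h where "h = sqrt a"
  have h: "0 < h" "h < 1" "a = h ^ 2" using a by (auto simp: h_def)
  have "(\<lambda>n. 1 - 160 / h ^ 10 * (real n ^ 4 * h ^ n)) \<longlonglongrightarrow> 1 - 160 / h ^ 10 * 0"
    using h by (intro tendsto_diff tendsto_mult tendsto_const poly_times_power_tendsto_0) auto
  then have lim: "(\<lambda>n. 1 - 160 / h ^ 10 * (real n ^ 4 * h ^ n)) \<longlonglongrightarrow> 1" by simp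
  have low: "\<forall>\<^sub>F n in sequentially. 1 - 160 / h ^ 10 * (real n ^ 4 * h ^ n) \<le> Pr n (\<lambda>E. extension E {1..n} {1..n div 2})"
    using eventually_ge_at_top[of 1]
  proof eventually_elim
    case (elim n)
    \<comment> \<open>With \<open>a = h ^ 2\<close> the halving of \<open>n\<close> disappears; the
      exponent 10 covers twice the subtracted 4, the rounding in \<open>n div 2\<close>, and the
      truncated subtraction for small \<open>n\<close>.\<close>
    have "a ^ (n div 2 - 4) * h ^ 10 = h ^ (2 * (n div 2 - 4) + 10)" by (simp add: h(3) power_mult power_add)
    also have "\<dots> \<le> h ^ n" using h by (intro power_decreasing) auto
    finally have "a ^ (n div 2 - 4) \<le> h ^ n / h ^ 10" using h by (simp add: field_simps)
    then have "160 * real n ^ 4 * a ^ (n div 2 - 4) \<le> 160 * real n ^ 4 * (h ^ n / h ^ 10)"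
      by (intro mult_left_mono) auto
    then have "Pr n (\<lambda>E. \<not> extension E {1..n} {1..n div 2}) \<le> 160 * real n ^ 4 * (h ^ n / h ^ 10)"
      using extension_failure_bound[OF elim] unfolding a_def[symmetric] by linarith
    then show ?case using pr_not[of "pairs {1..n}" "\<lambda>E. extension E {1..n} {1..n div 2}"] by simp
  qed
  show ?thesis by (rule tendsto_sandwich[OF low _ lim tendsto_const]) (simp add: pr_le_1)
qed


section \<open>Typical graphs and the zero-one law away from the golden ratio\<close>

lemma conj_whp:
  assumes "(\<lambda>n. Pr n (A n)) \<longlonglongrightarrow> 1" "(\<lambda>n. Pr n (A' n)) \<longlonglongrightarrow> 1"
  shows "(\<lambda>n. Pr n (\<lambda>E. A n E \<and> A' n E)) \<longlonglongrightarrow> 1"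
proof -
  have "(\<lambda>n. Pr n (A n) + Pr n (A' n) - 1) \<longlonglongrightarrow> 1 + 1 - 1" by (intro tendsto_intros assms)
  then have lim: "(\<lambda>n. Pr n (A n) + Pr n (A' n) - 1) \<longlonglongrightarrow> 1" by simp
  show ?thesis
    by (rule tendsto_sandwich[OF _ _ lim tendsto_const]) (simp_all add: pr_conj_ge pr_le_1)
qed

lemma all_bool_whp:
  fixes A :: "nat \<Rightarrow> bool \<Rightarrow> nat set set \<Rightarrow> bool"
  assumes "\<And>b. (\<lambda>n. Pr n (A n b)) \<longlonglongrightarrow> 1"
  shows "(\<lambda>n. Pr n (\<lambda>E. \<forall>b. A n b E)) \<longlonglongrightarrow> 1"
  using conj_whp[OF assms[of True] assms[of False]] by (simp add: all_bool_eq conj_commute)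

lemma typical_whp:
  assumes nc: "\<And>b. bp p (\<not> b) \<noteq> sqrt (bp p b)"
  shows "(\<lambda>n. Pr n (\<lambda>E. typical_graph E {1..n} {1..n div 2} (\<lambda>b. bp p (\<not> b) < sqrt (bp p b)))) \<longlonglongrightarrow> 1"
proof -
  let ?P = "\<lambda>b. bp p (\<not> b) < sqrt (bp p b)"
  let ?M = "\<lambda>n b E. \<exists>X\<subseteq>{1..n}. 2 \<le> card X \<and> homog b E X \<and>
    (\<exists>w\<in>{1..n} - X. joined (\<not> b) E w X) \<and> (\<forall>u\<in>{1..n} - X. \<not> joined b E u X)"
  let ?X = "\<lambda>n b E. ?P b \<longrightarrow> (\<exists>X\<subseteq>{1..n}. 2 \<le> card X \<and> homog b E X \<and>
    (\<exists>w\<in>{1..n} - X. joined b E w X) \<and> (\<forall>u\<in>{1..n} - X. \<not> joined (\<not> b) E u X))"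
  let ?N = "\<lambda>n b E. \<not> ?P b \<longrightarrow> \<not> (\<exists>X. X \<subseteq> {1..n} \<and> X \<noteq> {} \<and> homog b E X \<and>
    (\<forall>u\<in>{1..n} - X. \<not> joined (\<not> b) E u X))"
  have T: "(\<lambda>n. Pr n (\<lambda>_. True)) \<longlonglongrightarrow> 1" by (simp add: pr_True)
  have M: "(\<lambda>n. Pr n (?M n b)) \<longlonglongrightarrow> 1" for b
  proof (rule homog_with_apex_whp)
    have "(bp p b)\<^sup>2 < bp p b" using bp_pos[of b] bp_less_1[of b] by (simp add: power2_eq_square)
    then show "bp p b < sqrt (bp p b)" by (rule real_less_rsqrt)
  qed
  have X: "(\<lambda>n. Pr n (?X n b)) \<longlonglongrightarrow> 1" for b
  proof (cases "?P b")
    case True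
    then show ?thesis using homog_with_apex_whp[of "\<not> b" b] by simp
  next
    case False
    then show ?thesis using T by simp
  qed
  have N: "(\<lambda>n. Pr n (?N n b)) \<longlonglongrightarrow> 1" for b
  proof (cases "?P b")
    case True
    then show ?thesis using T by simp
  next
    case False
    then have "sqrt (bp p b) < bp p (\<not> b)" using nc[of b] by linarith
    then have "(\<lambda>n. 1 - Pr n (\<lambda>E. \<exists>X. X \<subseteq> {1..n} \<and> X \<noteq> {} \<and> homog b E X \<and>
        (\<forall>u\<in>{1..n} - X. \<not> joined (\<not> b) E u X))) \<longlonglongrightarrow> 1 - 0"
      by (intro tendsto_intros no_homog_dominating_whp)
    then show ?thesis using False by (simp add: pr_not[symmetric])
  qed
  have "(\<lambda>n. Pr n (\<lambda>E. extension E {1..n} {1..n div 2} \<and>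
      (\<forall>b. ?M n b E) \<and> (\<forall>b. ?X n b E) \<and> (\<forall>b. ?N n b E))) \<longlonglongrightarrow> 1"
    by (rule conj_whp[OF extension_whp conj_whp[OF all_bool_whp[OF M] conj_whp[OF all_bool_whp[OF X] all_bool_whp[OF N]]]])
  note lim = this
  have le: "Pr n (\<lambda>E. extension E {1..n} {1..n div 2} \<and> (\<forall>b. ?M n b E) \<and> (\<forall>b. ?X n b E) \<and> (\<forall>b. ?N n b E)) \<le>
      Pr n (\<lambda>E. typical_graph E {1..n} {1..n div 2} ?P)" for n
  proof (rule pr_mono)
    fix E
    assume a: "extension E {1..n} {1..n div 2} \<and> (\<forall>b. ?M n b E) \<and> (\<forall>b. ?X n b E) \<and> (\<forall>b. ?N n b E)"
    show "typical_graph E {1..n} {1..n div 2} ?P"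
    proof (rule typical_graph.intro)
      show "extension E {1..n} {1..n div 2}" using a by (rule conjunct1)
      show "{1..n div 2} \<subseteq> {1..n}" by auto
      show "?M n b E" for b using a[THEN conjunct2, THEN conjunct1] by (rule spec)
      show "\<exists>X\<subseteq>{1..n}. 2 \<le> card X \<and> homog b E X \<and>
        (\<exists>w\<in>{1..n} - X. joined b E w X) \<and> (\<forall>u\<in>{1..n} - X. \<not> joined (\<not> b) E u X)" if "?P b" for b
        using a[THEN conjunct2, THEN conjunct2, THEN conjunct1, THEN spec, of b] that by (rule mp)
      show "\<exists>u\<in>{1..n} - X. joined (\<not> b) E u X"
        if np: "\<not> ?P b" and X: "X \<subseteq> {1..n}" "X \<noteq> {}" "homog b E X" for b X
      proof (rule ccontr)
        assume "\<not> ?thesis"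
        then have "\<forall>u\<in>{1..n} - X. \<not> joined (\<not> b) E u X" by simp
        then have "\<exists>X. X \<subseteq> {1..n} \<and> X \<noteq> {} \<and> homog b E X \<and> (\<forall>u\<in>{1..n} - X. \<not> joined (\<not> b) E u X)"
          using X by (intro exI[of _ X] conjI)
        then show False
          using a[THEN conjunct2, THEN conjunct2, THEN conjunct2, THEN spec, of b, THEN mp, OF np]
          by (rule notE[rotated])
      qed
    qed simp
  qed simp
  show ?thesis
    by (rule tendsto_sandwich[OF _ _ lim tendsto_const]) (simp_all only: le pr_le_1 finite_pairs finite_atLeastAtMost eventually_True)
qed

text \<open>Typical graphs of all sizes agree on \<open>\<phi>\<close>, so \<open>\<phi>\<close>
  either holds in every typical graph or fails in every one, and typical graphs have probability
  tending to 1.\<close>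

lemma zero_one_law_noncritical:
  assumes nc: "\<And>b. bp p (\<not> b) \<noteq> sqrt (bp p b)"
  shows "zero_one_law_E12 p"
  unfolding zero_one_law_E12_def prob_Gnp_eq_Pr
proof (intro allI impI)
  fix \<phi> assume \<phi>: "E12 \<phi>"
  let ?P = "\<lambda>b. bp p (\<not> b) < sqrt (bp p b)"
  let ?T = "\<lambda>n E. typical_graph E {1..n} {1..n div 2} ?P"
  let ?S = "\<lambda>n E. models_E12 E {1..n} \<phi>"
  note lim = typical_whp[OF nc]
  have same: "?S n E \<longleftrightarrow> ?S n' E'"
    if "?T n E" "E \<subseteq> pairs {1..n}" "?T n' E'" "E' \<subseteq> pairs {1..n'}" for n E n' E'
  proof (rule models_E12_cong[OF \<phi>])
    show "vtypes E {1..n} ` Pow {1..n} = vtypes E' {1..n'} ` Pow {1..n'}"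
      using typical_graph.realised_vtypes[OF that(1)] typical_graph.realised_vtypes[OF that(3)] by (rule trans[OF _ sym])
  qed (use that no_loops in auto)
  show "\<exists>L\<in>{0, 1}. (\<lambda>n. Pr n (?S n)) \<longlonglongrightarrow> L"
  proof (cases "\<exists>n E. ?T n E \<and> E \<subseteq> pairs {1..n} \<and> ?S n E")
    case True
    then obtain n\<^sub>0 E\<^sub>0 where *: "?T n\<^sub>0 E\<^sub>0" "E\<^sub>0 \<subseteq> pairs {1..n\<^sub>0}" "?S n\<^sub>0 E\<^sub>0" by (elim exE conjE)
    have "Pr n (?T n) \<le> Pr n (?S n)" for n
    proof (rule pr_mono)
      fix E assume "E \<subseteq> pairs {1..n}" "?T n E"
      from same[OF this(2,1) *(1,2)] *(3) show "?S n E" by (rule iffD2)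
    qed simp
    then have "(\<lambda>n. Pr n (?S n)) \<longlonglongrightarrow> 1"
      by (intro tendsto_sandwich[OF _ _ lim tendsto_const]) (simp_all add: pr_le_1)
    then show ?thesis by blast
  next
    case False
    have "Pr n (?S n) \<le> 1 - Pr n (?T n)" for n
    proof -
      have "Pr n (?S n) \<le> Pr n (\<lambda>E. \<not> ?T n E)"
      proof (rule pr_mono, simp, rule notI)
        fix E assume "E \<subseteq> pairs {1..n}" "?S n E" "?T n E"
        then have "\<exists>n E. ?T n E \<and> E \<subseteq> pairs {1..n} \<and> ?S n E" by (intro exI conjI)
        then show False by (rule notE[OF False])
      qed
      then show ?thesis by (simp add: pr_not)
    qed
    note le = this
    have "(\<lambda>n. 1 - Pr n (?T n)) \<longlonglongrightarrow> 1 - 1" by (intro tendsto_intros lim)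
    then have lim0: "(\<lambda>n. 1 - Pr n (?T n)) \<longlonglongrightarrow> 0" by simp
    have "(\<lambda>n. Pr n (?S n)) \<longlonglongrightarrow> 0"
      by (rule tendsto_sandwich[OF _ _ tendsto_const lim0]) (simp_all only: le pr_nonneg eventually_True)
    then show ?thesis by blast
  qed
qed

end

text \<open>Squaring gives \<open>p ^ 2 = 1 - p\<close> for \<open>b = False\<close> and
  \<open>(1 - p) ^ 2 = p\<close> for \<open>b = True\<close>; each quadratic has exactly one root in
  the open unit interval.\<close>

lemma golden_iff_critical:
  fixes p :: real
  assumes p: "0 < p" "p < 1"
  shows "p \<in> {(3 - sqrt 5) / 2, (sqrt 5 - 1) / 2} \<longleftrightarrow> (\<exists>b. bp p (\<not> b) = sqrt (bp p b))"
proof -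
  have s5: "sqrt 5 * sqrt 5 = 5" "2 < sqrt 5" "sqrt 5 < 3"
    by (simp, rule real_less_rsqrt, simp, rule real_less_lsqrt, simp_all)
  have A: "p = sqrt (1 - p) \<longleftrightarrow> p = (sqrt 5 - 1) / 2"
  proof -
    have "p = sqrt (1 - p) \<longleftrightarrow> p\<^sup>2 = 1 - p"
      using p by (metis diff_ge_0_iff_ge less_eq_real_def real_sqrt_pow2 real_sqrt_unique)
    also have "\<dots> \<longleftrightarrow> (p - (sqrt 5 - 1) / 2) * (p + (sqrt 5 + 1) / 2) = 0"
      using s5(1) by (simp add: power2_eq_square algebra_simps add_divide_distrib diff_divide_distrib)
    also have "\<dots> \<longleftrightarrow> p = (sqrt 5 - 1) / 2"
    proof -
      have "p + (sqrt 5 + 1) / 2 \<noteq> 0" using p s5 by (smt (verit) divide_pos_pos)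
      then show ?thesis by simp
    qed
    finally show ?thesis .
  qed
  have B: "1 - p = sqrt p \<longleftrightarrow> p = (3 - sqrt 5) / 2"
  proof -
    have "1 - p = sqrt p \<longleftrightarrow> (1 - p)\<^sup>2 = p"
      using p by (metis diff_ge_0_iff_ge less_eq_real_def real_sqrt_pow2 real_sqrt_unique)
    also have "\<dots> \<longleftrightarrow> (p - (3 - sqrt 5) / 2) * (p - (3 + sqrt 5) / 2) = 0"
      using s5(1) by (simp add: power2_eq_square algebra_simps add_divide_distrib diff_divide_distrib)
    also have "\<dots> \<longleftrightarrow> p = (3 - sqrt 5) / 2"
    proof -
      have "p - (3 + sqrt 5) / 2 \<noteq> 0" using p s5 by auto
      then show ?thesis by simp
    qed
    finally show ?thesis .
  qed
  show ?thesis using A B by (auto simp: ex_bool_eq bp_def)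
qed

subsection \<open>The golden ratio\<close>

text \<open>The induction step is \<open>exp 1 \<le> (1 + 1 / m) ^ (m + 1)\<close>. The linear
  factor exceeds the square root in Stirling's formula; in the lower bound for the expectation it is
  paid for by the \<open>m\<close> choices of the marked vertex.\<close>

lemma fact_upper: "fact (Suc k) \<le> real (Suc k) ^ Suc k * exp (1 - real (Suc k)) * real (Suc k)"
proof (induction k)
  case (Suc k)
  define m where "m = real (Suc k)"
  have m: "1 \<le> m" by (simp add: m_def)
  have e: "exp 1 \<le> (1 + 1 / m) ^ (Suc (Suc k))"
  proof -
    have "1 / (1 + 1 / m) \<le> exp (- (1 / (m + 1)))"
    proof -
      have "1 / (1 + 1 / m) = 1 - 1 / (m + 1)" using m by (simp add: field_simps)
      then show ?thesis using exp_ge_add_one_self[of "- (1 / (m + 1))"] by simp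
    qed
    then have "(1 / (1 + 1 / m)) ^ (Suc (Suc k)) \<le> exp (- (1 / (m + 1))) ^ (Suc (Suc k))"
      using m by (intro power_mono) auto
    also have "\<dots> = exp (- 1)"
    proof -
      have "real (Suc (Suc k)) = m + 1" by (simp add: m_def)
      then have "real (Suc (Suc k)) * (- (1 / (m + 1))) = - 1" using m by (simp add: field_simps)
      then show ?thesis by (simp only: exp_of_nat_mult[symmetric])
    qed
    finally have "1 / (1 + 1 / m) ^ Suc (Suc k) \<le> 1 / exp 1" by (simp add: power_one_over exp_minus inverse_eq_divide)
    moreover have "0 < (1 + 1 / m) ^ Suc (Suc k)" using m by (intro zero_less_power) (simp add: add_pos_pos)
    ultimately show ?thesis by (simp add: field_simps)
  qed
  have "fact (Suc (Suc k)) = (m + 1) * fact (Suc k)" by (simp add: m_def algebra_simps)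
  also have "\<dots> \<le> (m + 1) * (m ^ Suc k * exp (1 - m) * m)"
    using Suc.IH m by (intro mult_left_mono) (auto simp: m_def)
  also have "\<dots> = (m + 1) * exp (- m) * (m ^ Suc (Suc k) * exp 1)" by (simp add: exp_diff exp_minus field_simps)
  also have "\<dots> \<le> (m + 1) * exp (- m) * (m ^ Suc (Suc k) * (1 + 1 / m) ^ Suc (Suc k))"
    using e m by (intro mult_left_mono) auto
  also have "m ^ Suc (Suc k) * (1 + 1 / m) ^ Suc (Suc k) = (m + 1) ^ Suc (Suc k)"
  proof -
    have "m * (1 + 1 / m) = m + 1" using m by (simp add: field_simps)
    then show ?thesis by (simp only: power_mult_distrib[symmetric])
  qed
  also have "(m + 1) * exp (- m) * (m + 1) ^ Suc (Suc k) =
      real (Suc (Suc k)) ^ Suc (Suc k) * exp (1 - real (Suc (Suc k))) * real (Suc (Suc k))"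
    by (simp add: m_def algebra_simps)
  finally show ?case .
qed simp

text \<open>A single term of the exponential series at \<open>m\<close> is at most its sum.\<close>

lemma power_le_fact_exp: "real m ^ m \<le> fact m * exp (real m)"
proof -
  have "(\<Sum>i\<in>{m}. real m ^ i /\<^sub>R fact i) \<le> exp (real m)"
    unfolding exp_def by (rule sum_le_suminf[OF summable_exp_generic]) auto
  then show ?thesis by (simp add: field_simps)
qed

text \<open>\<open>x ^ k\<close> is the smallest of the first \<open>k + 1\<close> terms of the
  geometric series.\<close>

lemma mult_power_le_geometric:
  fixes x :: real
  assumes "0 \<le> x" "x < 1"
  shows "real (Suc k) * x ^ k \<le> 1 / (1 - x)"
proof -
  have "real (Suc k) * x ^ k = (\<Sum>j\<le>k. x ^ k)" by simp
  also have "\<dots> \<le> (\<Sum>j\<le>k. x ^ j)" using assms by (intro sum_mono power_decreasing) auto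
  also have "\<dots> \<le> 1 / (1 - x)" using assms by (rule sum_power_le_geometric)
  finally show ?thesis .
qed

lemma choose_ge_power_div_fact:
  assumes "m \<le> n" "l \<le> m"
  shows "real (n - m) ^ l / fact l \<le> real (n choose l)"
proof -
  have "(n - m) ^ l \<le> fact l * (n choose l)"
    using assms
  proof (induction l)
    case (Suc l)
    have "(n - m) ^ Suc l \<le> (n - l) * (fact l * (n choose l))"
      using Suc by (simp add: mult_le_mono)
    also have "\<dots> = fact l * (Suc l * (n choose Suc l))"
    proof -
      have "(n - l) * (n choose l) = Suc l * (n choose Suc l)"
        unfolding binomial_absorb_comp by (rule binomial_absorption[symmetric])
      then show ?thesis by (simp only: mult.left_commute[of _ "fact l"])
    qed
    finally show ?case by (simp add: algebra_simps)
  qed simp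
  then have "real ((n - m) ^ l) \<le> real (fact l * (n choose l))" by (simp only: of_nat_le_iff)
  then show ?thesis by (simp add: field_simps)
qed

text \<open>The property without a limiting probability: \<open>X\<close> is a clique (\<open>b\<close>) or independent set
  (\<open>\<not> b\<close>) that is not maximal, and no outside vertex is joined to it uniformly in the opposite way.\<close>
definition crit :: "bool \<Rightarrow> nat set \<Rightarrow> nat set set \<Rightarrow> bool" where
  "crit b V E \<longleftrightarrow> (\<exists>X\<subseteq>V. homog b E X \<and> (\<exists>v\<in>V - X. joined b E v X) \<and> (\<forall>u\<in>V - X. \<not> joined (\<not> b) E u X))"

definition rel_fo :: "bool \<Rightarrow> fo" where
  "rel_fo b = (if b then Adj 0 1 else Neg (Adj 0 1))"

definition crit_fo :: "bool \<Rightarrow> fo" where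
  "crit_fo b = Conj
     (Neg (Ex 0 (Ex 1 (Conj (Conj (InX 0) (Conj (InX 1) (Neg (Eq 0 1)))) (Neg (rel_fo b))))))
     (Conj (Ex 0 (Conj (Neg (InX 0)) (Neg (Ex 1 (Conj (InX 1) (Neg (rel_fo b)))))))
       (Neg (Ex 0 (Conj (Neg (InX 0)) (Neg (Ex 1 (Conj (InX 1) (rel_fo b))))))))"

lemma E12_crit_fo: "E12 (crit_fo b)"
  by (cases b) (auto simp: E12_def crit_fo_def rel_fo_def)

lemma models_crit_fo: "models_E12 E V (crit_fo b) \<longleftrightarrow> crit b V E"
proof -
  have rel: "sat E V S a (rel_fo b) \<longleftrightarrow> adj E (a 0) (a 1) = b" for S a
    by (cases b) (simp_all add: rel_fo_def adj_def)
  have "sat E V S a (crit_fo b) \<longleftrightarrow>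
      homog b E S \<and> (\<exists>v\<in>V - S. joined b E v S) \<and> (\<forall>u\<in>V - S. \<not> joined (\<not> b) E u S)" if S: "S \<subseteq> V" for S a
  proof -
    have "sat E V S a (crit_fo b) \<longleftrightarrow>
        (\<forall>x\<in>V. x \<in> S \<longrightarrow> (\<forall>y\<in>V. y \<in> S \<longrightarrow> x = y \<or> adj E x y = b)) \<and>
        (\<exists>v\<in>V. v \<notin> S \<and> (\<forall>y\<in>V. y \<in> S \<longrightarrow> adj E v y = b)) \<and>
        (\<forall>u\<in>V. u \<in> S \<or> (\<exists>y\<in>V. y \<in> S \<and> adj E u y = b))"
      unfolding crit_fo_def by (simp add: rel)
    moreover have "(\<forall>v\<in>V. v \<in> S \<longrightarrow> Q v) \<longleftrightarrow> (\<forall>v\<in>S. Q v)" "(\<exists>v\<in>V. v \<in> S \<and> Q v) \<longleftrightarrow> (\<exists>v\<in>S. Q v)"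
      "(\<exists>v\<in>V. v \<notin> S \<and> Q v) \<longleftrightarrow> (\<exists>v\<in>V - S. Q v)" "(\<forall>v\<in>V. v \<in> S \<or> Q v) \<longleftrightarrow> (\<forall>v\<in>V - S. Q v)" for Q
      using S by blast+
    moreover have "(\<exists>y\<in>S. adj E u y = b) \<longleftrightarrow> \<not> joined (\<not> b) E u S" for u
      unfolding joined_def by (cases b) simp_all
    ultimately show ?thesis by (simp only: homog_def joined_def[of b] disj_imp)
  qed
  then show ?thesis unfolding models_E12_def crit_def by (intro ex_cong1 conj_cong refl)
qed

text \<open>Witnesses for \<open>crit\<close> are counted as pairs \<open>(A, v)\<close> with \<open>A = X \<union> {v}\<close>; the factor \<open>m\<close> for the
  choice of \<open>v\<close> is what keeps their maximal expected number bounded away from \<open>0\<close>.\<close>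
definition conf :: "nat \<Rightarrow> nat \<Rightarrow> (nat set \<times> nat) set" where
  "conf n m = (SIGMA A:{A. A \<subseteq> {1..n} \<and> card A = m}. A)"

definition conf_event :: "nat \<Rightarrow> bool \<Rightarrow> nat set \<times> nat \<Rightarrow> nat set set \<Rightarrow> bool" where
  "conf_event n b i E \<longleftrightarrow> homog b E (fst i) \<and> (\<forall>u\<in>{1..n} - fst i. \<not> joined (\<not> b) E u (fst i - {snd i}))"

lemma finite_subsets_of_card: "finite {A. A \<subseteq> {1..n::nat} \<and> card A = m}"
  by (rule finite_subset[of _ "Pow {1..n}"]) auto

lemma finite_conf: "finite (conf n m)"
  unfolding conf_def
  by (intro finite_SigmaI finite_subsets_of_card) (use finite_subset[of _ "{1..n}"] in blast)

lemma card_conf: "card (conf n m) = m * (n choose m)"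
proof -
  have "card (conf n m) = (\<Sum>A\<in>{A. A \<subseteq> {1..n} \<and> card A = m}. card A)"
    unfolding conf_def by (intro card_SigmaI finite_subsets_of_card) (use finite_subset[of _ "{1..n}"] in blast)
  also have "\<dots> = (\<Sum>A\<in>{A. A \<subseteq> {1..n} \<and> card A = m}. m)" by (intro sum.cong) auto
  also have "\<dots> = m * (n choose m)" using n_subsets[of "{1..n}" m] by simp
  finally show ?thesis .
qed

text \<open>The set \<open>X\<close> cannot be empty, since the vertex \<open>v\<close> would then
  be joined to it by both values; hence sizes start at 2. For nonempty \<open>X\<close> the marked
  vertex \<open>v\<close> is joined by \<open>b\<close> and thus not by \<open>\<not> b\<close>, so
  only vertices outside \<open>A\<close> have to be tested.\<close>

lemma crit_iff_conf:
  "crit b {1..n} E \<longleftrightarrow> (\<exists>m\<in>{2..n}. \<exists>i\<in>conf n m. conf_event n b i E)"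
proof
  assume "crit b {1..n} E"
  then obtain X v where X: "X \<subseteq> {1..n}" "homog b E X" "v \<in> {1..n} - X" "joined b E v X"
    "\<forall>u\<in>{1..n} - X. \<not> joined (\<not> b) E u X" unfolding crit_def by (elim exE bexE conjE)
  have finX: "finite X" using X(1) by (rule finite_subset) simp
  have "X \<noteq> {}" using X(3,5) by (auto simp: joined_def)
  then have c: "card (insert v X) \<in> {2..n}"
    using X(1,3) finX card_mono[of "{1..n}" "insert v X"] by (auto simp: card_gt_0_iff Suc_le_eq)
  have "homog b E (insert v X)" unfolding homog_def
  proof (intro ballI impI)
    fix x y assume xy: "x \<in> insert v X" "y \<in> insert v X" "x \<noteq> y"
    consider "x = v" "y \<in> X" | "y = v" "x \<in> X" | "x \<in> X" "y \<in> X" using xy by auto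
    then show "adj E x y = b"
    proof cases
      case 1
      then show ?thesis using X(4) by (simp add: joined_def)
    next
      case 2
      then have "adj E v x = b" using X(4) by (simp add: joined_def)
      then show ?thesis using 2 adj_commute[of E x v] by simp
    next
      case 3
      then show ?thesis using X(2) xy by (simp add: homog_def)
    qed
  qed
  moreover have "insert v X - {v} = X" using X(3) by blast
  ultimately have "conf_event n b (insert v X, v) E" using X(5) by (simp add: conf_event_def)
  moreover have "(insert v X, v) \<in> conf n (card (insert v X))" using X(1,3) by (simp add: conf_def)
  ultimately have "\<exists>i\<in>conf n (card (insert v X)). conf_event n b i E" by (rule bexI)
  then show "\<exists>m\<in>{2..n}. \<exists>i\<in>conf n m. conf_event n b i E" using c by (rule bexI)
next
  assume "\<exists>m\<in>{2..n}. \<exists>i\<in>conf n m. conf_event n b i E"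
  then obtain m A v where m: "m \<in> {2..n}" and A: "A \<subseteq> {1..n}" "card A = m" "v \<in> A"
    and ev: "conf_event n b (A, v) E" unfolding conf_def by (elim bexE SigmaE) auto
  let ?X = "A - {v}"
  have h: "homog b E A" and u: "\<forall>u\<in>{1..n} - A. \<not> joined (\<not> b) E u ?X"
    using ev by (simp_all add: conf_event_def)
  have "finite A" using A(1) by (rule finite_subset) simp
  then have "card ?X \<noteq> 0" using A m by simp
  then have ne: "?X \<noteq> {}" by (metis card.empty)
  have j: "joined b E v ?X" using h A(3) by (simp add: joined_def homog_def)
  have "\<not> joined (\<not> b) E v ?X" using j ne by (auto simp: joined_def)
  moreover have "{1..n} - ?X \<subseteq> insert v ({1..n} - A)" by blast
  ultimately have "\<forall>u\<in>{1..n} - ?X. \<not> joined (\<not> b) E u ?X" using u by blast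
  moreover have "v \<in> {1..n} - ?X" using A by blast
  moreover have "homog b E ?X" using h by (simp add: homog_def)
  moreover have "?X \<subseteq> {1..n}" using A by blast
  ultimately show "crit b {1..n} E" unfolding crit_def using j by (intro exI[of _ ?X] conjI bexI[of _ v])
qed

section \<open>Moments of the critical configurations\<close>

context edge_probability
begin

lemma pr_conf_event:
  assumes i: "i \<in> conf n m"
  shows "Pr n (conf_event n b i) = bp p b ^ (m choose 2) * (1 - bp p (\<not> b) ^ (m - 1)) ^ (n - m)"
proof -
  obtain A v where Av: "i = (A, v)" "A \<subseteq> {1..n}" "card A = m" "v \<in> A" using i unfolding conf_def by auto
  have finA: "finite A" using Av(2) by (rule finite_subset) simp
  let ?X = "A - {v}"
  have cX: "card ?X = m - 1" using Av finA by simp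
  have "Pr n (conf_event n b i) = Pr n (\<lambda>E. homog b E A \<and> (\<forall>u\<in>{1..n} - A. \<not> joined (\<not> b) E u ?X))"
    by (rule pr_cong) (simp add: conf_event_def Av(1))
  also have "\<dots> = Pr n (\<lambda>E. homog b E A) * (\<Prod>u\<in>{1..n} - A. Pr n (\<lambda>E. \<not> joined (\<not> b) E u ?X))"
  proof (rule pr_inside_outside[OF _ _ _ depends_on_homog])
    show "depends_on (\<lambda>E. \<not> joined (\<not> b) E u ?X) (star u A)" for u
      by (rule depends_on_mono[OF depends_on_not[OF depends_on_joined]]) (auto simp: star_def)
  qed auto
  also have "(\<Prod>u\<in>{1..n} - A. Pr n (\<lambda>E. \<not> joined (\<not> b) E u ?X)) = (\<Prod>u\<in>{1..n} - A. 1 - bp p (\<not> b) ^ (m - 1))"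
  proof (rule prod.cong[OF refl])
    fix u assume u: "u \<in> {1..n} - A"
    then show "Pr n (\<lambda>E. \<not> joined (\<not> b) E u ?X) = 1 - bp p (\<not> b) ^ (m - 1)"
      using pr_not_joined[of u n ?X "\<not> b"] Av(2) unfolding cX by blast
  qed
  also have "\<dots> = (1 - bp p (\<not> b) ^ (m - 1)) ^ (n - m)" using Av finA by (simp add: card_Diff_subset)
  also have "Pr n (\<lambda>E. homog b E A) = bp p b ^ (m choose 2)" using pr_homog[OF Av(2), of b] Av(3) by simp
  finally show ?thesis .
qed

lemma pr_crit_upper:
  "Pr n (crit b {1..n}) \<le>
    (\<Sum>m=2..n. real m * real (n choose m) * (bp p b ^ (m choose 2) * (1 - bp p (\<not> b) ^ (m - 1)) ^ (n - m)))"
proof -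
  have "Pr n (crit b {1..n}) = Pr n (\<lambda>E. \<exists>m\<in>{2..n}. \<exists>i\<in>conf n m. conf_event n b i E)"
    by (rule pr_cong) (rule crit_iff_conf)
  also have "\<dots> \<le> (\<Sum>m=2..n. Pr n (\<lambda>E. \<exists>i\<in>conf n m. conf_event n b i E))" by (rule pr_Bex_le) auto
  also have "\<dots> \<le> (\<Sum>m=2..n. \<Sum>i\<in>conf n m. Pr n (conf_event n b i))"
    by (intro sum_mono pr_Bex_le finite_conf) simp
  also have "\<dots> = (\<Sum>m=2..n. real m * real (n choose m) * (bp p b ^ (m choose 2) * (1 - bp p (\<not> b) ^ (m - 1)) ^ (n - m)))"
  proof (rule sum.cong[OF refl])
    fix m
    have "(\<Sum>i\<in>conf n m. Pr n (conf_event n b i)) =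
        (\<Sum>i\<in>conf n m. bp p b ^ (m choose 2) * (1 - bp p (\<not> b) ^ (m - 1)) ^ (n - m))"
      by (intro sum.cong refl pr_conf_event)
    then show "(\<Sum>i\<in>conf n m. Pr n (conf_event n b i)) =
        real m * real (n choose m) * (bp p b ^ (m choose 2) * (1 - bp p (\<not> b) ^ (m - 1)) ^ (n - m))"
      by (simp add: card_conf)
  qed
  finally show ?thesis .
qed

text \<open>Only vertices outside \<open>A \<union> B\<close> are tested, each against both sets,
  with probability \<open>1 - 2 * a + c\<close>. This is at most
  \<open>(1 - a)\<^sup>2 * exp (c / (1 - a)\<^sup>2)\<close>, which separates the value for
  independent events from a correlation term. The factor \<open>1 / (1 - a) ^ (2 * m)\<close>
  compensates for the vertices of \<open>A \<union> B\<close> that are left out.\<close>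

lemma pr_two_conf_events:
  fixes n m :: nat and b :: bool
  defines "s \<equiv> bp p (\<not> b)"
  assumes A: "(A, v) \<in> conf n m" and B: "(B, w) \<in> conf n m" and mn: "2 * m \<le> n" and m: "2 \<le> m"
  shows "Pr n (\<lambda>E. conf_event n b (A, v) E \<and> conf_event n b (B, w) E) \<le>
    (bp p b ^ (m choose 2) * (1 - s ^ (m - 1)) ^ (n - m))\<^sup>2 * (1 / (1 - s ^ (m - 1)) ^ (2 * m)) *
    (exp (real n * s ^ card ((A - {v}) \<union> (B - {w})) / (1 - s ^ (m - 1))\<^sup>2) / bp p b ^ (card (A \<inter> B) choose 2))"
proof -
  have A': "A \<subseteq> {1..n}" "card A = m" "v \<in> A" and B': "B \<subseteq> {1..n}" "card B = m" "w \<in> B"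
    using A B by (auto simp: conf_def)
  have fin: "finite A" "finite B" using A'(1) B'(1) by (auto intro: finite_subset)
  let ?X = "A - {v}" and ?Y = "B - {w}"
  define a c l where "a = s ^ (m - 1)" and "c = s ^ card (?X \<union> ?Y)" and "l = card (A \<inter> B)"
  have s: "0 < s" "s < 1" using bp_pos bp_less_1 by (auto simp: s_def)
  have a: "0 < a" "a < 1" using s m by (auto simp: a_def power_less_one_iff)
  have c: "0 < c" using s by (simp add: c_def)
  have cXY: "card ?X = m - 1" "card ?Y = m - 1" using A' B' fin by simp_all
  let ?U = "{1..n} - (A \<union> B)"
  let ?N = "\<lambda>u E. \<not> joined (\<not> b) E u ?X \<and> \<not> joined (\<not> b) E u ?Y"
  have "Pr n (\<lambda>E. conf_event n b (A, v) E \<and> conf_event n b (B, w) E) \<le>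
      Pr n (\<lambda>E. (homog b E A \<and> homog b E B) \<and> (\<forall>u\<in>?U. ?N u E))"
    by (rule pr_mono) (auto simp: conf_event_def)
  also have "\<dots> = Pr n (\<lambda>E. homog b E A \<and> homog b E B) * (\<Prod>u\<in>?U. Pr n (?N u))"
  proof (rule pr_inside_outside[where W = "A \<union> B"])
    show "depends_on (\<lambda>E. homog b E A \<and> homog b E B) (pairs (A \<union> B))"
      by (intro depends_on_conj depends_on_mono[OF depends_on_homog] pairs_mono) auto
    show "depends_on (?N u) (star u (A \<union> B))" for u
      by (intro depends_on_conj depends_on_mono[OF depends_on_not[OF depends_on_joined]]) (auto simp: star_def)
  qed auto
  also have "(\<Prod>u\<in>?U. Pr n (?N u)) = (\<Prod>u\<in>?U. 1 - 2 * a + c)"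
  proof (rule prod.cong[OF refl])
    fix u assume u: "u \<in> ?U"
    have "Pr n (?N u) = 1 - s ^ card ?X - s ^ card ?Y + s ^ card (?X \<union> ?Y)"
      unfolding s_def by (rule pr_joined_neither) (use u A'(1) B'(1) in auto)
    then show "Pr n (?N u) = 1 - 2 * a + c" by (simp add: cXY a_def c_def)
  qed
  also have "\<dots> = (1 - 2 * a + c) ^ card ?U" by simp
  also have "card ?U = n - 2 * m + l"
  proof -
    have "card (A \<union> B) + l = 2 * m" using card_Un_Int[OF fin] A' B' by (simp add: l_def)
    moreover have "card ?U = n - card (A \<union> B)" using A'(1) B'(1) fin by (subst card_Diff_subset) auto
    ultimately show ?thesis using mn by linarith
  qed
  also have "Pr n (\<lambda>E. homog b E A \<and> homog b E B) = (bp p b ^ (m choose 2))\<^sup>2 / bp p b ^ (l choose 2)"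
    unfolding pr_two_homog[OF A'(1) B'(1)] A'(2) B'(2) l_def by (simp add: power2_eq_square)
  finally have prod: "Pr n (\<lambda>E. conf_event n b (A, v) E \<and> conf_event n b (B, w) E) \<le>
      (bp p b ^ (m choose 2))\<^sup>2 / bp p b ^ (l choose 2) * (1 - 2 * a + c) ^ (n - 2 * m + l)" .
  have "(1 - 2 * a + c) ^ (n - 2 * m + l) \<le>
      ((1 - a) ^ (n - m))\<^sup>2 * (1 / (1 - a) ^ (2 * m)) * exp (real n * c / (1 - a)\<^sup>2)"
  proof -
    have lm: "l \<le> m" using card_mono[OF fin(1), of "A \<inter> B"] A' by (simp add: l_def)
    have "1 - 2 * a + c \<le> (1 - a)\<^sup>2 * (1 + c / (1 - a)\<^sup>2)"
      using a by (simp add: distrib_left) (simp add: power2_eq_square algebra_simps)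
    also have "\<dots> \<le> (1 - a)\<^sup>2 * exp (c / (1 - a)\<^sup>2)"
      by (intro mult_left_mono exp_ge_add_one_self) auto
    finally have le: "1 - 2 * a + c \<le> (1 - a)\<^sup>2 * exp (c / (1 - a)\<^sup>2)" .
    have ge: "0 \<le> 1 - 2 * a + c"
    proof -
      have "card (?X \<union> ?Y) \<le> 2 * (m - 1)" using card_Un_le[of ?X ?Y] cXY by simp
      then have "a\<^sup>2 \<le> c" unfolding a_def c_def power_mult[symmetric] using s by (intro power_decreasing) (auto simp: mult.commute)
      then have "(1 - a)\<^sup>2 \<le> 1 - 2 * a + c" by (simp add: power2_eq_square algebra_simps)
      then show ?thesis using zero_le_power2[of "1 - a"] by linarith
    qed
    have "(1 - 2 * a + c) ^ (n - 2 * m + l) \<le> ((1 - a)\<^sup>2 * exp (c / (1 - a)\<^sup>2)) ^ (n - 2 * m + l)"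
      using le ge by (rule power_mono)
    also have "\<dots> = (1 - a) ^ (2 * (n - 2 * m + l)) * exp (real (n - 2 * m + l) * (c / (1 - a)\<^sup>2))"
      by (simp only: power_mult_distrib power_mult exp_of_nat_mult)
    also have "\<dots> \<le> (((1 - a) ^ (n - m))\<^sup>2 * (1 / (1 - a) ^ (2 * m))) * exp (real n * (c / (1 - a)\<^sup>2))"
    proof (intro mult_mono)
      have "(1 - a) ^ (2 * (n - 2 * m + l)) * (1 - a) ^ (2 * m) = (1 - a) ^ (2 * (n - 2 * m + l) + 2 * m)"
        by (simp add: power_add)
      also have "\<dots> \<le> (1 - a) ^ (2 * (n - m))" using a mn by (intro power_decreasing) auto
      also have "\<dots> = ((1 - a) ^ (n - m))\<^sup>2" by (simp add: power_mult mult.commute)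
      finally show "(1 - a) ^ (2 * (n - 2 * m + l)) \<le> ((1 - a) ^ (n - m))\<^sup>2 * (1 / (1 - a) ^ (2 * m))"
        using a by (simp add: field_simps)
      have "real (n - 2 * m + l) \<le> real n" using lm mn by simp
      then show "exp (real (n - 2 * m + l) * (c / (1 - a)\<^sup>2)) \<le> exp (real n * (c / (1 - a)\<^sup>2))"
        using a c by (simp add: divide_right_mono mult_right_mono)
    qed (use a in auto)
    finally show ?thesis by simp
  qed
  then have "(bp p b ^ (m choose 2))\<^sup>2 / bp p b ^ (l choose 2) * (1 - 2 * a + c) ^ (n - 2 * m + l) \<le>
      (bp p b ^ (m choose 2))\<^sup>2 / bp p b ^ (l choose 2) *
      (((1 - a) ^ (n - m))\<^sup>2 * (1 / (1 - a) ^ (2 * m)) * exp (real n * c / (1 - a)\<^sup>2))"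
    using bp_pos[of b] by (intro mult_left_mono) auto
  with prod have "Pr n (\<lambda>E. conf_event n b (A, v) E \<and> conf_event n b (B, w) E) \<le>
      (bp p b ^ (m choose 2))\<^sup>2 / bp p b ^ (l choose 2) *
      (((1 - a) ^ (n - m))\<^sup>2 * (1 / (1 - a) ^ (2 * m)) * exp (real n * c / (1 - a)\<^sup>2))" by (rule order_trans)
  then show ?thesis unfolding a_def[symmetric] c_def[symmetric] l_def[symmetric]
    by (simp add: power_mult_distrib mult_ac)
qed

end

lemma fact_le_fact_mult_power:
  assumes "l \<le> m"
  shows "fact m \<le> (fact (m - l) * m ^ l :: nat)"
proof -
  have "fact m = fact m div fact (m - l) * (fact (m - l) :: nat)" by (simp add: fact_dvd)
  also have "\<dots> \<le> m ^ l * fact (m - l)" using fact_div_fact_le_pow[OF assms] by (rule mult_le_mono1)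
  finally show ?thesis by (simp add: mult.commute)
qed

text \<open>The two summands are the two regimes. For \<open>2 * l \<le> m\<close> the sets
  \<open>A\<close>, \<open>B\<close> overlap little, the correlation exponential is at most
  \<open>exp 1\<close>, and the power \<open>s ^ (l * (m - l))\<close> is at most
  \<open>h ^ (m * l)\<close>. For larger \<open>l\<close> that exponential can be of order
  \<open>exp m\<close>, but the ratio of binomials gains a factor \<open>exp (- m)\<close>, and what
  remains is small in \<open>m - l\<close>.\<close>

lemma critical_overlap_term:
  fixes s a h y :: real and m n l :: nat
  assumes s: "0 < s" "s < 1" and a: "a = s ^ (m - 1)" and h: "0 < h" "s = h\<^sup>2" and y: "y = real m ^ 2 * h ^ m"
    and m: "2 \<le> m" and l: "l < m" and mn: "m \<le> n"
    and nm: "real m * (1 - 2 * a) \<le> real (n - m) * a" and half: "1 / 2 \<le> (1 - 2 * a) ^ m" "0 < 1 - 2 * a"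
    and hm: "(real m + 1) * h ^ m / s \<le> 1"
  shows "real (m choose l) ^ 2 / real (n choose l) * (exp ((real m + 1) * s ^ (m - l - 1)) / s ^ (l * (l - 1)))
    \<le> 2 * exp 1 * y ^ l + 2 * exp 2 * real m * y ^ (m - l)"
proof -
  define j where "j = m - l"
  have j: "1 \<le> j" "m = l + j" using l by (auto simp: j_def)
  have a0: "0 < a" "a < 1" using s m by (auto simp: a power_less_one_iff)
  have h1: "h < 1" using s h by (metis abs_of_pos abs_square_less_1)
  have y0: "0 \<le> y" using h by (simp add: y)
  \<comment> \<open>\<open>\<beta>\<close> compares the falling factorial of length \<open>l\<close>
    with the power \<open>m ^ l\<close>: it is at most 1, and close to \<open>l = m\<close> it is of
    order \<open>exp (- m)\<close> up to powers of \<open>m\<close>, by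
    \<open>fact_upper\<close>.\<close>
  define \<beta> where "\<beta> = fact m / (fact j * real m ^ l)"
  have \<beta>0: "0 \<le> \<beta>" by (simp add: \<beta>_def)
  have r: "real (m choose l) / real (n choose l) \<le> 2 * a ^ l * \<beta>"
  proof -
    have c1: "real (m choose l) = fact m / (fact l * fact j)"
      using binomial_fact[of l m, where ?'a = real] l by (simp add: j_def)
    have pos: "0 < real (n - m)" using nm half a0 m
      by (metis mult_pos_pos not_less of_nat_0_less_iff order_less_le_trans pos2 zero_less_mult_pos2 less_le_trans)
    have c2: "real (n - m) ^ l / fact l \<le> real (n choose l)" using mn l by (intro choose_ge_power_div_fact) auto
    have "real m ^ l / 2 \<le> real m ^ l * (1 - 2 * a) ^ l"
    proof -
      have "(1 - 2 * a) ^ m \<le> (1 - 2 * a) ^ l" using half a0 l by (intro power_decreasing) auto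
      then have "1 / 2 \<le> (1 - 2 * a) ^ l" using half by linarith
      then have "real m ^ l * (1 / 2) \<le> real m ^ l * (1 - 2 * a) ^ l" by (intro mult_left_mono) auto
      then show ?thesis by simp
    qed
    also have "\<dots> = (real m * (1 - 2 * a)) ^ l" by (simp add: power_mult_distrib)
    also have "\<dots> \<le> (real (n - m) * a) ^ l" using nm half by (intro power_mono) auto
    finally have c3: "real m ^ l / 2 \<le> real (n - m) ^ l * a ^ l" by (simp add: power_mult_distrib)
    have "real (m choose l) / real (n choose l) \<le> (fact m / (fact l * fact j)) / (real (n - m) ^ l / fact l)"
      unfolding c1 using c2 pos l mn by (intro divide_left_mono mult_pos_pos) auto
    also have "\<dots> = fact m / fact j * (1 / real (n - m) ^ l)" by (simp add: field_simps)
    also have "\<dots> \<le> fact m / fact j * (2 * a ^ l / real m ^ l)"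
    proof (rule mult_left_mono)
      show "1 / real (n - m) ^ l \<le> 2 * a ^ l / real m ^ l" using c3 pos m by (simp add: field_simps)
    qed simp
    also have "\<dots> = 2 * a ^ l * \<beta>" by (simp add: \<beta>_def)
    finally show ?thesis .
  qed
  \<comment> \<open>The factor \<open>a ^ l\<close> gained from the binomials cancels the loss
    \<open>1 / s ^ (l * (l - 1))\<close> from shared pairs exactly and leaves
    \<open>s ^ (l * j)\<close>. This cancellation is where \<open>s = t\<close> enters.\<close>
  have pw: "a ^ l = s ^ (l * (l - 1)) * s ^ (l * j)"
  proof -
    have "(m - 1) * l = l * (l - 1) + l * j"
      using j by (cases l) (auto simp: algebra_simps)
    then show ?thesis unfolding a power_mult[symmetric] power_add[symmetric] by simp
  qed
  let ?e = "exp ((real m + 1) * s ^ (m - l - 1))"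
  have "real (m choose l) ^ 2 / real (n choose l) * (?e / s ^ (l * (l - 1))) =
      (real (m choose l) * ?e / s ^ (l * (l - 1))) * (real (m choose l) / real (n choose l))"
    by (simp add: power2_eq_square mult_ac)
  also have "\<dots> \<le> (real (m choose l) * ?e / s ^ (l * (l - 1))) * (2 * a ^ l * \<beta>)"
    using r s by (intro mult_left_mono) auto
  also have "\<dots> = 2 * real (m choose l) * \<beta> * s ^ (l * j) * ?e" using s by (simp add: pw)
  also have "\<dots> \<le> 2 * exp 1 * y ^ l + 2 * exp 2 * real m * y ^ j"
  proof (cases "2 * l \<le> m")
    case True
    have "\<beta> \<le> 1"
    proof -
      have "real (fact m) \<le> real (fact (m - l) * m ^ l)"
        using fact_le_fact_mult_power[of l m] l by (simp only: of_nat_le_iff less_imp_le)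
      then show ?thesis unfolding \<beta>_def j_def using m by (simp add: divide_le_eq)
    qed
    moreover have "s ^ (l * j) \<le> (h ^ m) ^ l"
    proof -
      have "s ^ (l * j) = h ^ (2 * (l * j))" unfolding h(2) by (simp add: power_mult)
      also have "\<dots> \<le> h ^ (m * l)"
      proof (rule power_decreasing)
        have "m * l \<le> (2 * j) * l" using True j by (intro mult_le_mono1) auto
        then show "m * l \<le> 2 * (l * j)" by (simp add: mult_ac)
      qed (use h h1 in auto)
      finally show ?thesis by (simp add: power_mult)
    qed
    moreover have "?e \<le> exp 1"
    proof -
      have "s ^ (m - l - 1) * s = s ^ j"
        using j by (metis Suc_diff_1 j_def less_le_trans power_Suc2 zero_less_one)
      also have "\<dots> = h ^ (2 * j)" unfolding h(2) by (simp add: power_mult)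
      also have "\<dots> \<le> h ^ m" using True j h h1 by (intro power_decreasing) auto
      finally have "s ^ (m - l - 1) \<le> h ^ m / s" using s by (simp add: field_simps)
      then have "(real m + 1) * s ^ (m - l - 1) \<le> (real m + 1) * (h ^ m / s)" by (intro mult_left_mono) auto
      then show ?thesis using hm by simp
    qed
    moreover have "real (m choose l) \<le> real m ^ l" by (rule binomial_le_power_real)
    ultimately have "2 * real (m choose l) * \<beta> * s ^ (l * j) * ?e \<le> 2 * real m ^ l * 1 * (h ^ m) ^ l * exp 1"
      using \<beta>0 s h by (intro mult_mono) auto
    also have "\<dots> = 2 * exp 1 * (real m * h ^ m) ^ l" by (simp add: power_mult_distrib)
    also have "\<dots> \<le> 2 * exp 1 * y ^ l"
    proof (intro mult_left_mono power_mono)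
      have "real m * 1 \<le> real m * real m" using m by (intro mult_left_mono) auto
      then show "real m * h ^ m \<le> y" unfolding y using h by (intro mult_right_mono) (auto simp: power2_eq_square)
    qed (use h in auto)
    also have "\<dots> \<le> 2 * exp 1 * y ^ l + 2 * exp 2 * real m * y ^ j" using y0 by simp
    finally show ?thesis .
  next
    case False
    have "\<beta> \<le> exp 1 * real m * exp (- real m) * real m ^ j"
    proof -
      have f: "fact m \<le> real m ^ m * exp (1 - real m) * real m" using fact_upper[of "m - 1"] m by simp
      have "\<beta> \<le> fact m / (1 * real m ^ l)" unfolding \<beta>_def using m fact_ge_1[of j, where ?'a = real]
        by (intro divide_left_mono mult_right_mono mult_pos_pos) auto
      also have "\<dots> \<le> (real m ^ m * exp (1 - real m) * real m) / real m ^ l" using f by (simp add: divide_right_mono)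
      also have "\<dots> = exp 1 * real m * exp (- real m) * real m ^ j"
      proof -
        have "real m ^ m = real m ^ l * real m ^ j" using j(2) by (metis power_add)
        then show ?thesis using m by (simp add: exp_diff exp_minus field_simps)
      qed
      finally show ?thesis .
    qed
    moreover have "s ^ (l * j) \<le> (h ^ m) ^ j"
    proof -
      have "s ^ (l * j) = h ^ (2 * (l * j))" unfolding h(2) by (simp add: power_mult)
      also have "\<dots> \<le> h ^ (m * j)"
      proof (rule power_decreasing)
        have "m * j \<le> (2 * l) * j" using False by (intro mult_le_mono1) auto
        then show "m * j \<le> 2 * (l * j)" by (simp add: mult_ac)
      qed (use h h1 in auto)
      finally show ?thesis by (simp add: power_mult)
    qed
    moreover have "?e \<le> exp (real m + 1)"
      using s by (simp add: mult_left_le power_le_one)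
    moreover have "real (m choose l) \<le> real m ^ j"
    proof -
      have "m choose l = m choose j" using l unfolding j_def by (intro binomial_symmetric) simp
      then show ?thesis using binomial_le_power_real[of m j] by simp
    qed
    ultimately have "2 * real (m choose l) * \<beta> * s ^ (l * j) * ?e \<le>
        2 * real m ^ j * (exp 1 * real m * exp (- real m) * real m ^ j) * (h ^ m) ^ j * exp (real m + 1)"
      using \<beta>0 s h by (intro mult_mono) auto
    also have "\<dots> = 2 * (exp 1 * exp (- real m) * exp (real m + 1)) * real m * (real m ^ 2 * h ^ m) ^ j"
      by (simp add: power_mult_distrib power2_eq_square mult_ac)
    also have "exp 1 * exp (- real m) * exp (real m + 1) = exp 2" by (simp flip: exp_add)
    also have "2 * exp 2 * real m * (real m ^ 2 * h ^ m) ^ j \<le> 2 * exp 1 * y ^ l + 2 * exp 2 * real m * y ^ j"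
      unfolding y[symmetric] using y0 by simp
    finally show ?thesis .
  qed
  finally show ?thesis by (simp add: j_def)
qed

context edge_probability
begin

text \<open>The choice of \<open>n\<close> makes \<open>n * s ^ (m - 1) / m\<close> as close to 1 as
  rounding allows. Then the expected number \<open>Z\<close> of configurations is bounded below, and
  each row of the second moment is at most \<open>R\<close> times \<open>Z * \<mu>\<close>, so
  \<open>1 / R\<close> bounds the probability. The smallness hypotheses hold for all large
  \<open>m\<close>.\<close>

lemma crit_lower_bound:
  fixes m n :: nat and b :: bool
  defines "s \<equiv> bp p (\<not> b)"
  defines "a \<equiv> s ^ (m - 1)" and "h \<equiv> sqrt s"
  defines "n \<equiv> nat \<lfloor>real m / a\<rfloor>" and "y \<equiv> real m ^ 2 * h ^ m"
  assumes crit: "bp p b = s\<^sup>2" and m: "2 \<le> m" and ma: "4 * real m * a \<le> 1"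
    and hm: "(real m + 1) * h ^ m / s \<le> 1" and y2: "y \<le> 1 / 2" and my: "real m * y \<le> 1"
  shows "1 / (2 * (4 * exp 1 + 4 * exp 2) + (1 + 2 * exp 2 / (1 - s)) * (2 * exp 2)) \<le> Pr n (crit b {1..n})"
proof -
  have s: "0 < s" "s < 1" using bp_pos bp_less_1 by (auto simp: s_def)
  have a: "0 < a" using s by (simp add: a_def)
  have h: "0 < h" "s = h\<^sup>2" using s by (auto simp: h_def)
  have y0: "0 \<le> y" using h by (simp add: y_def)
  have m': "2 \<le> real m" using m by simp
  have a8: "8 * a \<le> 1" using ma m' a mult_right_mono[of 2 "real m" "4 * a"] by linarith
  have na1: "real n * a \<le> real m"
  proof -
    have "real n \<le> real m / a" using a by (simp add: n_def of_nat_floor)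
    then show ?thesis using a by (simp add: field_simps)
  qed
  have na2: "real m - a \<le> real n * a"
  proof -
    have "real m / a - 1 \<le> real n" unfolding n_def by linarith
    then have "(real m / a - 1) * a \<le> real n * a" using a by (intro mult_right_mono) auto
    then show ?thesis using a by (simp add: left_diff_distrib)
  qed
  have mn: "2 * m \<le> n"
  proof -
    have "real m * (8 * a) \<le> real m * 1" using a8 by (intro mult_left_mono) auto
    moreover have "a \<le> real m * a" using a m' by simp
    moreover have "0 < real m * a" using a m' by simp
    ultimately have "2 * real m * a < real n * a" using na2 by linarith
    then have "2 * real m < real n" using a by simp
    then show ?thesis by linarith
  qed
  have nmr: "real (n - m) = real n - real m" using mn by (simp add: of_nat_diff)
  have nm: "real m * (1 - 2 * a) \<le> real (n - m) * a"
  proof -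
    have "a \<le> real m * a" using a m' by simp
    then show ?thesis using na2 unfolding nmr by (simp add: algebra_simps)
  qed
  have half1: "1 / 2 \<le> (1 - 2 * a) ^ m"
  proof -
    have "1 + real m * (- (2 * a)) \<le> (1 + - (2 * a)) ^ m" by (rule Bernoulli_inequality) (use a8 in simp)
    then show ?thesis using ma by (simp add: algebra_simps)
  qed
  have half2: "0 < 1 - 2 * a" "0 < 1 - a" using a8 a by auto
  define \<mu> N \<kappa> where "\<mu> = bp p b ^ (m choose 2) * (1 - a) ^ (n - m)" and "N = real (n choose m)"
    and "\<kappa> = 1 / (1 - a) ^ (2 * m)"
  have qm: "bp p b ^ (m choose 2) = a ^ m"
  proof -
    have "s ^ (m * (m - 1)) = a ^ m" unfolding a_def by (simp add: power_mult[symmetric] mult.commute)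
    then show ?thesis unfolding crit choose_two_square .
  qed
  have ql: "bp p b ^ (l choose 2) = s ^ (l * (l - 1))" for l unfolding crit choose_two_square ..
  have \<mu>0: "0 < \<mu>" using a half2 by (simp add: \<mu>_def qm)
  have N0: "0 < N" using mn by (simp add: N_def)
  have \<kappa>: "0 < \<kappa>" "\<kappa> \<le> 2"
  proof -
    have "1 - 2 * a \<le> (1 - a)\<^sup>2" by (simp add: power2_eq_square algebra_simps)
    then have "(1 - 2 * a) ^ m \<le> ((1 - a)\<^sup>2) ^ m" using half2 by (intro power_mono) auto
    then have "1 / 2 \<le> (1 - a) ^ (2 * m)" using half1 by (simp add: power_mult)
    then show "\<kappa> \<le> 2" using half2 by (simp add: \<kappa>_def field_simps)
    show "0 < \<kappa>" using half2 by (simp add: \<kappa>_def)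
  qed
  define Z where "Z = real m * N * \<mu>"
  have Zpos: "0 < Z" using m N0 \<mu>0 by (simp add: Z_def)
  have Z: "1 / (2 * exp 2) \<le> Z"
  proof -
    have "(real m * (1 - 2 * a)) ^ m \<le> (real (n - m) * a) ^ m" using nm half2 by (intro power_mono) auto
    then have "real m ^ m * (1 - 2 * a) ^ m \<le> real (n - m) ^ m * a ^ m" by (simp add: power_mult_distrib)
    moreover have "real m ^ m * (1 / 2) \<le> real m ^ m * (1 - 2 * a) ^ m" using half1 by (intro mult_left_mono) auto
    ultimately have c1: "real m ^ m / 2 \<le> real (n - m) ^ m * a ^ m" by linarith
    have "real (n - m) ^ m / fact m \<le> N" unfolding N_def using mn by (intro choose_ge_power_div_fact) auto
    then have "real (n - m) ^ m / fact m * a ^ m \<le> N * a ^ m" using a by (intro mult_right_mono) auto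
    moreover have "real m ^ m / 2 / fact m \<le> real (n - m) ^ m * a ^ m / fact m"
      using c1 by (rule divide_right_mono) simp
    ultimately have c2: "real m ^ m / (2 * fact m) \<le> N * a ^ m" by (simp add: field_simps)
    have c3: "exp (- real m - 1) \<le> (1 - a) ^ (n - m)"
    proof -
      have "1 / (1 - a) \<le> exp (a / (1 - a))" using exp_ge_add_one_self[of "a / (1 - a)"] half2 by (simp add: field_simps)
      then have "exp (- (a / (1 - a))) \<le> 1 - a" using half2 by (simp add: exp_minus field_simps)
      then have "exp (- (a / (1 - a))) ^ (n - m) \<le> (1 - a) ^ (n - m)" by (intro power_mono) auto
      moreover have "exp (- (a / (1 - a))) ^ (n - m) = exp (- (real (n - m) * (a / (1 - a))))"
        by (simp add: exp_of_nat_mult[symmetric])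
      moreover have "real (n - m) * (a / (1 - a)) \<le> real m + 1"
      proof -
        have "real (n - m) * a \<le> real n * a" using a by (intro mult_right_mono) auto
        also have "\<dots> \<le> real m" by (rule na1)
        also have "\<dots> \<le> (real m + 1) * (1 - a)"
        proof -
          have "(real m + 1) * (1 - a) = real m + 1 - real m * a - a" by (simp add: algebra_simps)
          then show ?thesis using ma a8 a by linarith
        qed
        finally have "real (n - m) * a / (1 - a) \<le> real m + 1" using half2 by (simp only: pos_divide_le_eq)
        then show ?thesis by simp
      qed
      moreover have "exp (- real m - 1) \<le> exp (- (real (n - m) * (a / (1 - a))))"
        using calculation(3) by simp
      ultimately show ?thesis by linarith
    qed
    have f: "fact m \<le> real m ^ m * exp (1 - real m) * real m" using fact_upper[of "m - 1"] m by simp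
    have "exp (- real m - 1) * exp (real m - 1) = exp (- 2)" by (simp flip: exp_add)
    also have "\<dots> = 1 / exp 2" by (simp add: exp_minus inverse_eq_divide)
    finally have "1 / (2 * exp 2) = exp (- real m - 1) * (exp (real m - 1) / 2)" by simp
    also have "\<dots> \<le> exp (- real m - 1) * (real m * (real m ^ m / (2 * fact m)))"
    proof (rule mult_left_mono)
      have "fact m * exp (real m - 1) \<le> (real m ^ m * exp (1 - real m) * real m) * exp (real m - 1)"
        using f by (intro mult_right_mono) auto
      also have "\<dots> = real m ^ m * real m * (exp (1 - real m) * exp (real m - 1))" by (simp only: mult_ac)
      also have "exp (1 - real m) * exp (real m - 1) = 1" by (simp flip: exp_add)
      finally have "fact m * exp (real m - 1) \<le> real m ^ m * real m" by simp
      then show "exp (real m - 1) / 2 \<le> real m * (real m ^ m / (2 * fact m))" by (simp add: field_simps)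
    qed simp
    also have "\<dots> \<le> (1 - a) ^ (n - m) * (real m * (N * a ^ m))"
      using c2 c3 m N0 a half2 by (intro mult_mono mult_left_mono) auto
    also have "\<dots> = Z" by (simp add: Z_def \<mu>_def qm mult_ac)
    finally show ?thesis .
  qed
  \<comment> \<open>This controls the up to \<open>m\<close> configurations on the same set
    \<open>A\<close> with another marked vertex: \<open>(1 - a) ^ (n - m)\<close> is of order
    \<open>exp (- m)\<close> and beats the correlation \<open>exp ((m + 1) * s)\<close> because
    \<open>s < 1\<close>.\<close>
  have tail: "real m * (1 - a) ^ (n - m) * exp ((real m + 1) * s) \<le> exp 2 / (1 - s)"
  proof -
    have "(1 - a) ^ (n - m) \<le> exp (- a) ^ (n - m)"
      using exp_ge_add_one_self[of "- a"] half2 by (intro power_mono) auto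
    also have "\<dots> = exp (- (real (n - m) * a))" by (simp add: exp_of_nat_mult[symmetric])
    also have "\<dots> \<le> exp (1 / 2 - real m)"
    proof -
      have "real m * (1 - 2 * a) = real m - 2 * (real m * a)" by (simp add: algebra_simps)
      then have "- (real (n - m) * a) \<le> 1 / 2 - real m" using nm ma by linarith
      then show ?thesis by (simp only: exp_le_cancel_iff)
    qed
    finally have "real m * (1 - a) ^ (n - m) * exp ((real m + 1) * s) \<le> real m * exp (1 / 2 - real m) * exp ((real m + 1) * s)"
      by (intro mult_right_mono mult_left_mono) auto
    also have "\<dots> = real m * exp (1 / 2 + s - (1 - s) * real m)" by (simp add: algebra_simps flip: exp_add)
    also have "\<dots> \<le> real m * exp (2 - (1 - s) * real m)" using s by (intro mult_left_mono) auto
    also have "exp (2 - (1 - s) * real m) = exp 2 * exp (- ((1 - s) * real m))"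
      unfolding exp_add[symmetric] by simp
    also have "real m * (exp 2 * exp (- ((1 - s) * real m))) = exp 2 * (real m * exp (- ((1 - s) * real m)))"
      by (simp only: mult_ac)
    also have "\<dots> \<le> exp 2 * (1 / (1 - s))"
    proof (rule mult_left_mono)
      have "(1 - s) * real m \<le> exp ((1 - s) * real m)" using exp_ge_add_one_self[of "(1 - s) * real m"] by linarith
      then have "((1 - s) * real m) * exp (- ((1 - s) * real m)) \<le> exp ((1 - s) * real m) * exp (- ((1 - s) * real m))"
        by (intro mult_right_mono) auto
      also have "\<dots> = 1" unfolding exp_add[symmetric] by simp
      finally have "(real m * exp (- ((1 - s) * real m))) * (1 - s) \<le> 1" by (simp only: mult_ac)
      then show "real m * exp (- ((1 - s) * real m)) \<le> 1 / (1 - s)" using s by (simp only: pos_le_divide_eq diff_gt_0_iff_gt)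
    qed simp
    finally show ?thesis by simp
  qed
  (* Overlapping pairs: given (A, v), the pairs (B, w) with |A \<inter> B| = l contribute F l at most. *)
  define f where "f l = exp ((real m + 1) * s ^ (m - l - 1)) / s ^ (l * (l - 1))" for l
  define G where "G = \<mu> + real m * \<mu>\<^sup>2 * \<kappa> * (exp ((real m + 1) * s) / a ^ m)"
  define F where "F l = (if l = m then G else real m * \<mu>\<^sup>2 * \<kappa> * f l)" for l
  have F0: "0 \<le> F l" for l using \<mu>0 \<kappa> s a by (simp add: F_def G_def f_def)
  let ?I = "{A. A \<subseteq> {1..n} \<and> card A = m}"
  let ?Q = "\<lambda>i j. Pr n (\<lambda>E. conf_event n b i E \<and> conf_event n b j E)"
  \<comment> \<open>\<open>d\<close> is the excess of the union over \<open>m - 1\<close>; since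
    \<open>n * a \<le> m\<close>, the exponent is about \<open>m * s ^ d\<close>, and the step from
    \<open>m\<close> to \<open>m + 1\<close> absorbs the division by
    \<open>(1 - a)\<^sup>2\<close>.\<close>
  have hU: "exp (real n * s ^ U / (1 - a)\<^sup>2) \<le> exp ((real m + 1) * s ^ d)" if U: "m - 1 + d \<le> U" for U d
  proof -
    have "s ^ U \<le> s ^ (m - 1 + d)" using U s by (intro power_decreasing) auto
    also have "\<dots> = a * s ^ d" by (simp add: a_def power_add)
    finally have "real n * s ^ U \<le> real n * (a * s ^ d)" by (intro mult_left_mono) auto
    also have "\<dots> \<le> real m * s ^ d" using na1 s mult_right_mono[OF na1, of "s ^ d"] by (simp add: mult_ac)
    also have "\<dots> \<le> ((real m + 1) * (1 - a)\<^sup>2) * s ^ d"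
    proof (rule mult_right_mono)
      have "(real m + 1) * (1 - 2 * a) \<le> (real m + 1) * (1 - a)\<^sup>2"
        by (intro mult_left_mono) (auto simp: power2_eq_square algebra_simps)
      then show "real m \<le> (real m + 1) * (1 - a)\<^sup>2" using ma a8 a by (simp add: algebra_simps)
    qed (use s in auto)
    finally have "real n * s ^ U / (1 - a)\<^sup>2 \<le> (real m + 1) * s ^ d" using half2 by (simp add: field_simps)
    then show ?thesis by simp
  qed
  have Qle: "?Q (A, v) (B, w) \<le> \<mu>\<^sup>2 * \<kappa> * (exp ((real m + 1) * s ^ d) / s ^ (card (A \<inter> B) * (card (A \<inter> B) - 1)))"
    if A: "(A, v) \<in> conf n m" and B: "(B, w) \<in> conf n m" and d: "m - 1 + d \<le> card ((A - {v}) \<union> (B - {w}))" for A v B w d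
  proof -
    have "?Q (A, v) (B, w) \<le> \<mu>\<^sup>2 * \<kappa> * (exp (real n * s ^ card ((A - {v}) \<union> (B - {w})) / (1 - a)\<^sup>2) /
        s ^ (card (A \<inter> B) * (card (A \<inter> B) - 1)))"
      using pr_two_conf_events[OF A B mn m, of b] unfolding s_def[symmetric]
      unfolding a_def[symmetric] unfolding \<mu>_def[symmetric] \<kappa>_def[symmetric] unfolding ql .
    also have "\<dots> \<le> \<mu>\<^sup>2 * \<kappa> * (exp ((real m + 1) * s ^ d) / s ^ (card (A \<inter> B) * (card (A \<inter> B) - 1)))"
      using hU[OF d] \<kappa> s by (intro mult_left_mono divide_right_mono) auto
    finally show ?thesis .
  qed
  have inner: "(\<Sum>w\<in>B. ?Q (A, v) (B, w)) \<le> F (card (A \<inter> B))" if A: "(A, v) \<in> conf n m" and B: "B \<in> ?I" for A v B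
  proof -
    have A': "A \<subseteq> {1..n}" "card A = m" "v \<in> A" using A by (auto simp: conf_def)
    have fin: "finite A" "finite B" using A'(1) B by (auto intro: finite_subset)
    have Bw: "(B, w) \<in> conf n m" if "w \<in> B" for w using B that by (simp add: conf_def)
    show ?thesis
    proof (cases "A = B")
      case True
      have "(\<Sum>w\<in>B. ?Q (A, v) (B, w)) = ?Q (A, v) (B, v) + (\<Sum>w\<in>B - {v}. ?Q (A, v) (B, w))"
        using fin A' True by (subst sum.remove[of B v]) auto
      also have "?Q (A, v) (B, v) = \<mu>"
        using pr_conf_event[OF A, of b] True unfolding s_def[symmetric] a_def[symmetric] \<mu>_def by simp
      also have "(\<Sum>w\<in>B - {v}. ?Q (A, v) (B, w)) \<le> (\<Sum>w\<in>B - {v}. \<mu>\<^sup>2 * \<kappa> * (exp ((real m + 1) * s) / a ^ m))"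
      proof (rule sum_mono)
        fix w assume w: "w \<in> B - {v}"
        \<comment> \<open>Two different marked vertices in the same set: the union is one larger
          than each part, so the excess is \<open>d = 1\<close>.\<close>
        have "(A - {v}) \<union> (B - {w}) = A" using w True by blast
        then have "m - 1 + 1 \<le> card ((A - {v}) \<union> (B - {w}))" using A' m by simp
        from Qle[OF A Bw[of w] this] w have "?Q (A, v) (B, w) \<le>
            \<mu>\<^sup>2 * \<kappa> * (exp ((real m + 1) * s ^ 1) / s ^ (card (A \<inter> B) * (card (A \<inter> B) - 1)))" by simp
        moreover have "s ^ (card (A \<inter> B) * (card (A \<inter> B) - 1)) = a ^ m"
          using True A' ql[of m] qm by simp
        ultimately show "?Q (A, v) (B, w) \<le> \<mu>\<^sup>2 * \<kappa> * (exp ((real m + 1) * s) / a ^ m)" by simp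
      qed
      also have "\<dots> \<le> real m * (\<mu>\<^sup>2 * \<kappa> * (exp ((real m + 1) * s) / a ^ m))"
      proof -
        have "real (card (B - {v})) \<le> real m" using A' True fin by simp
        then show ?thesis unfolding sum_constant using \<mu>0 \<kappa> a by (intro mult_right_mono) auto
      qed
      finally show ?thesis using True A' by (simp add: F_def G_def mult_ac)
    next
      case False
      define l where "l = card (A \<inter> B)"
      have lm: "l < m"
      proof (rule ccontr)
        assume "\<not> l < m"
        then have c: "card A \<le> card (A \<inter> B)" "card B \<le> card (A \<inter> B)" using A' B by (simp_all add: l_def)
        have "A \<inter> B = A" by (rule card_seteq[OF fin(1) Int_lower1 c(1)])
        moreover have "A \<inter> B = B" by (rule card_seteq[OF fin(2) Int_lower2 c(2)])
        ultimately show False using False by simp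
      qed
      have "(\<Sum>w\<in>B. ?Q (A, v) (B, w)) \<le> (\<Sum>w\<in>B. \<mu>\<^sup>2 * \<kappa> * f l)"
      proof (rule sum_mono)
        fix w assume w: "w \<in> B"
        have "card ((A - {v}) \<union> (B - {w})) + card ((A - {v}) \<inter> (B - {w})) = (m - 1) + (m - 1)"
          using card_Un_Int[of "A - {v}" "B - {w}"] fin A' B w by simp
        moreover have "card ((A - {v}) \<inter> (B - {w})) \<le> l"
          unfolding l_def using fin by (intro card_mono) auto
        \<comment> \<open>Two sets of size \<open>m - 1\<close> with at most \<open>l\<close> common
          elements; this is the exponent \<open>d\<close> built into \<open>f\<close>.\<close>
        ultimately have "m - 1 + (m - l - 1) \<le> card ((A - {v}) \<union> (B - {w}))" using lm by linarith
        from Qle[OF A Bw[OF w] this] show "?Q (A, v) (B, w) \<le> \<mu>\<^sup>2 * \<kappa> * f l" unfolding f_def l_def .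
      qed
      then show ?thesis using lm B by (simp add: F_def l_def mult_ac)
    qed
  qed
  define T where "T = (\<Sum>l<m. real (m choose l) ^ 2 / real (n choose l) * f l)"
  have Tle: "T \<le> 4 * exp 1 + 4 * exp 2"
  proof -
    have "T \<le> (\<Sum>l<m. 2 * exp 1 * y ^ l + 2 * exp 2 * real m * y ^ (m - l))"
      unfolding T_def f_def
      by (intro sum_mono critical_overlap_term[OF s meta_eq_to_obj_eq[OF a_def] h meta_eq_to_obj_eq[OF y_def] m _ _ nm half1 half2(1) hm]) (use mn in auto)
    also have "\<dots> = 2 * exp 1 * (\<Sum>l<m. y ^ l) + 2 * exp 2 * real m * (\<Sum>l<m. y ^ (m - l))"
      by (simp add: sum.distrib sum_distrib_left)
    also have "\<dots> \<le> 2 * exp 1 * 2 + 2 * exp 2 * real m * (2 * y)"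
    proof (intro add_mono mult_left_mono)
      have geo: "(\<Sum>l\<le>m. y ^ l) \<le> 2"
      proof -
        have "(\<Sum>l\<le>m. y ^ l) \<le> 1 / (1 - y)" using y0 y2 by (intro sum_power_le_geometric) auto
        also have "\<dots> \<le> 2" using y2 by (simp add: field_simps)
        finally show ?thesis .
      qed
      have lt: "(\<Sum>l<m. y ^ l) \<le> (\<Sum>l\<le>m. y ^ l)" using y0 by (intro sum_mono2) auto
      then show "(\<Sum>l<m. y ^ l) \<le> 2" using geo by linarith
      have "(\<Sum>l<m. y ^ (m - l)) = (\<Sum>l<m. y ^ Suc l)"
        by (rule sum.reindex_bij_witness[of _ "\<lambda>l. m - Suc l" "\<lambda>l. m - Suc l"])
          (auto simp: Suc_diff_Suc simp flip: power_Suc)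
      also have "\<dots> = y * (\<Sum>l<m. y ^ l)" by (simp add: sum_distrib_left)
      also have "\<dots> \<le> y * 2" using y0 lt geo by (intro mult_left_mono) auto
      finally show "(\<Sum>l<m. y ^ (m - l)) \<le> 2 * y" by simp
    qed auto
    also have "\<dots> = 4 * exp 1 + 4 * exp 2 * (real m * y)" by simp
    also have "\<dots> \<le> 4 * exp 1 + 4 * exp 2 * 1" using my by (intro add_left_mono mult_left_mono) auto
    finally show ?thesis by simp
  qed
  \<comment> \<open>The first summand bounds \<open>\<kappa> * T\<close> by means of
    \<open>\<kappa> \<le> 2\<close>. The second comes from \<open>B = A\<close>: \<open>G\<close> is
    at most \<open>\<mu> * (1 + 2 * exp 2 / (1 - s))\<close>, and
    \<open>1 \<le> Z * (2 * exp 2)\<close> brings it to the common form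
    \<open>Z * \<mu>\<close>.\<close>
  define R where "R = 2 * (4 * exp 1 + 4 * exp 2) + (1 + 2 * exp 2 / (1 - s)) * (2 * exp 2)"
  have Rpos: "0 < R" using s by (simp add: R_def add_pos_pos)
  have row: "(\<Sum>j\<in>conf n m. ?Q i j) \<le> Z * \<mu> * R" if i: "i \<in> conf n m" for i
  proof -
    obtain A v where Av: "i = (A, v)" "A \<subseteq> {1..n}" "card A = m" using i unfolding conf_def by auto
    have iA: "(A, v) \<in> conf n m" using i Av by simp
    have "(\<Sum>j\<in>conf n m. ?Q i j) = (\<Sum>B\<in>?I. \<Sum>w\<in>B. ?Q i (B, w))"
      unfolding conf_def by (subst sum.Sigma) (use finite_subsets_of_card finite_subset[of _ "{1..n}"] in auto)
    also have "\<dots> \<le> (\<Sum>B\<in>?I. F (card (A \<inter> B)))"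
      unfolding Av(1) by (intro sum_mono inner[OF iA])
    also have "\<dots> \<le> real (n choose m) * (\<Sum>l\<le>m. real (m choose l) ^ 2 / real (n choose l) * F l)"
      by (rule sum_over_subsets_by_intersection) (use Av F0 in auto)
    also have "(\<Sum>l\<le>m. real (m choose l) ^ 2 / real (n choose l) * F l) = G / N + real m * \<mu>\<^sup>2 * \<kappa> * T"
    proof -
      have "{..m} = insert m {..<m}" by auto
      then have "(\<Sum>l\<le>m. real (m choose l) ^ 2 / real (n choose l) * F l) =
          real (m choose m) ^ 2 / real (n choose m) * F m + (\<Sum>l<m. real (m choose l) ^ 2 / real (n choose l) * F l)" by simp
      also have "(\<Sum>l<m. real (m choose l) ^ 2 / real (n choose l) * F l) = real m * \<mu>\<^sup>2 * \<kappa> * T"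
        unfolding T_def sum_distrib_left by (intro sum.cong) (auto simp: F_def)
      finally show ?thesis by (simp add: F_def N_def)
    qed
    also have "real (n choose m) * (G / N + real m * \<mu>\<^sup>2 * \<kappa> * T) = G + Z * \<mu> * (\<kappa> * T)"
      using N0 unfolding N_def[symmetric] Z_def by (simp add: distrib_left power2_eq_square mult_ac)
    also have "\<dots> \<le> Z * \<mu> * ((1 + 2 * exp 2 / (1 - s)) * (2 * exp 2)) + Z * \<mu> * (2 * (4 * exp 1 + 4 * exp 2))"
    proof (rule add_mono)
      have "G = \<mu> * (1 + \<kappa> * (real m * (1 - a) ^ (n - m) * exp ((real m + 1) * s)))"
        unfolding G_def using a by (simp add: \<mu>_def qm power2_eq_square field_simps)
      also have "\<dots> \<le> \<mu> * (1 + 2 * (exp 2 / (1 - s)))"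
        using \<mu>0 \<kappa> tail half2 s by (intro mult_left_mono add_left_mono mult_mono) auto
      also have "\<dots> = \<mu> * (1 + 2 * exp 2 / (1 - s)) * 1" by simp
      also have "\<dots> \<le> \<mu> * (1 + 2 * exp 2 / (1 - s)) * (Z * (2 * exp 2))"
      proof (rule mult_left_mono)
        show "1 \<le> Z * (2 * exp 2)" using Z by (simp add: field_simps)
        show "0 \<le> \<mu> * (1 + 2 * exp 2 / (1 - s))" using \<mu>0 s by simp
      qed
      finally show "G \<le> Z * \<mu> * ((1 + 2 * exp 2 / (1 - s)) * (2 * exp 2))" by (simp only: mult_ac)
      have T0: "0 \<le> T" unfolding T_def f_def using s by (intro sum_nonneg) auto
      show "Z * \<mu> * (\<kappa> * T) \<le> Z * \<mu> * (2 * (4 * exp 1 + 4 * exp 2))"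
        using Zpos \<mu>0 \<kappa> Tle T0 by (intro mult_left_mono mult_mono) auto
    qed
    also have "\<dots> = Z * \<mu> * R" by (simp add: R_def algebra_simps)
    finally show ?thesis .
  qed
  have cardC: "real (card (conf n m)) * \<mu> = Z" by (simp add: card_conf Z_def N_def)
  have first: "(\<Sum>i\<in>conf n m. Pr n (conf_event n b i)) = Z"
  proof -
    have "(\<Sum>i\<in>conf n m. Pr n (conf_event n b i)) = (\<Sum>i\<in>conf n m. \<mu>)"
      unfolding \<mu>_def a_def s_def by (intro sum.cong refl pr_conf_event)
    then show ?thesis using cardC by simp
  qed
  have "(\<Sum>i\<in>conf n m. \<Sum>j\<in>conf n m. ?Q i j) \<le> (\<Sum>i\<in>conf n m. Z * \<mu> * R)" by (intro sum_mono row)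
  also have "\<dots> = Z\<^sup>2 * R" by (simp add: cardC[symmetric] power2_eq_square)
  finally have second: "(\<Sum>i\<in>conf n m. \<Sum>j\<in>conf n m. ?Q i j) \<le> Z\<^sup>2 * R" .
  let ?P = "Pr n (\<lambda>E. \<exists>i\<in>conf n m. conf_event n b i E)"
  have "Z\<^sup>2 \<le> ?P * (\<Sum>i\<in>conf n m. \<Sum>j\<in>conf n m. ?Q i j)"
    unfolding first[symmetric] by (rule second_moment) (auto simp: finite_conf)
  also have "\<dots> \<le> ?P * (Z\<^sup>2 * R)" by (intro mult_left_mono second pr_nonneg)
  finally have "Z\<^sup>2 * 1 \<le> Z\<^sup>2 * (?P * R)" by (simp add: mult_ac)
  then have "1 \<le> ?P * R" using Zpos by (subst (asm) mult_le_cancel_left_pos) auto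
  then have "1 / R \<le> ?P" using Rpos by (simp add: field_simps)
  also have "\<dots> \<le> Pr n (crit b {1..n})"
  proof (rule pr_mono)
    fix E assume "\<exists>i\<in>conf n m. conf_event n b i E"
    then have "\<exists>m\<in>{2..n}. \<exists>i\<in>conf n m. conf_event n b i E" using m mn by (intro bexI[of _ m]) auto
    then show "crit b {1..n} E" unfolding crit_iff_conf .
  qed simp
  finally show ?thesis unfolding R_def .
qed

end

section \<open>The function \<open>x * exp (1 - x)\<close> and upper bounds at the golden
  ratio\<close>

lemma bump_mono_left:
  fixes x \<eta> :: real
  assumes "0 \<le> x" "x \<le> \<eta>" "\<eta> \<le> 1" "0 < \<eta>"
  shows "x * exp (1 - x) \<le> \<eta> * exp (1 - \<eta>)"
proof -
  have "x * (1 - \<eta>) \<le> \<eta> * (1 - \<eta>)" using assms by (intro mult_right_mono) auto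
  then have "x \<le> \<eta> * (1 + (x - \<eta>))" by (simp add: algebra_simps)
  also have "\<dots> \<le> \<eta> * exp (x - \<eta>)" using assms by (intro mult_left_mono exp_ge_add_one_self) auto
  finally have "x * exp (1 - x) \<le> \<eta> * exp (x - \<eta>) * exp (1 - x)" by (intro mult_right_mono) auto
  also have "\<dots> = \<eta> * exp (1 - \<eta>)" by (simp add: mult.assoc flip: exp_add)
  finally show ?thesis .
qed

lemma bump_mono_right:
  fixes x c :: real
  assumes "1 \<le> c" "c \<le> x"
  shows "x * exp (1 - x) \<le> c * exp (1 - c)"
proof -
  have "(c - 1) * c \<le> (c - 1) * x" using assms by (intro mult_left_mono) auto
  then have "x \<le> c * (1 + (x - c))" by (simp add: algebra_simps)
  also have "\<dots> \<le> c * exp (x - c)" using assms by (intro mult_left_mono exp_ge_add_one_self) auto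
  finally have "x * exp (1 - x) \<le> c * exp (x - c) * exp (1 - x)" by (intro mult_right_mono) auto
  also have "\<dots> = c * exp (1 - c)" by (simp add: mult.assoc flip: exp_add)
  finally show ?thesis .
qed

text \<open>The inequality \<open>1 + u \<le> exp u\<close> is squared at
  \<open>u = (x - 1) / 2\<close>; the surplus \<open>(x - 1)\<^sup>2 / 4\<close> over the tangent
  line gives strictness.\<close>

lemma bump_less_1:
  fixes x :: real
  assumes "0 < x" "x \<noteq> 1"
  shows "x * exp (1 - x) < 1"
proof -
  have "0 \<le> 1 + (x - 1) / 2" using assms by (simp add: field_simps)
  then have "(1 + (x - 1) / 2)\<^sup>2 \<le> (exp ((x - 1) / 2))\<^sup>2"
    by (rule power_mono[OF exp_ge_add_one_self])
  also have "\<dots> = exp (x - 1)" by (simp add: power2_eq_square flip: exp_add)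
  finally have "x + (x - 1)\<^sup>2 / 4 \<le> exp (x - 1)" by (simp add: power2_eq_square field_simps)
  moreover have "0 < (x - 1)\<^sup>2 / 4" using assms by simp
  ultimately have "x < exp (x - 1)" by linarith
  then have "x * exp (1 - x) < exp (x - 1) * exp (1 - x)" by (intro mult_strict_right_mono) auto
  then show ?thesis by (simp flip: exp_add)
qed

text \<open>The quadratic Taylor bound for \<open>exp\<close> gives decay for large
  \<open>x\<close>, which makes sizes far below the critical one negligible.\<close>

lemma bump_le_inverse:
  fixes x :: real
  assumes "0 < x"
  shows "x * exp (1 - x) \<le> 2 * exp 1 / x"
proof -
  have "x\<^sup>2 / 2 \<le> exp x" using exp_lower_Taylor_quadratic[of x] assms by simp
  then have "x * x * exp 1 \<le> 2 * exp x * exp 1" by (simp add: power2_eq_square)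
  then show ?thesis using assms by (simp add: exp_diff field_simps)
qed

text \<open>The binomial is at most \<open>(exp 1 * n / m) ^ m\<close>, and
  \<open>(1 - a) ^ (n - m)\<close> is at most \<open>exp (m * a - n * a)\<close> with
  \<open>a = s ^ (m - 1)\<close>. The correction \<open>m * a\<close> stays below
  \<open>1 / (1 - s)\<close> for all \<open>m\<close>, and
  \<open>n * a = m * \<rho>\<close>.\<close>

lemma critical_expectation_term:
  fixes s :: real and n m :: nat
  assumes s: "0 < s" "s < 1" and m: "1 \<le> m" "m \<le> n"
  defines "\<rho> \<equiv> real n * s ^ (m - 1) / real m"
  shows "real m * real (n choose m) * (s ^ (m * (m - 1)) * (1 - s ^ (m - 1)) ^ (n - m)) \<le>
    real m * exp (1 / (1 - s)) * (\<rho> * exp (1 - \<rho>)) ^ m"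
proof -
  define a where "a = s ^ (m - 1)"
  have a: "0 < a" "a \<le> 1" using s by (auto simp: a_def power_le_one)
  have c: "real (n choose m) \<le> real n ^ m * exp (real m) / real m ^ m"
  proof -
    have "real ((n choose m) * fact m) \<le> real (n ^ m)" using binomial_fact_pow[of n m] by (simp only: of_nat_le_iff)
    then have "real (n choose m) * fact m \<le> real n ^ m" by simp
    then have "(real (n choose m) * fact m) * exp (real m) \<le> real n ^ m * exp (real m)" by (intro mult_right_mono) auto
    then have "real (n choose m) * (fact m * exp (real m)) \<le> real n ^ m * exp (real m)" by (simp only: mult.assoc)
    moreover have "real (n choose m) * real m ^ m \<le> real (n choose m) * (fact m * exp (real m))"
      using power_le_fact_exp[of m] by (intro mult_left_mono) auto
    ultimately have "real (n choose m) * real m ^ m \<le> real n ^ m * exp (real m)" by linarith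
    then show ?thesis using m by (simp add: field_simps)
  qed
  have e: "(1 - a) ^ (n - m) \<le> exp (1 / (1 - s)) * exp (- \<rho>) ^ m"
  proof -
    have "(1 - a) ^ (n - m) \<le> exp (- a) ^ (n - m)"
      using exp_ge_add_one_self[of "- a"] a by (intro power_mono) auto
    also have "\<dots> = exp (real m * a - real n * a)"
      using m by (simp add: exp_of_nat_mult[symmetric] of_nat_diff algebra_simps)
    also have "\<dots> \<le> exp (1 / (1 - s) - real n * a)"
      using mult_power_le_geometric[of s "m - 1"] s m by (simp add: a_def)
    also have "real n * a = real m * \<rho>" using m by (simp add: \<rho>_def a_def)
    also have "exp (1 / (1 - s) - real m * \<rho>) = exp (1 / (1 - s)) * exp (- \<rho>) ^ m"
      by (simp add: exp_of_nat_mult[symmetric] flip: exp_add)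
    finally show ?thesis .
  qed
  have "s ^ (m * (m - 1)) = a ^ m" unfolding a_def by (simp add: power_mult[symmetric] mult.commute)
  then have "real m * real (n choose m) * (s ^ (m * (m - 1)) * (1 - s ^ (m - 1)) ^ (n - m)) =
      real m * real (n choose m) * (a ^ m * (1 - a) ^ (n - m))" by (simp add: a_def)
  also have "\<dots> \<le> real m * (real n ^ m * exp (real m) / real m ^ m) * (a ^ m * (exp (1 / (1 - s)) * exp (- \<rho>) ^ m))"
    using c e a by (intro mult_mono mult_left_mono) auto
  also have "\<dots> = real m * exp (1 / (1 - s)) * (\<rho> * exp (1 - \<rho>)) ^ m"
  proof -
    have "exp (real m) = exp 1 ^ m" using exp_of_nat_mult[of m "1::real"] by simp
    moreover have "\<rho> ^ m = real n ^ m * a ^ m / real m ^ m" by (simp add: \<rho>_def a_def power_divide power_mult_distrib)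
    moreover have "exp (1 - \<rho>) ^ m = exp 1 ^ m * exp (- \<rho>) ^ m" by (simp add: power_mult_distrib[symmetric] flip: exp_add)
    ultimately show ?thesis by (simp add: power_mult_distrib)
  qed
  finally show ?thesis .
qed

context edge_probability
begin

text \<open>With \<open>h = sqrt s\<close> this \<open>n\<close> lies midway, on the logarithmic
  scale, between the critical values for sizes \<open>K\<close> and \<open>K + 1\<close>:
  \<open>\<rho>\<close> is about \<open>1 / h\<close> at \<open>K\<close> and about \<open>h\<close>
  at \<open>K + 1\<close>, so no size has \<open>\<rho>\<close> near 1. \<open>\<gamma>\<close>
  bounds \<open>\<rho> * exp (1 - \<rho>)\<close> for sizes up to \<open>K\<close>, and
  \<open>\<theta>\<^sup>2\<close> does so above \<open>K\<close>.\<close>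

lemma crit_upper_bound:
  fixes b :: bool and K n :: nat
  defines "s \<equiv> bp p (\<not> b)"
  defines "h \<equiv> sqrt s"
  defines "\<gamma> \<equiv> 1 / h * exp (1 - 1 / h)" and "\<theta> \<equiv> sqrt ((1 + h) / 2 * exp (1 - (1 + h) / 2))"
  defines "n \<equiv> nat \<lceil>real K / (s ^ (K - 1) * h)\<rceil>"
  assumes crit: "bp p b = s\<^sup>2" and K: "2 \<le> K"
  shows "Pr n (crit b {1..n}) \<le> exp (1 / (1 - s)) *
    (2 * exp 1 * (real K ^ 2 * max s \<gamma> ^ (K - 1)) + \<theta> ^ K / (1 - \<theta>)\<^sup>2)"
proof -
  have s: "0 < s" "s < 1" using bp_pos bp_less_1 by (auto simp: s_def)
  have h: "0 < h" "h < 1" "s = h * h" using s by (auto simp: h_def)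
  define C where "C = exp (1 / (1 - s))"
  have C: "0 < C" by (simp add: C_def)
  \<comment> \<open>Halfway between \<open>h\<close> and 1, which leaves room for the rounding of
    \<open>n\<close>.\<close>
  define \<eta> where "\<eta> = (1 + h) / 2"
  have \<eta>: "0 < \<eta>" "\<eta> < 1" using h by (auto simp: \<eta>_def)
  have \<gamma>: "0 < \<gamma>" "\<gamma> < 1" unfolding \<gamma>_def using h by (simp, intro bump_less_1) auto
  define \<gamma>' where "\<gamma>' = \<eta> * exp (1 - \<eta>)"
  have \<gamma>': "0 < \<gamma>'" "\<gamma>' < 1" unfolding \<gamma>'_def using \<eta> by (simp, intro bump_less_1) auto
  have \<theta>: "0 < \<theta>" "\<theta> < 1" "\<theta> * \<theta> = \<gamma>'"
    using \<gamma>' unfolding \<theta>_def \<eta>_def[symmetric] \<gamma>'_def[symmetric] by auto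
  define \<delta> where "\<delta> = max s \<gamma>"
  have \<delta>: "0 < \<delta>" "s \<le> \<delta>" "\<gamma> \<le> \<delta>" using s by (auto simp: \<delta>_def)
  define \<rho> where "\<rho> m = real n * s ^ (m - 1) / real m" for m
  have n1: "real K / h \<le> real n * s ^ (K - 1)"
  proof -
    have "real K / (s ^ (K - 1) * h) \<le> real n" unfolding n_def by linarith
    then show ?thesis using s h by (simp add: field_simps)
  qed
  have n2: "real n * s ^ (K - 1) \<le> real K / h + s ^ (K - 1)"
  proof -
    have "0 \<le> real K / (s ^ (K - 1) * h)" using s h by simp
    then have "real n \<le> real K / (s ^ (K - 1) * h) + 1" unfolding n_def by linarith
    then have "real n * s ^ (K - 1) \<le> (real K / (s ^ (K - 1) * h) + 1) * s ^ (K - 1)"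
      using s by (intro mult_right_mono) auto
    also have "\<dots> = real K / h + s ^ (K - 1)" using s h by (simp add: field_simps)
    finally show ?thesis .
  qed
  let ?T = "\<lambda>m. real m * C * (\<rho> m * exp (1 - \<rho> m)) ^ m"
  have small: "?T m \<le> real K * C * (2 * exp 1 * \<delta> ^ (K - 1))" if m: "m \<in> {2..n}" "m \<le> K" for m
  proof -
    have m': "2 \<le> m" "m \<le> K" using m by auto
    have pw: "s ^ (K - 1) = s ^ (m - 1) * s ^ (K - m)"
      unfolding power_add[symmetric] using m' by (intro arg_cong[where f = "power s"]) simp
    have "1 / h * real m \<le> real K / h" using m' h by (simp add: field_simps)
    also have "\<dots> \<le> real n * (s ^ (m - 1) * s ^ (K - m))" using n1 unfolding pw .
    finally have r: "1 / h \<le> \<rho> m * s ^ (K - m)" using m' by (simp add: \<rho>_def field_simps)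
    have \<rho>0: "0 < \<rho> m" using m' n1 m h s unfolding \<rho>_def by simp
    have sp: "0 < s ^ (K - m)" "s ^ (K - m) \<le> 1" using s by (auto simp: power_le_one)
    have r1: "1 / h \<le> \<rho> m"
    proof -
      have "\<rho> m * s ^ (K - m) \<le> \<rho> m * 1" using \<rho>0 sp by (intro mult_left_mono) auto
      then show ?thesis using r by simp
    qed
    have "1 < 1 / h" using h by simp
    then have r2: "1 / \<rho> m \<le> s ^ (K - m)"
    proof -
      have "1 \<le> \<rho> m * s ^ (K - m)" using r \<open>1 < 1 / h\<close> by linarith
      then show ?thesis using \<rho>0 by (simp add: field_simps)
    qed
    have g1: "\<rho> m * exp (1 - \<rho> m) \<le> 2 * exp 1 * \<delta> ^ (K - m)"
    proof -
      have "\<rho> m * exp (1 - \<rho> m) \<le> 2 * exp 1 * (1 / \<rho> m)" using bump_le_inverse[OF \<rho>0] by simp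
      also have "\<dots> \<le> 2 * exp 1 * s ^ (K - m)" using r2 by (intro mult_left_mono) auto
      also have "\<dots> \<le> 2 * exp 1 * \<delta> ^ (K - m)" using \<delta> s by (intro mult_left_mono power_mono) auto
      finally show ?thesis .
    qed
    have g2: "(\<rho> m * exp (1 - \<rho> m)) ^ (m - 1) \<le> \<delta> ^ (m - 1)"
    proof (rule power_mono)
      have "\<rho> m * exp (1 - \<rho> m) \<le> \<gamma>" unfolding \<gamma>_def using r1 h by (intro bump_mono_right) auto
      then show "\<rho> m * exp (1 - \<rho> m) \<le> \<delta>" using \<delta> by linarith
    qed (use \<rho>0 in simp)
    \<comment> \<open>One of the \<open>m\<close> factors is estimated by its decay in
      \<open>K - m\<close>, the others by the constant \<open>\<delta>\<close>. Together they give
      \<open>\<delta> ^ (K - 1)\<close>, the same bound for every size up to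
      \<open>K\<close>.\<close>
    have "(\<rho> m * exp (1 - \<rho> m)) ^ m = (\<rho> m * exp (1 - \<rho> m)) * (\<rho> m * exp (1 - \<rho> m)) ^ (m - 1)"
      using m' by (cases m) auto
    also have "\<dots> \<le> (2 * exp 1 * \<delta> ^ (K - m)) * \<delta> ^ (m - 1)"
      using \<rho>0 \<delta> by (intro mult_mono[OF g1 g2]) auto
    also have "\<dots> = 2 * exp 1 * \<delta> ^ (K - m + (m - 1))" by (simp add: power_add)
    also have "K - m + (m - 1) = K - 1" using m' by simp
    finally have "(\<rho> m * exp (1 - \<rho> m)) ^ m \<le> 2 * exp 1 * \<delta> ^ (K - 1)" .
    then show ?thesis using m' C \<rho>0 by (intro mult_mono) auto
  qed
  have large: "?T m \<le> C * (1 / (1 - \<theta>) * \<theta> ^ m)" if m: "m \<in> {2..n}" "K < m" for m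
  proof -
    have m': "2 \<le> m" "K < m" using m by auto
    have pw: "s ^ (m - 1) = s ^ (K - 1) * s ^ (m - K)"
      unfolding power_add[symmetric] using m' K by (intro arg_cong[where f = "power s"]) simp
    have "real n * s ^ (m - 1) \<le> (real K / h + s ^ (K - 1)) * s ^ (m - K)"
      unfolding pw using mult_right_mono[OF n2, of "s ^ (m - K)"] s by (simp add: mult.assoc)
    also have "\<dots> \<le> (real K / h + 1) * s"
    proof (rule mult_mono)
      show "real K / h + s ^ (K - 1) \<le> real K / h + 1" using s by (simp add: power_le_one)
      have "s ^ (m - K) \<le> s ^ 1" using m' s by (intro power_decreasing) auto
      then show "s ^ (m - K) \<le> s" by simp
    qed (use s h in auto)
    also have "\<dots> = real K * h + s" using h by (simp add: field_simps)
    also have "\<dots> \<le> (real K + 1) * \<eta>"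
    proof -
      have "0 \<le> (real K - 1) * (1 - h)" using K h by simp
      then show ?thesis using s by (simp add: \<eta>_def field_simps)
    qed
    also have "\<dots> \<le> real m * \<eta>" using m' \<eta> by (intro mult_right_mono) auto
    finally have "\<rho> m \<le> \<eta>" using m' by (simp add: \<rho>_def field_simps)
    moreover have \<rho>0: "0 \<le> \<rho> m" using s by (simp add: \<rho>_def)
    ultimately have "\<rho> m * exp (1 - \<rho> m) \<le> \<theta> * \<theta>" unfolding \<theta>(3) \<gamma>'_def using \<eta> by (intro bump_mono_left) auto
    then have "(\<rho> m * exp (1 - \<rho> m)) ^ m \<le> (\<theta> * \<theta>) ^ m" using \<rho>0 by (intro power_mono) auto
    then have "?T m \<le> real m * C * (\<theta> * \<theta>) ^ m" using C by (intro mult_left_mono) auto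
    also have "\<dots> = C * ((real m * \<theta> ^ m) * \<theta> ^ m)" by (simp add: power_mult_distrib)
    \<comment> \<open>The square root in \<open>\<theta>\<close> splits the decay into two powers:
      one absorbs the factor \<open>m\<close>, the other is summed.\<close>
    also have "\<dots> \<le> C * (1 / (1 - \<theta>) * \<theta> ^ m)"
    proof (intro mult_left_mono mult_right_mono)
      have "real m * \<theta> ^ m \<le> real m * \<theta> ^ (m - 1)" using \<theta> by (intro mult_left_mono power_decreasing) auto
      also have "\<dots> \<le> 1 / (1 - \<theta>)" using mult_power_le_geometric[of \<theta> "m - 1"] \<theta> m' by simp
      finally show "real m * \<theta> ^ m \<le> 1 / (1 - \<theta>)" .
    qed (use C \<theta> in auto)
    finally show ?thesis .
  qed
  have "Pr n (crit b {1..n}) \<le>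
      (\<Sum>m=2..n. real m * real (n choose m) * (bp p b ^ (m choose 2) * (1 - s ^ (m - 1)) ^ (n - m)))"
    unfolding s_def by (rule pr_crit_upper)
  also have "\<dots> \<le> (\<Sum>m=2..n. ?T m)"
    unfolding crit choose_two_square C_def \<rho>_def
    by (intro sum_mono critical_expectation_term s) auto
  also have "\<dots> \<le> (\<Sum>m=2..n. (if m \<le> K then real K * C * (2 * exp 1 * \<delta> ^ (K - 1)) else 0) +
      (if K < m then C * (1 / (1 - \<theta>) * \<theta> ^ m) else 0))"
    by (rule sum_mono) (use small large in \<open>auto simp: not_le\<close>)
  also have "\<dots> = (\<Sum>m\<in>{m\<in>{2..n}. m \<le> K}. real K * C * (2 * exp 1 * \<delta> ^ (K - 1))) +
      (\<Sum>m\<in>{m\<in>{2..n}. K < m}. C * (1 / (1 - \<theta>) * \<theta> ^ m))"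
    unfolding sum.distrib by (intro arg_cong2[where f = "(+)"] sum.inter_filter[symmetric]) simp_all
  also have "\<dots> \<le> real K * (real K * C * (2 * exp 1 * \<delta> ^ (K - 1))) + C * (1 / (1 - \<theta>) * (\<theta> ^ K / (1 - \<theta>)))"
  proof (rule add_mono)
    have "card {m\<in>{2..n}. m \<le> K} \<le> card {1..K}" by (rule card_mono) auto
    then have "real (card {m\<in>{2..n}. m \<le> K}) \<le> real K" by simp
    then show "(\<Sum>m\<in>{m\<in>{2..n}. m \<le> K}. real K * C * (2 * exp 1 * \<delta> ^ (K - 1))) \<le>
        real K * (real K * C * (2 * exp 1 * \<delta> ^ (K - 1)))"
      using C \<delta> unfolding sum_constant by (intro mult_right_mono) auto
    have "(\<Sum>m\<in>{m\<in>{2..n}. K < m}. \<theta> ^ m) \<le> (\<Sum>m\<in>{K..K + n}. \<theta> ^ m)"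
      using \<theta> by (intro sum_mono2) auto
    also have "\<dots> = \<theta> ^ K * (\<Sum>j\<le>n. \<theta> ^ j)"
      unfolding sum_distrib_left
      by (rule sum.reindex_bij_witness[of _ "\<lambda>j. K + j" "\<lambda>m. m - K"]) (auto simp flip: power_add)
    also have "\<dots> \<le> \<theta> ^ K * (1 / (1 - \<theta>))" using \<theta> by (intro mult_left_mono sum_power_le_geometric) auto
    finally have "(\<Sum>m\<in>{m\<in>{2..n}. K < m}. \<theta> ^ m) \<le> \<theta> ^ K / (1 - \<theta>)" by simp
    then have "C * (1 / (1 - \<theta>) * (\<Sum>m\<in>{m\<in>{2..n}. K < m}. \<theta> ^ m)) \<le> C * (1 / (1 - \<theta>) * (\<theta> ^ K / (1 - \<theta>)))"
      using C \<theta> by (intro mult_left_mono) auto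
    then show "(\<Sum>m\<in>{m\<in>{2..n}. K < m}. C * (1 / (1 - \<theta>) * \<theta> ^ m)) \<le> C * (1 / (1 - \<theta>) * (\<theta> ^ K / (1 - \<theta>)))"
      by (simp only: sum_distrib_left)
  qed
  also have "\<dots> = C * (2 * exp 1 * (real K ^ 2 * \<delta> ^ (K - 1)) + \<theta> ^ K / (1 - \<theta>)\<^sup>2)"
    by (simp add: power2_eq_square algebra_simps)
  finally show ?thesis unfolding C_def \<delta>_def .
qed

text \<open>A limit \<open>L\<close> would satisfy \<open>c \<le> L\<close> along the sizes
  \<open>f m\<close>, where \<open>\<rho>\<close> is near 1, and \<open>L \<le> 0\<close> along the
  midway sizes \<open>g K\<close>, where the upper bound \<open>B K\<close> vanishes.\<close>

lemma crit_not_convergent: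
  fixes b :: bool
  assumes crit: "bp p (\<not> b) = sqrt (bp p b)"
  shows "\<not> convergent (\<lambda>n. Pr n (crit b {1..n}))"
proof
  define s h where "s = bp p (\<not> b)" and "h = sqrt s"
  have s: "0 < s" "s < 1" using bp_pos bp_less_1 by (auto simp: s_def)
  have h: "0 < h" "h < 1" using s by (auto simp: h_def)
  have q: "bp p b = s\<^sup>2" using crit bp_pos[of b] by (simp add: s_def)
  assume "convergent (\<lambda>n. Pr n (crit b {1..n}))"
  then obtain L where L: "(\<lambda>n. Pr n (crit b {1..n})) \<longlonglongrightarrow> L" by (auto simp: convergent_def)
  define c where "c = 1 / (2 * (4 * exp 1 + 4 * exp 2) + (1 + 2 * exp 2 / (1 - s)) * (2 * exp 2))"
  have c: "0 < c" using s by (simp add: c_def add_pos_pos)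
  define f where "f m = nat \<lfloor>real m / s ^ (m - 1)\<rfloor>" for m
  have f: "filterlim f at_top sequentially"
  proof (rule filterlim_at_top_mono[OF filterlim_ident], rule always_eventually, rule allI)
    fix m
    have "s ^ (m - 1) \<le> 1" "0 < s ^ (m - 1)" using s by (auto simp: power_le_one)
    then have "real m \<le> real m / s ^ (m - 1)" by (simp add: field_simps mult_left_le)
    then show "m \<le> f m" unfolding f_def by linarith
  qed
  have e1: "\<forall>\<^sub>F m in sequentially. 4 * real m * s ^ (m - 1) < 1"
  proof -
    have "(\<lambda>m. 4 / s * (real m ^ 1 * s ^ m)) \<longlonglongrightarrow> 4 / s * 0"
      using s by (intro tendsto_mult tendsto_const poly_times_power_tendsto_0) auto
    then have "\<forall>\<^sub>F m in sequentially. 4 / s * (real m ^ 1 * s ^ m) < 1" by (rule order_tendstoD) simp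
    then show ?thesis using eventually_ge_at_top[of 1]
    proof eventually_elim
      case (elim m)
      then have "s ^ m = s ^ (m - 1) * s" by (cases m) auto
      then show ?case using elim s by simp
    qed
  qed
  have e2: "\<forall>\<^sub>F m in sequentially. (real m + 1) * h ^ m / s < 1"
  proof -
    have "(\<lambda>m. (real m ^ 1 * h ^ m + real m ^ 0 * h ^ m) / s) \<longlonglongrightarrow> (0 + 0) / s"
      using s h by (intro tendsto_divide tendsto_add tendsto_const poly_times_power_tendsto_0) auto
    then have "\<forall>\<^sub>F m in sequentially. (real m ^ 1 * h ^ m + real m ^ 0 * h ^ m) / s < 1" by (rule order_tendstoD) simp
    then show ?thesis by (simp add: distrib_right)
  qed
  have e3: "\<forall>\<^sub>F m in sequentially. real m ^ 2 * h ^ m < 1 / 2"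
    by (rule order_tendstoD(2)[OF poly_times_power_tendsto_0]) (use h in auto)
  have e4: "\<forall>\<^sub>F m in sequentially. real m ^ 3 * h ^ m < 1"
    by (rule order_tendstoD(2)[OF poly_times_power_tendsto_0]) (use h in auto)
  have "\<forall>\<^sub>F m in sequentially. c \<le> Pr (f m) (crit b {1..f m})"
    using e1 e2 e3 e4 eventually_ge_at_top[of 2]
  proof eventually_elim
    case (elim m)
    have "real m * (real m ^ 2 * h ^ m) \<le> 1" using elim by (simp add: power2_eq_square power3_eq_cube mult.assoc)
    then show ?case
      using crit_lower_bound[of b m, folded s_def, folded h_def, OF q] elim unfolding c_def f_def by simp
  qed
  moreover have "(\<lambda>m. Pr (f m) (crit b {1..f m})) \<longlonglongrightarrow> L" using filterlim_compose[OF L f] .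
  ultimately have cL: "c \<le> L" by (intro tendsto_lowerbound) auto
  define g where "g K = nat \<lceil>real K / (s ^ (K - 1) * h)\<rceil>" for K
  have g: "filterlim g at_top sequentially"
  proof (rule filterlim_at_top_mono[OF filterlim_ident], rule always_eventually, rule allI)
    fix K
    have "s ^ (K - 1) * h \<le> 1" "0 < s ^ (K - 1) * h" using s h by (auto simp: power_le_one mult_le_one)
    moreover have "real K * (s ^ (K - 1) * h) \<le> real K * 1" using calculation by (intro mult_left_mono) auto
    ultimately have "real K \<le> real K / (s ^ (K - 1) * h)" by (simp only: pos_le_divide_eq mult_1_right)
    then show "K \<le> g K" unfolding g_def by linarith
  qed
  define \<gamma> \<theta> where "\<gamma> = 1 / h * exp (1 - 1 / h)" and "\<theta> = sqrt ((1 + h) / 2 * exp (1 - (1 + h) / 2))"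
  have \<gamma>: "\<gamma> < 1" unfolding \<gamma>_def using h by (intro bump_less_1) auto
  have \<theta>: "0 \<le> \<theta>" "\<theta> < 1" unfolding \<theta>_def using h bump_less_1[of "(1 + h) / 2"] by auto
  define \<delta> where "\<delta> = max s \<gamma>"
  have \<delta>: "0 < \<delta>" "\<delta> < 1" using s \<gamma> by (auto simp: \<delta>_def)
  define B where "B K = exp (1 / (1 - s)) * (2 * exp 1 * (real K ^ 2 * \<delta> ^ K / \<delta>) + \<theta> ^ K / (1 - \<theta>)\<^sup>2)" for K
  have "B \<longlonglongrightarrow> exp (1 / (1 - s)) * (2 * exp 1 * (0 / \<delta>) + 0 / (1 - \<theta>)\<^sup>2)"
    unfolding B_def using \<delta> \<theta>
    by (intro tendsto_mult tendsto_add tendsto_divide tendsto_const poly_times_power_tendsto_0 LIMSEQ_power_zero) auto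
  then have B: "B \<longlonglongrightarrow> 0" by simp
  have "\<forall>\<^sub>F K in sequentially. Pr (g K) (crit b {1..g K}) \<le> B K"
    using eventually_ge_at_top[of 2]
  proof eventually_elim
    case (elim K)
    have e: "\<delta> ^ K / \<delta> = \<delta> ^ (K - 1)" using elim \<delta> by (cases K) auto
    have "real K ^ 2 * \<delta> ^ K / \<delta> = real K ^ 2 * \<delta> ^ (K - 1)"
      unfolding times_divide_eq_right[symmetric] e ..
    then have BK: "B K = exp (1 / (1 - s)) * (2 * exp 1 * (real K ^ 2 * \<delta> ^ (K - 1)) + \<theta> ^ K / (1 - \<theta>)\<^sup>2)"
      unfolding B_def by (simp only:)
    show ?case
      using crit_upper_bound[of b K, folded s_def, folded h_def, OF q elim]
      unfolding BK g_def \<delta>_def \<gamma>_def \<theta>_def .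
  qed
  moreover have "(\<lambda>K. Pr (g K) (crit b {1..g K})) \<longlonglongrightarrow> L" using filterlim_compose[OF L g] .
  ultimately have "L \<le> 0" by (intro tendsto_le[OF _ B]) auto
  then show False using cL c by linarith
qed

end

theorem theorem2:
  fixes p :: real
  assumes "0 < p" and "p < 1"
  shows "(zero_one_law_E12 p \<longleftrightarrow> p \<notin> {(3 - sqrt 5) / 2, (sqrt 5 - 1) / 2})
       \<and> (p \<in> {(3 - sqrt 5) / 2, (sqrt 5 - 1) / 2} \<longrightarrow> \<not> convergence_law_E12 p)"
proof -
  interpret edge_probability p using assms by unfold_locales
  have "\<not> convergence_law_E12 p" if crit: "bp p (\<not> b) = sqrt (bp p b)" for b
  proof
    assume "convergence_law_E12 p"
    then have "convergent (\<lambda>n. prob_Gnp n p (crit_fo b))" using E12_crit_fo unfolding convergence_law_E12_def by blast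
    then show False using crit_not_convergent[OF crit] unfolding prob_Gnp_eq_Pr models_crit_fo by blast
  qed
  moreover have "convergence_law_E12 p" if "zero_one_law_E12 p"
    using that unfolding zero_one_law_E12_def convergence_law_E12_def convergent_def by blast
  ultimately show ?thesis
    unfolding golden_iff_critical[OF assms] using zero_one_law_noncritical by blast
qed

end
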